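(* Let $D,f_0>0$, let $A(t)$ and $L(t)$ be twice continuously differentiable, and let $L_0=L(0)$. Suppose that $$\ddot L(t)L(t)^3\le\gamma_0^+\qquad\text{and}\qquad \ddot A(t)L(t)^3\le\gamma_1^+$$ for some constants $\gamma_0^+,\gamma_1^+$. Then, for any given initial conditions $u(\xi,0)$ in $L^2([0,L_0])$, the solution $u(\xi,t)$ of the transformed problem (see context) can be bounded above by a sum of the functions $$u_n(\xi,t)=\exp\Big(\sigma_n\int_0^t\frac{L_0^2}{L(\zeta)^2}d\zeta\Big)g_n(\xi)\Big(\frac{L_0}{L(t)}\Big)^{1/2}\exp\Big(f_0t-\int_0^t\frac{\dot A(\zeta)^2}{4D}d\zeta-\frac{\xi^2\dot L(t)L(t)}{4DL_0^2}-\frac{\xi\dot A(t)L(t)}{2DL_0}\Big),$$ where the eigenfunctions $g_n(\xi)$ and eigenvalues $\sigma_n$ satisfy the Sturm–Liouville problem $$\sigma g(\xi)=Dg''(\xi)+\Big(\frac{\gamma_0^+\xi^2}{4DL_0^4}+\frac{\gamma_1^+\xi}{2DL_0^3}\Big)g(\xi)\ \text{ in } 0<\xi<L_0,\qquad g=0\ \text{ at }\xi=0\text{ and }\xi=L_0.$$ If the hypothesis holds with both inequalities reversed, then the solution $u(\xi,t)$ can instead be bounded below by a sum of the $u_n(\xi,t)$.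
   Context: The original problem is $\psi_t=D\psi_{xx}+f_0\psi$ in $A(t)<x<A(t)+L(t)$, with $\psi=0$ at both endpoints and $\psi\ge0$. With $\xi=\frac{x-A(t)}{L(t)}L_0$ and $u(\xi,t)=\psi(x,t)$ it becomes the transformed problem $$u_t=D\frac{L_0^2}{L(t)^2}u_{\xi\xi}+\frac{\dot A(t)L_0+\xi\dot L(t)}{L(t)}u_\xi+f_0u\ \text{ in } 0<\xi<L_0,\qquad u=0\ \text{ at }\xi=0\text{ and }\xi=L_0.$$ A "sum of the $u_n$" means a linear combination (possibly infinite, as in an eigenfunction expansion) of the $u_n$ with constant coefficients. Dots denote derivatives with respect to $t$. *)

theory Defs
  imports "HOL-Analysis.Analysis"
begin

text \<open>Twice continuous differentiability on \<open>t \<ge> 0\<close>, with one-sided derivatives at \<open>t = 0\<close>.\<close>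

definition C2_halfline ::
  "(real \<Rightarrow> real) \<Rightarrow> (real \<Rightarrow> real) \<Rightarrow> (real \<Rightarrow> real) \<Rightarrow> bool" where
  "C2_halfline f f' f'' \<longleftrightarrow>
     (\<forall>t\<ge>0. (f has_real_derivative f' t) (at t within {0..}) \<and>
             (f' has_real_derivative f'' t) (at t within {0..})) \<and>
     continuous_on {0..} f''"

definition L2_on :: "real set \<Rightarrow> (real \<Rightarrow> real) \<Rightarrow> bool" where
  "L2_on S f \<longleftrightarrow>
     f \<in> borel_measurable (lebesgue_on S) \<and> integrable (lebesgue_on S) (\<lambda>x. (f x)\<^sup>2)"

text \<open>
  The Bochner integral of a non-integrable function is \<open>0\<close>, so this is the squared
  distance only when both arguments are in \<open>L2_on S\<close>.  Below, one argument is always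
  continuous on a compact interval and the other is assumed to be square integrable.
\<close>

definition L2_dist_sq :: "real set \<Rightarrow> (real \<Rightarrow> real) \<Rightarrow> (real \<Rightarrow> real) \<Rightarrow> real" where
  "L2_dist_sq S f h = (LINT x|lebesgue_on S. (f x - h x)\<^sup>2)"

text \<open>
  Classical nonnegative solutions of the transformed problem for \<open>t > 0\<close>: continuous up to
  the lateral boundary, with continuous \<open>u\<^sub>t\<close>, \<open>u\<^sub>\<xi>\<close>, \<open>u\<^sub>\<xi>\<^sub>\<xi>\<close> in the interior.  The initial
  datum \<open>\<lambda>\<xi>. u \<xi> 0\<close> represents an element of \<open>L\<^sup>2\<close> and is attained as the \<open>L\<^sup>2\<close> limit
  of \<open>u(\<cdot>,t)\<close> as \<open>t\<close> decreases to \<open>0\<close>.  The arguments \<open>A'\<close>, \<open>L'\<close> are the time derivatives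
  of \<open>A\<close>, \<open>L\<close>, and \<open>L\<^sub>0 = L 0\<close>.
\<close>

definition transformed_solution ::
  "real \<Rightarrow> real \<Rightarrow> (real \<Rightarrow> real) \<Rightarrow> (real \<Rightarrow> real) \<Rightarrow> (real \<Rightarrow> real) \<Rightarrow>
   (real \<Rightarrow> real \<Rightarrow> real) \<Rightarrow> bool" where
  "transformed_solution D f0 A' L L' u \<longleftrightarrow>
     continuous_on ({0..L 0} \<times> {0<..}) (\<lambda>(\<xi>, t). u \<xi> t) \<and>
     (\<exists>ut ux uxx.
        continuous_on ({0<..<L 0} \<times> {0<..}) (\<lambda>(\<xi>, t). ut \<xi> t) \<and>
        continuous_on ({0<..<L 0} \<times> {0<..}) (\<lambda>(\<xi>, t). ux \<xi> t) \<and>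
        continuous_on ({0<..<L 0} \<times> {0<..}) (\<lambda>(\<xi>, t). uxx \<xi> t) \<and>
        (\<forall>t>0. \<forall>\<xi>\<in>{0<..<L 0}.
           ((\<lambda>s. u \<xi> s) has_real_derivative ut \<xi> t) (at t) \<and>
           ((\<lambda>x. u x t) has_real_derivative ux \<xi> t) (at \<xi>) \<and>
           ((\<lambda>x. ux x t) has_real_derivative uxx \<xi> t) (at \<xi>) \<and>
           ut \<xi> t = D * (L 0)\<^sup>2 / (L t)\<^sup>2 * uxx \<xi> t
                    + (A' t * L 0 + \<xi> * L' t) / L t * ux \<xi> t + f0 * u \<xi> t)) \<and>
     (\<forall>t>0. u 0 t = 0 \<and> u (L 0) t = 0) \<and>
     (\<forall>t>0. \<forall>\<xi>\<in>{0..L 0}. 0 \<le> u \<xi> t) \<and>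
     ((\<lambda>t. L2_dist_sq {0..L 0} (\<lambda>\<xi>. u \<xi> t) (\<lambda>\<xi>. u \<xi> 0)) \<longlongrightarrow> 0) (at_right 0)"

definition SL_eigenpair ::
  "real \<Rightarrow> real \<Rightarrow> real \<Rightarrow> real \<Rightarrow> real \<Rightarrow> (real \<Rightarrow> real) \<Rightarrow> bool" where
  "SL_eigenpair D L0 \<gamma>0 \<gamma>1 \<sigma> g \<longleftrightarrow>
     continuous_on {0..L0} g \<and> g 0 = 0 \<and> g L0 = 0 \<and> (\<exists>\<xi>\<in>{0<..<L0}. g \<xi> \<noteq> 0) \<and>
     (\<exists>g' g''. \<forall>\<xi>\<in>{0<..<L0}.
        (g has_real_derivative g' \<xi>) (at \<xi>) \<and>
        (g' has_real_derivative g'' \<xi>) (at \<xi>) \<and>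
        \<sigma> * g \<xi> = D * g'' \<xi>
          + (\<gamma>0 * \<xi>\<^sup>2 / (4 * D * L0 ^ 4) + \<gamma>1 * \<xi> / (2 * D * L0 ^ 3)) * g \<xi>)"

text \<open>
  The eigenvalues of this regular problem are simple and form an infinite sequence, so
  a full system of eigenfunctions is obtained by choosing one eigenfunction for each eigenvalue.
  Neither the order of enumeration nor the normalisation of the eigenfunctions is prescribed.
\<close>

definition SL_eigensystem ::
  "real \<Rightarrow> real \<Rightarrow> real \<Rightarrow> real \<Rightarrow> (nat \<Rightarrow> real) \<Rightarrow> (nat \<Rightarrow> real \<Rightarrow> real) \<Rightarrow> bool" where
  "SL_eigensystem D L0 \<gamma>0 \<gamma>1 \<sigma> g \<longleftrightarrow>
     (\<forall>n. SL_eigenpair D L0 \<gamma>0 \<gamma>1 (\<sigma> n) (g n)) \<and> inj \<sigma> \<and>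
     (\<forall>s h. SL_eigenpair D L0 \<gamma>0 \<gamma>1 s h \<longrightarrow> s \<in> range \<sigma>)"

definition mode ::
  "real \<Rightarrow> real \<Rightarrow> (real \<Rightarrow> real) \<Rightarrow> (real \<Rightarrow> real) \<Rightarrow> (real \<Rightarrow> real) \<Rightarrow>
   real \<Rightarrow> (real \<Rightarrow> real) \<Rightarrow> real \<Rightarrow> real \<Rightarrow> real" where
  "mode D f0 A' L L' \<sigma> g \<xi> t =
     exp (\<sigma> * integral {0..t} (\<lambda>\<zeta>. (L 0)\<^sup>2 / (L \<zeta>)\<^sup>2)) * g \<xi> * (L 0 / L t) powr (1/2) *
     exp (f0 * t - integral {0..t} (\<lambda>\<zeta>. (A' \<zeta>)\<^sup>2 / (4 * D))
          - \<xi>\<^sup>2 * L' t * L t / (4 * D * (L 0)\<^sup>2) - \<xi> * A' t * L t / (2 * D * L 0))"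

text \<open>
  The series \<open>\<Sum>n. c n * v n \<xi> t\<close> is the expansion attached to the initial condition of \<open>u\<close>: it
  converges pointwise for \<open>t > 0\<close>, and at \<open>t = 0\<close> its partial sums converge in
  \<open>L\<^sup>2(0,L\<^sub>0)\<close> to \<open>u(\<cdot>,0)\<close>.  Without the latter condition the zero series would be a
  trivial lower bound for the nonnegative function \<open>u\<close>.
\<close>

definition expansion_of_initial ::
  "real \<Rightarrow> (nat \<Rightarrow> real \<Rightarrow> real \<Rightarrow> real) \<Rightarrow> (real \<Rightarrow> real \<Rightarrow> real) \<Rightarrow> (nat \<Rightarrow> real) \<Rightarrow> bool" where
  "expansion_of_initial L0 v u c \<longleftrightarrow>
     (\<lambda>N. L2_dist_sq {0..L0} (\<lambda>\<xi>. \<Sum>n<N. c n * v n \<xi> 0) (\<lambda>\<xi>. u \<xi> 0)) \<longlonglongrightarrow> 0 \<and>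
     (\<forall>t>0. \<forall>\<xi>\<in>{0..L0}. summable (\<lambda>n. c n * v n \<xi> t))"

end

theory Submission
  imports Defs "HOL-Complex_Analysis.Great_Picard"
begin

text \<open>
  Dividing \<open>u\<close> by the factor of the modes that does not depend on \<open>n\<close> removes the drift: the quotient
  \<open>w \<ge> 0\<close> satisfies \<open>w\<^sub>t = (L\<^sub>0\<^sup>2 / L\<^sup>2) (D w\<^sub>\<xi>\<^sub>\<xi> + q w)\<close>, where the hypothesis says precisely that \<open>q \<le> Q\<close>
  for the potential \<open>Q\<close> of the Sturm--Liouville problem (respectively \<open>q \<ge> Q\<close>).  The parabolic maximum
  principle therefore compares \<open>w\<close> with solutions of the same equation with \<open>Q\<close> in place of \<open>q\<close>.

  Finite combinations of the eigenfunctions are uniformly dense among the continuous functions vanishing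
  at both ends, because the Green operator is compact and symmetric.  So at a small time \<open>\<tau>\<close> the function
  \<open>w\<close> is uniformly close to such a combination, whose evolution under the \<open>Q\<close>-equation is explicit.  As
  \<open>\<tau> \<rightarrow> 0\<close>, the coefficients converge to those of the initial datum, and the eigenvalue asymptotics
  provided by Bessel's inequality for the Green kernel allow passing to the limit in the series.
\<close>

section \<open>Maximum principles\<close>

text \<open>Three obstacles shape the argument. The datum is only square integrable, whereas the
  maximum principle compares pointwise values; comparison therefore starts at a time
  \<open>\<tau> > 0\<close>, needs uniform and not merely L2 approximation, and returns to time 0
  through the coefficients, which are continuous for the L2 norm. The potential \<open>Q\<close> has
  no definite sign; a constant \<open>\<kappa>\<close> above it makes
  \<open>D u'' + (Q - \<kappa>) u\<close> obey the maximum principle, which yields uniqueness, a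
  Green operator and positive eigenvalues, and which also makes the parabolic inequality strict. The
  eigensystem is given only as an exhaustive list of eigenvalues, so completeness has to be proved.
  The comparison functions may change sign; only \<open>w \<ge> 0\<close> is used, because the
  difference of the potentials multiplies \<open>w\<close> alone.\<close>

lemma second_derivative_nonpos_at_local_max:
  fixes f :: "real \<Rightarrow> real"
  assumes "x \<in> {a<..<b}"
    and max: "\<And>y. y \<in> {a<..<b} \<Longrightarrow> f y \<le> f x"
    and f': "\<And>y. y \<in> {a<..<b} \<Longrightarrow> (f has_real_derivative f' y) (at y)"
    and f'': "(f' has_real_derivative d) (at x)"
  shows "d \<le> 0"
proof (rule ccontr)
  assume "\<not> d \<le> 0"
  then have "d > 0" by simp
  have "f' x = 0"
  proof (rule DERIV_local_max[OF f'])
    show "0 < min (x - a) (b - x)" using assms(1) by auto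
    show "\<forall>y. \<bar>x - y\<bar> < min (x - a) (b - x) \<longrightarrow> f y \<le> f x"
      by (intro allI impI max) auto
  qed (use assms(1) in auto)
  obtain \<delta> where "\<delta> > 0" and \<delta>: "\<And>h. 0 < h \<Longrightarrow> h < \<delta> \<Longrightarrow> f' x < f' (x + h)"
    using DERIV_pos_inc_right[OF f'' \<open>d > 0\<close>] by blast
  define y where "y = x + min (\<delta>/2) ((b - x)/2)"
  have y: "x < y" "y < b" "y - x < \<delta>"
    using \<open>\<delta> > 0\<close> assms(1) by (auto simp: y_def min_def field_simps)
  obtain z where z: "x < z" "z < y" "f y - f x = (y - x) * f' z"
    using MVT2[of x y f f'] y f' assms(1) by force
  have "f' z > 0"
    using \<delta>[of "z - x"] z y \<open>f' x = 0\<close> by simp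
  then have "f y > f x"
    using mult_pos_pos[of "y - x" "f' z"] z(3) y(1) by linarith
  with max[of y] y assms(1) show False by simp
qed

lemma continuous_interior_max:
  fixes u :: "real \<Rightarrow> real"
  assumes "continuous_on {0..l} u" "u 0 = 0" "u l = 0" "x \<in> {0..l}" "u x > 0"
  obtains y where "y \<in> {0<..<l}" "u y > 0" "\<And>z. z \<in> {0..l} \<Longrightarrow> u z \<le> u y"
proof -
  obtain y where y: "y \<in> {0..l}" "\<And>z. z \<in> {0..l} \<Longrightarrow> u z \<le> u y"
    using continuous_attains_sup[of "{0..l}" u] assms by auto
  have "u y > 0" using y(2)[OF assms(4)] assms(5) by simp
  moreover have "y \<in> {0<..<l}" using y(1) \<open>u y > 0\<close> assms(2,3)
    by (cases "y = 0"; cases "y = l"; auto)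
  ultimately show ?thesis using that y by blast
qed

text \<open>Asking for the inequality only where \<open>u > 0\<close> allows a source that depends
  on \<open>u\<close>: for an eigenfunction \<open>h\<close> with eigenvalue
  \<open>\<mu> \<le> 0\<close>, the source \<open>\<mu> * h\<close> is nonpositive there, though not
  everywhere.\<close>

lemma elliptic_max_principle:
  fixes u u' u'' M f :: "real \<Rightarrow> real"
  assumes cont: "continuous_on {0..l} u" and bc: "u 0 = 0" "u l = 0" and "D > 0"
    and M: "\<And>x. x \<in> {0..l} \<Longrightarrow> M x > 0"
    and d1: "\<And>x. x \<in> {0<..<l} \<Longrightarrow> (u has_real_derivative u' x) (at x)"
    and d2: "\<And>x. x \<in> {0<..<l} \<Longrightarrow> (u' has_real_derivative u'' x) (at x)"
    and le: "\<And>x. x \<in> {0<..<l} \<Longrightarrow> u x > 0 \<Longrightarrow> M x * u x - D * u'' x \<le> 0"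
    and x: "x \<in> {0..l}"
  shows "u x \<le> 0"
proof (rule ccontr)
  assume "\<not> u x \<le> 0"
  then obtain y where y: "y \<in> {0<..<l}" "u y > 0" "\<And>z. z \<in> {0..l} \<Longrightarrow> u z \<le> u y"
    using continuous_interior_max[OF cont bc x] by (metis not_le)
  have "u'' y \<le> 0"
    using second_derivative_nonpos_at_local_max[OF y(1) _ d1 d2[OF y(1)]] y(3) by force
  then have "D * u'' y \<le> 0" using \<open>D > 0\<close> by (simp add: mult_nonneg_nonpos)
  moreover have "M y * u y > 0" using M y by simp
  ultimately show False using le[OF y(1,2)] by linarith
qed

text \<open>At a maximum above \<open>B \<ge> 0\<close> one has \<open>yt \<ge> 0\<close> and
  \<open>yxx \<le> 0\<close>, which the strict inequality excludes. In the application strictness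
  comes from the shift by \<kappa>, so \<open>y\<close> need not be perturbed.\<close>

lemma parabolic_max_principle:
  fixes y yt yx yxx :: "real \<Rightarrow> real \<Rightarrow> real"
  assumes cont: "continuous_on ({0..l} \<times> {\<tau>..T}) (\<lambda>(x, t). y x t)"
    and bc: "\<And>t. t \<in> {\<tau>..T} \<Longrightarrow> y 0 t \<le> B" "\<And>t. t \<in> {\<tau>..T} \<Longrightarrow> y l t \<le> B"
    and init: "\<And>x. x \<in> {0..l} \<Longrightarrow> y x \<tau> \<le> B" and "0 \<le> B"
    and dt: "\<And>x t. x \<in> {0<..<l} \<Longrightarrow> t \<in> {\<tau><..T} \<Longrightarrow> (y x has_real_derivative yt x t) (at t)"
    and dx: "\<And>x t. x \<in> {0<..<l} \<Longrightarrow> t \<in> {\<tau><..T} \<Longrightarrow> ((\<lambda>x. y x t) has_real_derivative yx x t) (at x)"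
    and dxx: "\<And>x t. x \<in> {0<..<l} \<Longrightarrow> t \<in> {\<tau><..T} \<Longrightarrow> ((\<lambda>x. yx x t) has_real_derivative yxx x t) (at x)"
    and a: "\<And>t. t \<in> {\<tau><..T} \<Longrightarrow> 0 \<le> a t"
    and less: "\<And>x t. x \<in> {0<..<l} \<Longrightarrow> t \<in> {\<tau><..T} \<Longrightarrow> 0 < y x t \<Longrightarrow> yt x t < a t * yxx x t"
    and x: "x \<in> {0..l}" and t: "t \<in> {\<tau>..T}"
  shows "y x t \<le> B"
proof (rule ccontr)
  assume gt: "\<not> y x t \<le> B"
  have "compact ({0..l} \<times> {\<tau>..T})" by (intro compact_Times compact_Icc)
  moreover have "{0..l} \<times> {\<tau>..T} \<noteq> {}" using x t by blast
  ultimately obtain z where z: "z \<in> {0..l} \<times> {\<tau>..T}"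
    "\<forall>z'\<in>{0..l} \<times> {\<tau>..T}. (\<lambda>(x, t). y x t) z' \<le> (\<lambda>(x, t). y x t) z"
    using continuous_attains_sup[OF _ _ cont] by blast
  obtain x0 t0 where z_eq: "z = (x0, t0)" by (cases z)
  have in0: "x0 \<in> {0..l}" "t0 \<in> {\<tau>..T}" using z(1) z_eq by auto
  have max: "y x' t' \<le> y x0 t0" if "x' \<in> {0..l}" "t' \<in> {\<tau>..T}" for x' t'
    using bspec[OF z(2), of "(x', t')"] that z_eq by simp
  have big: "B < y x0 t0" using max[OF x t] gt by simp
  have "x0 \<noteq> 0" "x0 \<noteq> l" "t0 \<noteq> \<tau>" using big bc[OF in0(2)] init[OF in0(1)] by auto
  then have x0: "x0 \<in> {0<..<l}" and t0: "t0 \<in> {\<tau><..T}" using in0 by auto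
  have "yxx x0 t0 \<le> 0"
    by (rule second_derivative_nonpos_at_local_max[OF x0 _ dx[OF _ t0] dxx[OF x0 t0]])
      (use max in0 in auto)
  then have "a t0 * yxx x0 t0 \<le> 0" using a[OF t0] by (simp add: mult_nonneg_nonpos)
  moreover have "0 \<le> yt x0 t0"
  proof (rule ccontr)
    assume "\<not> 0 \<le> yt x0 t0"
    then obtain d where d: "d > 0" "\<And>h. 0 < h \<Longrightarrow> h < d \<Longrightarrow> y x0 t0 < y x0 (t0 - h)"
      using DERIV_neg_dec_left[OF dt[OF x0 t0]] by auto
    \<comment> \<open>The maximum may sit at the final time \<open>T\<close>, so the comparison
      looks backwards in time; that suffices for \<open>yt \<ge> 0\<close>. The minimum keeps
      \<open>t0 - h\<close> in \<open>{\<tau>..T}\<close>.\<close>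
    define h where "h = min (d / 2) (t0 - \<tau>)"
    have "0 < h" "h < d" "t0 - h \<in> {\<tau>..T}" using d(1) t0 by (auto simp: h_def min_def)
    then show False using d(2)[of h] max[OF in0(1), of "t0 - h"] by simp
  qed
  ultimately show False using less[OF x0 t0] big \<open>0 \<le> B\<close> by simp
qed

section \<open>The Cauchy problem for a linear second order equation\<close>

text \<open>Picard iterates for \<open>\<psi>'' = p \<psi>\<close>, \<open>\<psi> 0 = 0\<close>, \<open>\<psi>' 0 = 1\<close>, as pairs of the \<open>n\<close>-th summand and
  its derivative.\<close>

primrec volterra :: "(real \<Rightarrow> real) \<Rightarrow> nat \<Rightarrow> (real \<Rightarrow> real) \<times> (real \<Rightarrow> real)" where
  "volterra p 0 = (\<lambda>x. x, \<lambda>x. 1)"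
| "volterra p (Suc n) =
     (let d = \<lambda>x. integral {0..x} (\<lambda>s. p s * fst (volterra p n) s)
      in (\<lambda>x. integral {0..x} d, d))"

text \<open>Only the inner of the two integrations gains a factor
  \<open>P * l * x / (n + 1)\<close>; the outer one is bounded by the length of the interval, which
  is the \<open>l\<close> in \<open>P * l\<close>. The cruder bound still sums to an exponential
  series. Nonnegativity of \<open>p\<close> keeps all iterates nonnegative.\<close>

lemma volterra_props:
  fixes p :: "real \<Rightarrow> real"
  assumes cp: "continuous_on {0..l} p" and p0: "\<And>x. x \<in> {0..l} \<Longrightarrow> 0 \<le> p x"
    and pP: "\<And>x. x \<in> {0..l} \<Longrightarrow> p x \<le> P" and "l > 0"
  shows "(\<forall>x\<in>{0..l}. (fst (volterra p n) has_real_derivative snd (volterra p n) x) (at x within {0..l})) \<and>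
     (\<forall>x\<in>{0..l}. (snd (volterra p (Suc n)) has_real_derivative p x * fst (volterra p n) x) (at x within {0..l})) \<and>
     (\<forall>x\<in>{0..l}. 0 \<le> fst (volterra p n) x \<and> fst (volterra p n) x \<le> l * ((P*l) * x)^n / fact n) \<and>
     (\<forall>x\<in>{0..l}. 0 \<le> snd (volterra p n) x \<and> snd (volterra p n) x \<le> ((P*l) * x)^n / fact n)"
proof (induction n)
  case 0
  have "continuous_on {0..l} (\<lambda>s. p s * s)" by (intro continuous_intros cp)
  then show ?case
    using integral_has_real_derivative[of 0 l "\<lambda>s. p s * s"] by (auto simp: Let_def)
next
  case (Suc n)
  define y where "y = fst (volterra p n)"
  define d where "d = snd (volterra p (Suc n))"
  define y1 where "y1 = fst (volterra p (Suc n))"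
  define d2 where "d2 = snd (volterra p (Suc (Suc n)))"
  have d_eq: "d x = integral {0..x} (\<lambda>s. p s * y s)" for x by (simp add: d_def y_def Let_def)
  have y1_eq: "y1 x = integral {0..x} d" for x by (simp add: d_def y1_def y_def Let_def)
  have d2_eq: "d2 x = integral {0..x} (\<lambda>s. p s * y1 s)" for x by (simp add: d2_def y1_def Let_def)
  note IH = Suc[folded y_def d_def]
  have "0 \<le> P" using p0[of 0] pP[of 0] \<open>l > 0\<close> by simp
  have yc: "continuous_on {0..l} y" using IH
    by (meson DERIV_continuous continuous_on_eq_continuous_within)
  have dc: "continuous_on {0..l} d" using IH
    by (meson DERIV_continuous continuous_on_eq_continuous_within)
  have y1d: "(y1 has_real_derivative d x) (at x within {0..l})" if "x \<in> {0..l}" for x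
    using integral_has_real_derivative[OF dc that] by (simp add: y1_eq[abs_def])
  then have y1c: "continuous_on {0..l} y1"
    by (meson DERIV_continuous continuous_on_eq_continuous_within)
  have d2d: "(d2 has_real_derivative p x * y1 x) (at x within {0..l})" if "x \<in> {0..l}" for x
  proof -
    have "continuous_on {0..l} (\<lambda>s. p s * y1 s)" by (intro continuous_intros cp y1c)
    from integral_has_real_derivative[OF this that] show ?thesis by (simp add: d2_eq[abs_def])
  qed
  define c where "c = P * l"
  have dnn: "0 \<le> d x \<and> d x \<le> (c * x)^Suc n / fact (Suc n)" if x: "x \<in> {0..l}" for x
  proof -
    have sub: "{0..x} \<subseteq> {0..l}" using x by auto
    have int: "(\<lambda>s. p s * y s) integrable_on {0..x}"
      by (intro integrable_continuous_interval continuous_intros continuous_on_subset[OF cp sub]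
          continuous_on_subset[OF yc sub])
    have 1: "((\<lambda>s. c * (c * s)^n / fact n) has_integral ((c*x)^Suc n / fact (Suc n) - (c*0)^Suc n / fact (Suc n))) {0..x}"
    proof (rule fundamental_theorem_of_calculus)
      show "0 \<le> x" using x by simp
      show "((\<lambda>s. (c * s)^Suc n / fact (Suc n)) has_vector_derivative (c * (c * s)^n / fact n)) (at s within {0..x})" for s
      proof -
        have "((\<lambda>s. (c * s)^Suc n) has_real_derivative real (Suc n) * (c * s)^n * c) (at s within {0..x})"
          by (rule derivative_eq_intros refl)+ simp
        from DERIV_cdivide[OF this, of "fact (Suc n)"]
        show ?thesis
          unfolding has_real_derivative_iff_has_vector_derivative[symmetric]
          by (simp add: mult.commute del: power_Suc of_nat_Suc)
      qed
    qed
    have "d x \<le> integral {0..x} (\<lambda>s. c * (c * s)^n / fact n)"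
      unfolding d_eq
    proof (rule integral_le[OF int])
      show "(\<lambda>s. c * (c * s)^n / fact n) integrable_on {0..x}" using 1 by blast
      fix s assume "s \<in> {0..x}"
      then have s: "s \<in> {0..l}" using x by auto
      have "p s * y s \<le> P * (l * (c * s)^n / fact n)"
        using IH s p0[OF s] pP[OF s] \<open>0 \<le> P\<close> unfolding c_def by (intro mult_mono) auto
      then show "p s * y s \<le> c * (c * s)^n / fact n" by (simp add: c_def mult.assoc)
    qed
    also have "\<dots> = (c*x)^Suc n / fact (Suc n)" using integral_unique[OF 1] by simp
    finally have "d x \<le> (c*x)^Suc n / fact (Suc n)" .
    moreover have "0 \<le> d x" unfolding d_eq
      by (rule integral_nonneg[OF int]) (use IH p0 x in auto)
    ultimately show ?thesis by simp
  qed
  have y1nn: "0 \<le> y1 x \<and> y1 x \<le> l * (c * x)^Suc n / fact (Suc n)" if x: "x \<in> {0..l}" for x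
  proof -
    have sub: "{0..x} \<subseteq> {0..l}" using x by auto
    have int: "d integrable_on {0..x}"
      by (intro integrable_continuous_interval continuous_on_subset[OF dc sub])
    have c0: "0 \<le> c" using \<open>0 \<le> P\<close> \<open>l > 0\<close> by (simp add: c_def)
    have "y1 x \<le> integral {0..x} (\<lambda>s. (c * x)^Suc n / fact (Suc n))"
      unfolding y1_eq
    proof (rule integral_le[OF int])
      fix s assume s: "s \<in> {0..x}"
      have "d s \<le> (c * s)^Suc n / fact (Suc n)" using dnn s x by simp
      also have "\<dots> \<le> (c * x)^Suc n / fact (Suc n)"
        using s c0 by (intro divide_right_mono power_mono mult_left_mono) auto
      finally show "d s \<le> (c * x)^Suc n / fact (Suc n)" .
    qed auto
    also have "\<dots> = x * ((c * x)^Suc n / fact (Suc n))" using x by (simp del: power_Suc fact_Suc)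
    also have "\<dots> \<le> l * ((c * x)^Suc n / fact (Suc n))"
      using x c0 by (intro mult_right_mono) auto
    finally have "y1 x \<le> l * (c * x)^Suc n / fact (Suc n)" by (simp del: power_Suc fact_Suc)
    moreover have "0 \<le> y1 x" unfolding y1_eq
      by (rule integral_nonneg[OF int]) (use dnn x in auto)
    ultimately show ?thesis by simp
  qed
  show ?case
    using y1d d2d y1nn dnn unfolding c_def d_def[symmetric] y1_def[symmetric] d2_def[symmetric] by blast
qed

text \<open>The bound \<open>x \<le> \<psi> x\<close> keeps only the zeroth term of a series of
  nonnegative terms. It gives \<open>\<psi> l > 0\<close>: the solution started at one end misses
  the Dirichlet condition at the other, which will make a Wronskian positive.\<close>

lemma cauchy_problem_solution:
  fixes p :: "real \<Rightarrow> real"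
  assumes cp: "continuous_on {0..l} p" and p0: "\<And>x. x \<in> {0..l} \<Longrightarrow> 0 \<le> p x" and "l > 0"
  obtains \<psi> \<psi>' where "\<psi> 0 = 0" "\<psi>' 0 = 1"
    "\<And>x. x \<in> {0..l} \<Longrightarrow> (\<psi> has_real_derivative \<psi>' x) (at x within {0..l})"
    "\<And>x. x \<in> {0..l} \<Longrightarrow> (\<psi>' has_real_derivative p x * \<psi> x) (at x within {0..l})"
    "\<And>x. x \<in> {0..l} \<Longrightarrow> x \<le> \<psi> x"
proof -
  obtain P where P: "\<And>x. x \<in> {0..l} \<Longrightarrow> p x \<le> P"
    using continuous_attains_sup[of "{0..l}" p] cp \<open>l > 0\<close> by fastforce
  have "0 \<le> P" using p0[of 0] P[of 0] \<open>l > 0\<close> by simp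
  define c where "c = P * l"
  have c0: "0 \<le> c" using \<open>0 \<le> P\<close> \<open>l > 0\<close> by (simp add: c_def)
  define y where "y n = fst (volterra p n)" for n
  define d where "d n = snd (volterra p n)" for n
  note vp = volterra_props[OF cp p0 P \<open>l > 0\<close>]
  have yd: "(y n has_real_derivative d n x) (at x within {0..l})" if "x \<in> {0..l}" for n x
    using vp[of n] that unfolding y_def d_def by blast
  \<comment> \<open>\<open>e n\<close> is the derivative of \<open>d n\<close>. The first one is
    zero because \<open>d 0\<close> is the constant 1; the shift of index turns the series of the
    \<open>e n\<close> into \<open>p\<close> times the series of the \<open>y n\<close>.\<close>
  define e where "e n = (case n of 0 \<Rightarrow> (\<lambda>x. 0) | Suc n \<Rightarrow> (\<lambda>x. p x * y n x))" for n
  have dd: "(d n has_real_derivative e n x) (at x within {0..l})" if "x \<in> {0..l}" for n x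
  proof (cases n)
    case 0 then show ?thesis by (auto simp: d_def e_def)
  next
    case (Suc m) then show ?thesis using vp[of m] that unfolding y_def d_def e_def by simp
  qed
  have b: "(c * x)^n / fact n \<le> (c * l)^n / fact n" if "x \<in> {0..l}" for n x
    using that c0 by (intro divide_right_mono power_mono mult_left_mono) auto
  have yb: "0 \<le> y n x" "y n x \<le> l * ((c*l)^n / fact n)" if x: "x \<in> {0..l}" for n x
  proof -
    have "y n x \<le> l * ((c * x)^n / fact n)" "0 \<le> y n x"
      using vp[of n] x unfolding y_def c_def by auto
    moreover have "l * ((c * x)^n / fact n) \<le> l * ((c*l)^n / fact n)"
      using b[OF x] \<open>l > 0\<close> by (intro mult_left_mono) auto
    ultimately show "0 \<le> y n x" "y n x \<le> l * ((c*l)^n / fact n)" by linarith+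
  qed
  have db: "norm (d n x) \<le> (c*l)^n / fact n" if x: "x \<in> {0..l}" for n x
  proof -
    have "d n x \<le> (c * x)^n / fact n" "0 \<le> d n x"
      using vp[of n] x unfolding d_def c_def by auto
    then show ?thesis using b[OF x, of n] by simp
  qed
  have sm: "summable (\<lambda>n. (c*l)^n / fact n)"
    using summable_exp[of "c*l"] by (simp add: divide_inverse mult.commute)
  define \<psi>' where "\<psi>' x = (\<Sum>n. d n x)" for x
  define \<psi>'' where "\<psi>'' x = (\<Sum>n. e n x)" for x
  have u1: "uniform_limit {0..l} (\<lambda>n x. \<Sum>i<n. d i x) \<psi>' sequentially"
    unfolding \<psi>'_def by (rule Weierstrass_m_test[OF db sm])
  have eb: "norm (e n x) \<le> (case n of 0 \<Rightarrow> 0 | Suc m \<Rightarrow> P * (l * ((c*l)^m / fact m)))" if x: "x \<in> {0..l}" for n x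
  proof (cases n)
    case (Suc m)
    have "p x * y m x \<le> P * (l * ((c*l)^m / fact m))"
      using p0[OF x] P[OF x] yb[OF x] \<open>0 \<le> P\<close> by (intro mult_mono) auto
    then show ?thesis using Suc p0[OF x] yb[OF x, of m] by (simp add: e_def abs_mult)
  qed (simp add: e_def)
  have sme: "summable (\<lambda>n. (case n of 0 \<Rightarrow> 0 | Suc m \<Rightarrow> P * (l * ((c*l)^m / fact m))))"
    using summable_mult[OF summable_mult[OF sm]] by (subst summable_Suc_iff[symmetric]) simp
  have u2: "uniform_limit {0..l} (\<lambda>n x. \<Sum>i<n. e i x) \<psi>'' sequentially"
    unfolding \<psi>''_def by (rule Weierstrass_m_test[OF eb sme])
  have zero: "0 \<in> {0..l}" using \<open>l > 0\<close> by simp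
  have y00: "y n 0 = 0" for n by (cases n) (auto simp: y_def Let_def)
  have "summable (\<lambda>n. y n 0)" using y00 by simp
  from has_field_derivative_series[OF convex_real_interval(5) yd u1 zero this]
  obtain \<psi> where "\<forall>x\<in>{0..l}. (\<lambda>n. y n x) sums \<psi> x \<and> (\<psi> has_real_derivative \<psi>' x) (at x within {0..l})"
    by blast
  then have \<psi>: "\<And>x. x \<in> {0..l} \<Longrightarrow> (\<lambda>n. y n x) sums \<psi> x"
     "\<And>x. x \<in> {0..l} \<Longrightarrow> (\<psi> has_real_derivative \<psi>' x) (at x within {0..l})" by auto
  have "summable (\<lambda>n. d n 0)"
    by (rule summable_comparison_test'[OF sm]) (use db zero in auto)
  from has_field_derivative_series[OF convex_real_interval(5) dd u2 zero this]
  obtain \<phi> where "\<forall>x\<in>{0..l}. (\<lambda>n. d n x) sums \<phi> x \<and> (\<phi> has_real_derivative \<psi>'' x) (at x within {0..l})"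
    by blast
  then have \<phi>: "\<And>x. x \<in> {0..l} \<Longrightarrow> (\<lambda>n. d n x) sums \<phi> x"
     "\<And>x. x \<in> {0..l} \<Longrightarrow> (\<phi> has_real_derivative \<psi>'' x) (at x within {0..l})" by auto
  have \<phi>\<psi>: "\<phi> x = \<psi>' x" if "x \<in> {0..l}" for x
    using \<phi>(1)[OF that] by (simp add: \<psi>'_def sums_iff)
  have \<psi>''eq: "\<psi>'' x = p x * \<psi> x" if x: "x \<in> {0..l}" for x
  proof -
    have "(\<lambda>n. e (Suc n) x) sums (p x * \<psi> x)"
      using sums_mult[OF \<psi>(1)[OF x], of "p x"] by (simp add: e_def)
    then have "(\<lambda>n. e n x) sums (p x * \<psi> x + e 0 x)" by (subst (asm) sums_Suc_iff)
    then show ?thesis by (simp add: \<psi>''_def sums_iff e_def)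
  qed
  show ?thesis
  proof
    show "\<psi> 0 = 0" using \<psi>(1)[OF zero] y00 by (simp add: sums_iff)
    have "d n 0 = (if n = 0 then 1 else 0)" for n by (cases n) (auto simp: d_def Let_def)
    then show "\<psi>' 0 = 1"
      using suminf_finite[of "{0}" "\<lambda>n. d n 0"] by (simp add: \<psi>'_def)
    fix x assume x: "x \<in> {0..l}"
    show "(\<psi> has_real_derivative \<psi>' x) (at x within {0..l})" by (rule \<psi>(2)[OF x])
    show "(\<psi>' has_real_derivative p x * \<psi> x) (at x within {0..l})"
      using has_field_derivative_transform_within[OF \<phi>(2)[OF x] zero_less_one x] \<phi>\<psi> by (simp add: \<psi>''eq[OF x])
    have "(\<lambda>n. y n x) sums \<psi> x" by (rule \<psi>(1)[OF x])
    then have "(\<Sum>n<1. y n x) \<le> \<psi> x"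
      using sum_le_suminf[of "\<lambda>n. y n x" "{..<1}"] yb(1)[OF x] by (simp add: sums_iff)
    then show "x \<le> \<psi> x" by (simp add: y_def)
  qed
qed

lemma continuous_on_DERIV:
  assumes "\<And>x. x \<in> S \<Longrightarrow> (f has_real_derivative f' x) (at x within S)"
  shows "continuous_on S f"
  using assms by (meson DERIV_continuous continuous_on_eq_continuous_within)

lemma DERIV_eq_0_imp_interior:
  assumes u: "\<And>x. x \<in> {0..l} \<Longrightarrow> (u has_real_derivative u' x) (at x within {0..l})"
    and z: "\<And>x. x \<in> {0..l} \<Longrightarrow> u x = 0" and x: "x \<in> {0<..<l::real}"
  shows "u' x = 0"
proof -
  have "(u has_real_derivative u' x) (at x)"
    using u[of x] x by (simp add: at_within_Icc_at)
  moreover have "(u has_real_derivative 0) (at x)"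
    by (rule has_field_derivative_transform_within_open[OF _ open_greaterThanLessThan x])
       (use z in \<open>auto intro!: derivative_eq_intros\<close>)
  ultimately show ?thesis by (rule DERIV_unique)
qed

text \<open>Gronwall argument: the energy \<open>k^2 + k'^2\<close> has derivative
  \<open>2 k k' (1 + r)\<close>, at most \<open>1 + R\<close> times the energy, so its product with
  \<open>exp (-(1 + R) x)\<close> cannot rise above its initial value 0.\<close>

lemma cauchy_problem_unique:
  fixes k k' r :: "real \<Rightarrow> real"
  assumes k: "\<And>x. x \<in> {0..l} \<Longrightarrow> (k has_real_derivative k' x) (at x within {0..l})"
    and k': "\<And>x. x \<in> {0..l} \<Longrightarrow> (k' has_real_derivative r x * k x) (at x within {0..l})"
    and R: "\<And>x. x \<in> {0..l} \<Longrightarrow> \<bar>r x\<bar> \<le> R"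
    and zero: "k 0 = 0" "k' 0 = 0" and x: "x \<in> {0..l}"
  shows "k x = 0"
proof -
  define F where "F x = ((k x)\<^sup>2 + (k' x)\<^sup>2) * exp (-(1+R) * x)" for x
  have "F x \<le> F 0"
  proof (rule DERIV_nonpos_imp_decreasing_open[of 0 x F])
    show "continuous_on {0..x} F" unfolding F_def[abs_def]
      by (intro continuous_intros continuous_on_subset[OF continuous_on_DERIV[OF k]]
          continuous_on_subset[OF continuous_on_DERIV[OF k']]) (use x in auto)
    fix y assume y: "0 < y" "y < x"
    have yl: "y \<in> {0..l}" using y x by auto
    have d: "(k has_real_derivative k' y) (at y)" "(k' has_real_derivative r y * k y) (at y)"
      using k[OF yl] k'[OF yl] y x by (simp_all add: at_within_Icc_at)
    have dF: "(F has_real_derivative (2 * k y * k' y * (1 + r y) - (1+R) * ((k y)\<^sup>2 + (k' y)\<^sup>2)) * exp (-(1+R) * y)) (at y)"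
      unfolding F_def[abs_def]
      by (rule derivative_eq_intros d refl | simp)+ (simp add: algebra_simps power2_eq_square)
    have "2 * k y * k' y * (1 + r y) \<le> \<bar>2 * k y * k' y\<bar> * \<bar>1 + r y\<bar>"
      by (metis abs_ge_self abs_mult)
    also have "\<dots> \<le> ((k y)\<^sup>2 + (k' y)\<^sup>2) * (1 + R)"
    proof (rule mult_mono)
      have "0 \<le> (\<bar>k y\<bar> - \<bar>k' y\<bar>)\<^sup>2" by simp
      then show "\<bar>2 * k y * k' y\<bar> \<le> (k y)\<^sup>2 + (k' y)\<^sup>2" by (simp add: power2_diff abs_mult)
      show "\<bar>1 + r y\<bar> \<le> 1 + R" using R[OF yl] by linarith
    qed auto
    finally have "2 * k y * k' y * (1 + r y) - (1+R) * ((k y)\<^sup>2 + (k' y)\<^sup>2) \<le> 0" by (simp add: mult.commute)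
    then have "(2 * k y * k' y * (1 + r y) - (1+R) * ((k y)\<^sup>2 + (k' y)\<^sup>2)) * exp (-(1+R) * y) \<le> 0"
      by (simp add: mult_le_0_iff)
    with dF show "\<exists>d. (F has_real_derivative d) (at y) \<and> d \<le> 0" by blast
  qed (use x in auto)
  then have "(k x)\<^sup>2 + (k' x)\<^sup>2 \<le> 0" by (simp add: F_def zero mult_le_0_iff)
  then have "(k x)\<^sup>2 = 0" using zero_le_power2[of "k' x"] zero_le_power2[of "k x"] by linarith
  then show ?thesis by simp
qed

section \<open>The inner product of square integrable functions\<close>

text \<open>Representatives are used instead of classes, so that point values, boundary values and
  derivatives keep their meaning. The price is that \<open>nrm\<close> is only a seminorm, definite
  on continuous functions over \<open>{0..l}\<close>.\<close>

definition ip :: "real \<Rightarrow> (real \<Rightarrow> real) \<Rightarrow> (real \<Rightarrow> real) \<Rightarrow> real" where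
  "ip l f h = (LINT x|lebesgue_on {0..l}. f x * h x)"

definition nrm :: "real \<Rightarrow> (real \<Rightarrow> real) \<Rightarrow> real" where
  "nrm l f = sqrt (ip l f f)"

lemma L2_on_mult_integrable:
  assumes "L2_on S f" "L2_on S h"
  shows "integrable (lebesgue_on S) (\<lambda>x. f x * h x)"
proof (rule Bochner_Integration.integrable_bound)
  show "integrable (lebesgue_on S) (\<lambda>x. (f x)\<^sup>2 + (h x)\<^sup>2)"
    using assms by (auto simp: L2_on_def)
  show "(\<lambda>x. f x * h x) \<in> borel_measurable (lebesgue_on S)"
    using assms by (auto simp: L2_on_def)
  have "\<bar>f x * h x\<bar> \<le> (f x)\<^sup>2 + (h x)\<^sup>2" for x
  proof -
    have "0 \<le> (\<bar>f x\<bar> - \<bar>h x\<bar>)\<^sup>2" by simp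
    then have "2 * \<bar>f x * h x\<bar> \<le> (f x)\<^sup>2 + (h x)\<^sup>2"
      by (simp add: power2_diff abs_mult)
    then show ?thesis by linarith
  qed
  then show "AE x in lebesgue_on S. norm (f x * h x) \<le> norm ((f x)\<^sup>2 + (h x)\<^sup>2)"
    by (auto intro!: AE_I2)
qed

lemma L2_on_continuous:
  assumes "continuous_on {0..l::real} f"
  shows "L2_on {0..l} f"
  unfolding L2_on_def
  using continuous_imp_measurable_on_sets_lebesgue[OF assms]
    continuous_imp_integrable_real[of 0 l "\<lambda>x. (f x)\<^sup>2"] assms
  by (auto intro!: continuous_intros)

lemma L2_on_add: "L2_on S f \<Longrightarrow> L2_on S h \<Longrightarrow> L2_on S (\<lambda>x. f x + h x)"
  using L2_on_mult_integrable[of S f h]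
  by (auto simp: L2_on_def power2_sum mult.assoc intro!: Bochner_Integration.integrable_add integrable_mult_right)

lemma L2_on_cmult: "L2_on S f \<Longrightarrow> L2_on S (\<lambda>x. c * f x)"
  by (auto simp: L2_on_def power_mult_distrib)

lemma L2_on_diff: "L2_on S f \<Longrightarrow> L2_on S h \<Longrightarrow> L2_on S (\<lambda>x. f x - h x)"
  using L2_on_add[OF _ L2_on_cmult[of S h "-1"], of f] by simp

lemma L2_on_sum: "finite I \<Longrightarrow> (\<And>i. i \<in> I \<Longrightarrow> L2_on {0..l::real} (f i)) \<Longrightarrow> L2_on {0..l} (\<lambda>x. \<Sum>i\<in>I. f i x)"
  by (induction I rule: finite_induct) (auto intro: L2_on_continuous L2_on_add)

lemma L2_on_mult_continuous:
  assumes f: "L2_on {0..l::real} f" and c: "continuous_on {0..l} c"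
  shows "L2_on {0..l} (\<lambda>x. c x * f x)"
proof -
  obtain B where "\<forall>y\<in>c ` {0..l}. \<bar>y\<bar> \<le> B"
    using compact_imp_bounded[OF compact_continuous_image[OF c compact_Icc]]
    unfolding bounded_real by blast
  then have B: "\<And>x. x \<in> {0..l} \<Longrightarrow> \<bar>c x\<bar> \<le> B" by blast
  have m: "c \<in> borel_measurable (lebesgue_on {0..l})"
    using continuous_imp_measurable_on_sets_lebesgue[OF c] by simp
  have "integrable (lebesgue_on {0..l}) (\<lambda>x. (c x * f x)\<^sup>2)"
  proof (rule Bochner_Integration.integrable_bound)
    show "integrable (lebesgue_on {0..l}) (\<lambda>x. B\<^sup>2 * (f x)\<^sup>2)"
      using f by (auto simp: L2_on_def)
    show "(\<lambda>x. (c x * f x)\<^sup>2) \<in> borel_measurable (lebesgue_on {0..l})"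
      using f m by (auto simp: L2_on_def)
    have "(c x * f x)\<^sup>2 \<le> B\<^sup>2 * (f x)\<^sup>2" if "x \<in> {0..l}" for x
      unfolding power_mult_distrib
      using power_mono[OF B[OF that], of 2] by (intro mult_right_mono) auto
    then show "AE x in lebesgue_on {0..l}. norm ((c x * f x)\<^sup>2) \<le> norm (B\<^sup>2 * (f x)\<^sup>2)"
      by (auto intro!: AE_I2)
  qed
  then show ?thesis using f m by (auto simp: L2_on_def)
qed

lemma ip_commute: "ip l f h = ip l h f"
  by (simp add: ip_def mult.commute)

lemma ip_cong:
  "(\<And>x. x \<in> {0..l} \<Longrightarrow> f x = f1 x) \<Longrightarrow> (\<And>x. x \<in> {0..l} \<Longrightarrow> h x = h1 x) \<Longrightarrow> ip l f h = ip l f1 h1"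
  unfolding ip_def by (rule Bochner_Integration.integral_cong) auto

lemma ip_add_left:
  "L2_on {0..l} f \<Longrightarrow> L2_on {0..l} f1 \<Longrightarrow> L2_on {0..l} h \<Longrightarrow> ip l (\<lambda>x. f x + f1 x) h = ip l f h + ip l f1 h"
  unfolding ip_def by (simp add: ring_distribs Bochner_Integration.integral_add L2_on_mult_integrable)

lemma ip_diff_left:
  "L2_on {0..l} f \<Longrightarrow> L2_on {0..l} f1 \<Longrightarrow> L2_on {0..l} h \<Longrightarrow> ip l (\<lambda>x. f x - f1 x) h = ip l f h - ip l f1 h"
  unfolding ip_def by (simp add: ring_distribs Bochner_Integration.integral_diff L2_on_mult_integrable)

lemma ip_cmult_left: "ip l (\<lambda>x. c * f x) h = c * ip l f h"
  unfolding ip_def by (simp add: mult.assoc)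

lemma ip_cmult_right: "ip l f (\<lambda>x. c * h x) = c * ip l f h"
  using ip_cmult_left ip_commute by metis

lemma ip_diff_right:
  "L2_on {0..l} f \<Longrightarrow> L2_on {0..l} h \<Longrightarrow> L2_on {0..l} h1 \<Longrightarrow> ip l f (\<lambda>x. h x - h1 x) = ip l f h - ip l f h1"
  using ip_diff_left[of l h h1 f] by (simp add: ip_commute)

lemma ip_sum_left:
  assumes "finite I" "\<And>i. i \<in> I \<Longrightarrow> L2_on {0..l} (f i)" "L2_on {0..l} h"
  shows "ip l (\<lambda>x. \<Sum>i\<in>I. f i x) h = (\<Sum>i\<in>I. ip l (f i) h)"
  unfolding ip_def sum_distrib_right
  by (rule Bochner_Integration.integral_sum) (use assms in \<open>auto intro: L2_on_mult_integrable\<close>)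

lemma ip_nonneg: "0 \<le> ip l f f"
  unfolding ip_def by (simp add: Bochner_Integration.integral_nonneg)

lemma nrm_nonneg: "0 \<le> nrm l f"
  by (simp add: nrm_def ip_nonneg)

lemma nrm_power2: "(nrm l f)\<^sup>2 = ip l f f"
  by (simp add: nrm_def ip_nonneg)

lemma nrm_cong: "(\<And>x. x \<in> {0..l} \<Longrightarrow> f x = h x) \<Longrightarrow> nrm l f = nrm l h"
  unfolding nrm_def using ip_cong by metis

lemma nrm_cmult: "nrm l (\<lambda>x. c * f x) = \<bar>c\<bar> * nrm l f"
  unfolding nrm_def ip_cmult_left ip_cmult_right by (simp add: real_sqrt_mult flip: mult.assoc)

lemma nrm_diff_power2:
  assumes "L2_on {0..l} f" "L2_on {0..l} h"
  shows "(nrm l (\<lambda>x. f x - h x))\<^sup>2 = (nrm l f)\<^sup>2 - 2 * ip l f h + (nrm l h)\<^sup>2"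
  using assms by (simp add: nrm_power2 ip_diff_left ip_diff_right L2_on_diff ip_commute[of l h f])

lemma L2_dist_sq_eq_nrm: "L2_dist_sq {0..l} f h = (nrm l (\<lambda>x. f x - h x))\<^sup>2"
  unfolding nrm_power2 by (simp add: L2_dist_sq_def ip_def power2_eq_square)

lemma ip_Cauchy_Schwarz:
  assumes f: "L2_on {0..l} f" and h: "L2_on {0..l} h"
  shows "\<bar>ip l f h\<bar> \<le> nrm l f * nrm l h"
proof -
  have pos: "0 \<le> (nrm l f)\<^sup>2 - 2 * t * ip l f h + t\<^sup>2 * (nrm l h)\<^sup>2" for t
  proof -
    have "(nrm l f)\<^sup>2 - 2 * t * ip l f h + t\<^sup>2 * (nrm l h)\<^sup>2 = (nrm l (\<lambda>x. f x - t * h x))\<^sup>2"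
      using f h by (simp add: nrm_diff_power2 L2_on_cmult ip_cmult_right nrm_cmult power_mult_distrib)
    then show ?thesis by simp
  qed
  show ?thesis
  proof (cases "nrm l h = 0")
    case True
    have "ip l f h = 0"
    proof (rule ccontr)
      assume nz: "ip l f h \<noteq> 0"
      \<comment> \<open>The quadratic term is absent, so \<open>pos\<close> is affine in
        \<open>t\<close>; this choice of \<open>t\<close> gives it the value -1.\<close>
      show False using pos[of "((nrm l f)\<^sup>2 + 1) / (2 * ip l f h)"] nz True by simp
    qed
    then show ?thesis using True by simp
  next
    case False
    then have nz: "(nrm l h)\<^sup>2 > 0" by simp
    have "0 \<le> (nrm l f)\<^sup>2 - (ip l f h)\<^sup>2 / (nrm l h)\<^sup>2"
      using pos[of "ip l f h / (nrm l h)\<^sup>2"] False by (simp add: field_simps power2_eq_square)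
    then have "(ip l f h)\<^sup>2 \<le> (nrm l f * nrm l h)\<^sup>2"
      using nz by (simp add: field_simps power_mult_distrib)
    then show ?thesis
      by (metis abs_le_square_iff abs_of_nonneg mult_nonneg_nonneg nrm_nonneg)
  qed
qed

lemma nrm_triangle:
  assumes f: "L2_on {0..l} f" and h: "L2_on {0..l} h"
  shows "nrm l (\<lambda>x. f x + h x) \<le> nrm l f + nrm l h"
proof -
  have "(nrm l (\<lambda>x. f x + h x))\<^sup>2 = (nrm l f)\<^sup>2 + 2 * ip l f h + (nrm l h)\<^sup>2"
    using nrm_diff_power2[OF f L2_on_cmult[OF h, of "-1"]]
    by (simp add: nrm_cmult[of l "-1" h, simplified] ip_cmult_right[of l f "-1" h, simplified])
  also have "\<dots> \<le> (nrm l f + nrm l h)\<^sup>2"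
    using ip_Cauchy_Schwarz[OF f h] by (simp add: power2_sum)
  finally show ?thesis by (rule power2_le_imp_le) (simp add: nrm_nonneg)
qed

lemma nrm_triangle_diff:
  assumes "L2_on {0..l} f" "L2_on {0..l} h" "L2_on {0..l} q"
  shows "nrm l (\<lambda>x. f x - q x) \<le> nrm l (\<lambda>x. f x - h x) + nrm l (\<lambda>x. h x - q x)"
  using nrm_triangle[OF L2_on_diff[OF assms(1,2)] L2_on_diff[OF assms(2,3)]] by simp

lemma nrm_le_diff:
  assumes "L2_on {0..l} f" "L2_on {0..l} h"
  shows "nrm l f \<le> nrm l (\<lambda>x. f x - h x) + nrm l h"
  using nrm_triangle[OF L2_on_diff[OF assms] assms(2)] by simp

lemma nrm_le_bound:
  assumes "L2_on {0..l} f" "l \<ge> 0" "\<And>x. x \<in> {0..l} \<Longrightarrow> \<bar>f x\<bar> \<le> B * \<bar>h x\<bar>" "L2_on {0..l} h" "0 \<le> B"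
  shows "nrm l f \<le> B * nrm l h"
proof -
  have "ip l f f \<le> B\<^sup>2 * ip l h h"
    unfolding ip_def integral_mult_right_zero[symmetric]
  proof (rule integral_mono_AE)
    show "AE x in lebesgue_on {0..l}. f x * f x \<le> B\<^sup>2 * (h x * h x)"
    proof (intro AE_I2)
      fix x assume "x \<in> space (lebesgue_on {0..l})"
      then have "\<bar>f x\<bar> \<le> B * \<bar>h x\<bar>" using assms(3) by simp
      from power_mono[OF this, of 2] show "f x * f x \<le> B\<^sup>2 * (h x * h x)"
        by (simp add: power_mult_distrib flip: power2_eq_square)
    qed
  qed (use assms in \<open>auto intro!: L2_on_mult_integrable integrable_mult_right\<close>)
  then have "(nrm l f)\<^sup>2 \<le> (B * nrm l h)\<^sup>2" by (simp add: nrm_power2 power_mult_distrib)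
  then show ?thesis by (rule power2_le_imp_le) (simp add: nrm_nonneg assms)
qed

lemma nrm_one: "0 \<le> l \<Longrightarrow> nrm l (\<lambda>x. 1) = sqrt l"
  by (simp add: nrm_def ip_def measure_restrict_space)

lemma nrm_le_sup:
  assumes "L2_on {0..l} f" "l \<ge> 0" "\<And>x. x \<in> {0..l} \<Longrightarrow> \<bar>f x\<bar> \<le> B" 
  shows "nrm l f \<le> B * sqrt l"
proof -
  have "0 \<le> B" using assms(3)[of 0] assms(2) by simp
  then show ?thesis
    using nrm_le_bound[of l f B "\<lambda>x. 1"] assms nrm_one[of l] by (simp add: L2_on_continuous)
qed

lemma ip_eq_integral:
  assumes "continuous_on {0..l} f" "continuous_on {0..l} h"
  shows "ip l f h = integral {0..l} (\<lambda>x. f x * h x)"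
  unfolding ip_def
  by (intro lebesgue_integral_eq_integral continuous_imp_integrable_real continuous_intros assms) simp

lemma nrm_eq_0_continuous:
  assumes c: "continuous_on {0..l} f" and "nrm l f = 0" and x: "x \<in> {0..l}" and "l > 0"
  shows "f x = 0"
proof -
  have i: "integral {0..l} (\<lambda>x. f x * f x) = 0"
    using assms(2) ip_eq_integral[OF c c] ip_nonneg[of l f] by (simp add: nrm_def)
  have "f x * f x = 0"
  proof (rule has_integral_0_cbox_imp_0[of 0 l "\<lambda>x. f x * f x"])
    show "continuous_on (cbox 0 l) (\<lambda>x. f x * f x)" using c by (auto intro!: continuous_intros)
    have "(\<lambda>x. f x * f x) integrable_on {0..l}"
      by (intro integrable_continuous_interval continuous_intros c)
    then show "((\<lambda>x. f x * f x) has_integral 0) (cbox 0 l)" using i by (metis has_integral_integral interval_cbox)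
  qed (use x \<open>l > 0\<close> in auto)
  then show ?thesis by simp
qed

lemma nrm_pos_continuous:
  assumes c: "continuous_on {0..l} f" and x: "x \<in> {0..l}" and "f x \<noteq> 0" and "l > 0"
  shows "0 < nrm l f"
  using nrm_eq_0_continuous[OF c _ x \<open>l > 0\<close>] assms(3) nrm_nonneg[of l f] by (metis less_eq_real_def)

lemma nrm_abs: "nrm l (\<lambda>x. \<bar>f x\<bar>) = nrm l f"
  by (simp add: nrm_def ip_def)

text \<open>Absolute values are taken first, so that enlarging the interval of integration to
  \<open>{0..l}\<close> can only increase the integral.\<close>

lemma integral_mult_le_nrm:
  assumes cf: "continuous_on {0..l} f" and ch: "continuous_on {0..l} h" and "0 \<le> c" "d \<le> l"
  shows "\<bar>integral {c..d} (\<lambda>x. f x * h x)\<bar> \<le> nrm l f * nrm l h"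
proof -
  have sub: "{c..d} \<subseteq> {0..l}" using assms by auto
  have c1: "continuous_on {0..l} (\<lambda>x. f x * h x)" and c2: "continuous_on {0..l} (\<lambda>x. \<bar>f x\<bar> * \<bar>h x\<bar>)"
    by (intro continuous_intros cf ch)+
  note i1 = integrable_continuous_interval[OF continuous_on_subset[OF c1 sub]]
  note i2 = integrable_continuous_interval[OF continuous_on_subset[OF c2 sub]]
  have "\<bar>integral {c..d} (\<lambda>x. f x * h x)\<bar> \<le> integral {c..d} (\<lambda>x. \<bar>f x\<bar> * \<bar>h x\<bar>)"
    using integral_norm_bound_integral[OF i1 i2] by (simp add: abs_mult)
  also have "\<dots> \<le> integral {0..l} (\<lambda>x. \<bar>f x\<bar> * \<bar>h x\<bar>)"
    by (rule integral_subset_le[OF sub i2 integrable_continuous_interval[OF c2]]) simp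
  also have "\<dots> = ip l (\<lambda>x. \<bar>f x\<bar>) (\<lambda>x. \<bar>h x\<bar>)"
    by (rule ip_eq_integral[symmetric]) (intro continuous_intros cf ch)+
  also have "\<dots> \<le> nrm l f * nrm l h"
    using ip_Cauchy_Schwarz[of l "\<lambda>x. \<bar>f x\<bar>" "\<lambda>x. \<bar>h x\<bar>"] cf ch
    by (simp add: nrm_abs L2_on_continuous continuous_on_rabs)
  finally show ?thesis .
qed

lemma nrm_tendsto_uniform:
  assumes c: "\<And>n. continuous_on {0..l} (u n)" "continuous_on {0..l} h" and "l > 0"
    and lim: "\<And>e. 0 < e \<Longrightarrow> \<exists>N. \<forall>n\<ge>N. \<forall>x\<in>{0..l}. \<bar>u n x - h x\<bar> < e"
  shows "(\<lambda>n. nrm l (\<lambda>x. u n x - h x)) \<longlonglongrightarrow> 0"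
proof (rule LIMSEQ_I)
  fix r :: real assume "0 < r"
  then have "0 < r / 2 / sqrt l" using \<open>l > 0\<close> by simp
  then obtain N where N: "\<forall>n\<ge>N. \<forall>x\<in>{0..l}. \<bar>u n x - h x\<bar> < r / 2 / sqrt l" using lim by blast
  have "norm (nrm l (\<lambda>x. u n x - h x) - 0) < r" if "n \<ge> N" for n
  proof -
    have "nrm l (\<lambda>x. u n x - h x) \<le> r / 2 / sqrt l * sqrt l"
      by (rule nrm_le_sup) (use N that \<open>l > 0\<close> c in \<open>auto intro!: less_imp_le L2_on_continuous continuous_intros\<close>)
    also have "\<dots> = r / 2" using \<open>l > 0\<close> by simp
    finally show ?thesis using \<open>0 < r\<close> nrm_nonneg[of l "\<lambda>x. u n x - h x"] by simp
  qed
  then show "\<exists>no. \<forall>n\<ge>no. norm (nrm l (\<lambda>x. u n x - h x) - 0) < r" by blast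
qed

lemma ip_tendsto:
  assumes "\<And>n. L2_on {0..l} (u n)" "L2_on {0..l} h" "L2_on {0..l} q"
    and lim: "(\<lambda>n. nrm l (\<lambda>x. u n x - h x)) \<longlonglongrightarrow> 0"
  shows "(\<lambda>n. ip l (u n) q) \<longlonglongrightarrow> ip l h q"
proof -
  have "(\<lambda>n. ip l (u n) q - ip l h q) \<longlonglongrightarrow> 0"
  proof (rule Lim_null_comparison)
    show "\<forall>\<^sub>F n in sequentially. norm (ip l (u n) q - ip l h q) \<le> nrm l (\<lambda>x. u n x - h x) * nrm l q"
      using assms by (auto intro!: always_eventually ip_Cauchy_Schwarz L2_on_diff simp flip: ip_diff_left)
    show "(\<lambda>n. nrm l (\<lambda>x. u n x - h x) * nrm l q) \<longlonglongrightarrow> 0"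
      using tendsto_mult_right[OF lim, of "nrm l q"] by simp
  qed
  then show ?thesis by (simp add: LIM_zero_iff)
qed

lemma nrm_diff_commute: "nrm l (\<lambda>x. f x - h x) = nrm l (\<lambda>x. h x - f x)"
  by (simp add: nrm_def ip_def algebra_simps)

lemma nrm_tendsto:
  assumes "\<And>n. L2_on {0..l} (u n)" "L2_on {0..l} h"
    and lim: "(\<lambda>n. nrm l (\<lambda>x. u n x - h x)) \<longlonglongrightarrow> 0"
  shows "(\<lambda>n. nrm l (u n)) \<longlonglongrightarrow> nrm l h"
proof -
  have "(\<lambda>n. nrm l (u n) - nrm l h) \<longlonglongrightarrow> 0"
  proof (rule Lim_null_comparison[OF _ lim], intro always_eventually allI)
    fix n
    show "norm (nrm l (u n) - nrm l h) \<le> nrm l (\<lambda>x. u n x - h x)"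
      using nrm_le_diff[OF assms(1)[of n] assms(2)] nrm_le_diff[OF assms(2) assms(1)[of n]]
        nrm_diff_commute[of l h "u n"] by auto
  qed
  then show ?thesis by (simp add: LIM_zero_iff)
qed

section \<open>The Dirichlet problem and its Green operator\<close>

lemma continuous_on_Icc_abs_bound:
  fixes f :: "real \<Rightarrow> real"
  assumes "continuous_on {0..l} f"
  obtains B where "0 \<le> B" "\<And>x. x \<in> {0..l} \<Longrightarrow> \<bar>f x\<bar> \<le> B"
proof -
  obtain B where "\<forall>y\<in>f ` {0..l}. \<bar>y\<bar> \<le> B"
    using compact_imp_bounded[OF compact_continuous_image[OF assms compact_Icc]]
    unfolding bounded_real by blast
  then have "\<And>x. x \<in> {0..l} \<Longrightarrow> \<bar>f x\<bar> \<le> max 0 B"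
    by (metis imageI max.coboundedI2)
  then show ?thesis using that[of "max 0 B"] by simp
qed

text \<open>Positivity of \<open>M\<close> puts the operator \<open>M u - D u''\<close> under the
  maximum principle: the Dirichlet problem is uniquely solvable and all eigenvalues are positive. In
  the application \<open>M\<close> is \<open>\<kappa> - Q\<close>.\<close>

locale dirichlet =
  fixes l D :: real and M :: "real \<Rightarrow> real"
  assumes l_pos: "l > 0" and D_pos: "D > 0"
    and M_cont: "continuous_on {0..l} M" and M_pos: "\<And>x. x \<in> {0..l} \<Longrightarrow> M x > 0"
begin

text \<open>The graph of the Green operator \<open>T\<close>, sending \<open>f\<close> to
  \<open>u\<close>. A relation is convenient because \<open>u\<close> is determined only on
  \<open>{0..l}\<close>.\<close>

definition sol :: "(real \<Rightarrow> real) \<Rightarrow> (real \<Rightarrow> real) \<Rightarrow> bool" where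
  "sol u f \<longleftrightarrow> u 0 = 0 \<and> u l = 0 \<and>
     (\<exists>u'. \<forall>x\<in>{0..l}. (u has_real_derivative u' x) (at x within {0..l}) \<and>
        (u' has_real_derivative (M x * u x - f x) / D) (at x within {0..l}))"

lemma solI:
  assumes "u 0 = 0" "u l = 0"
    "\<And>x. x \<in> {0..l} \<Longrightarrow> (u has_real_derivative u' x) (at x within {0..l})"
    "\<And>x. x \<in> {0..l} \<Longrightarrow> (u' has_real_derivative (M x * u x - f x) / D) (at x within {0..l})"
  shows "sol u f"
  unfolding sol_def using assms by (intro conjI exI[of _ u'] ballI) auto

text \<open>Variation of parameters. Both estimates are by the L2 norm of \<open>f\<close> rather
  than its supremum: they have to make the Green operator compact from the L2 norm to uniform
  convergence.\<close>

lemma green_exists: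
  obtains C where "C \<ge> 0" "\<And>f. continuous_on {0..l} f \<Longrightarrow> \<exists>u. sol u f \<and>
    (\<forall>x\<in>{0..l}. \<bar>u x\<bar> \<le> C * nrm l f \<and> (\<forall>y\<in>{0..l}. \<bar>u x - u y\<bar> \<le> C * nrm l f * \<bar>x - y\<bar>))"
proof -
  define p where "p x = M x / D" for x
  have pc: "continuous_on {0..l} p" unfolding p_def using D_pos by (auto intro!: continuous_intros M_cont)
  have p0: "0 \<le> p x" if "x \<in> {0..l}" for x using M_pos[OF that] D_pos by (simp add: p_def)
  have p0': "0 \<le> p (l - x)" if "x \<in> {0..l}" for x using p0[of "l - x"] that by simp
  have pc': "continuous_on {0..l} (\<lambda>x. p (l - x))"
    by (rule continuous_on_compose2[OF pc]) (auto intro!: continuous_intros)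
  obtain a a' where a0: "a 0 = 0" and a'0: "a' 0 = 1" and
    a: "\<And>x. x \<in> {0..l} \<Longrightarrow> (a has_real_derivative a' x) (at x within {0..l})" and
    a': "\<And>x. x \<in> {0..l} \<Longrightarrow> (a' has_real_derivative p x * a x) (at x within {0..l})"
    using cauchy_problem_solution[OF pc p0 l_pos] by metis
  obtain \<phi> \<phi>' where \<phi>0: "\<phi> 0 = 0" and
    \<phi>: "\<And>x. x \<in> {0..l} \<Longrightarrow> (\<phi> has_real_derivative \<phi>' x) (at x within {0..l})" and
    \<phi>': "\<And>x. x \<in> {0..l} \<Longrightarrow> (\<phi>' has_real_derivative p (l - x) * \<phi> x) (at x within {0..l})" and
    \<phi>_ge: "\<And>x. x \<in> {0..l} \<Longrightarrow> x \<le> \<phi> x"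
    using cauchy_problem_solution[OF pc' p0' l_pos] by metis
  \<comment> \<open>The second fundamental solution must vanish at \<open>l\<close>; it is obtained
    by reflecting the Cauchy solution for the reflected potential.\<close>
  define b where "b x = \<phi> (l - x)" for x
  define b' where "b' x = - \<phi>' (l - x)" for x
  have refl: "(\<lambda>x. l - x) ` {0..l} = {0..l}"
    by (auto simp: image_iff)
  have rd: "((\<lambda>x. l - x) has_real_derivative -1) (at x within {0..l})" for x
    by (auto intro!: derivative_eq_intros)
  have b: "(b has_real_derivative b' x) (at x within {0..l})" if "x \<in> {0..l}" for x
    using DERIV_image_chain[of \<phi> "\<phi>' (l - x)" "\<lambda>x. l - x" x "{0..l}" "-1"] \<phi>[of "l - x"] rd that
    by (simp add: refl o_def b_def[abs_def] b'_def)
  have b': "(b' has_real_derivative p x * b x) (at x within {0..l})" if "x \<in> {0..l}" for x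
    using DERIV_minus[OF DERIV_image_chain[of \<phi>' "p x * b x" "\<lambda>x. l - x" x "{0..l}" "-1"]]
      \<phi>'[of "l - x"] rd that
    by (simp add: refl o_def b_def b'_def[abs_def])
  have bl: "b l = 0" by (simp add: b_def \<phi>0)
  define W where "W = b 0"
  have W: "W > 0" using \<phi>_ge[of l] l_pos by (simp add: W_def b_def)
  \<comment> \<open>The Wronskian is constant since \<open>a\<close> and \<open>b\<close> solve the
    same equation. Its value at 0 is \<open>b 0 = \<phi> l\<close>, which is at least
    \<open>l\<close>.\<close>
  have "\<exists>c. \<forall>x\<in>{0..l}. a' x * b x - a x * b' x = c"
  proof (rule has_field_derivative_zero_constant)
    fix x assume x: "x \<in> {0..l}"
    show "((\<lambda>x. a' x * b x - a x * b' x) has_real_derivative 0) (at x within {0..l})"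
      using DERIV_diff[OF DERIV_mult[OF a'[OF x] b[OF x]] DERIV_mult[OF a[OF x] b'[OF x]]]
      by (simp add: algebra_simps)
  qed simp
  then obtain c where c: "\<forall>x\<in>{0..l}. a' x * b x - a x * b' x = c" by blast
  have "0 \<in> {0..l}" using l_pos by simp
  with c have "c = W" using a0 a'0 by (metis diff_zero mult_1 mult_zero_left W_def)
  with c have wr: "\<And>x. x \<in> {0..l} \<Longrightarrow> a' x * b x - a x * b' x = W" by blast
  note ac = continuous_on_DERIV[OF a] and bc = continuous_on_DERIV[OF b]
    and a'c = continuous_on_DERIV[OF a'] and b'c = continuous_on_DERIV[OF b']
  obtain Ba where Ba: "0 \<le> Ba" "\<And>x. x \<in> {0..l} \<Longrightarrow> \<bar>a x\<bar> \<le> Ba" using continuous_on_Icc_abs_bound[OF ac] by metis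
  obtain Bb where Bb: "0 \<le> Bb" "\<And>x. x \<in> {0..l} \<Longrightarrow> \<bar>b x\<bar> \<le> Bb" using continuous_on_Icc_abs_bound[OF bc] by metis
  obtain Ba' where Ba': "0 \<le> Ba'" "\<And>x. x \<in> {0..l} \<Longrightarrow> \<bar>a' x\<bar> \<le> Ba'" using continuous_on_Icc_abs_bound[OF a'c] by metis
  obtain Bb' where Bb': "0 \<le> Bb'" "\<And>x. x \<in> {0..l} \<Longrightarrow> \<bar>b' x\<bar> \<le> Bb'" using continuous_on_Icc_abs_bound[OF b'c] by metis
  define B where "B = Ba + Bb + Ba' + Bb'"
  \<comment> \<open>One constant serves as sup bound and as Lipschitz constant, since
    \<open>B\<close> dominates \<open>a\<close>, \<open>b\<close> and their derivatives alike; the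
    two norms come from Cauchy-Schwarz for the integrals against \<open>f\<close>.\<close>
  define C where "C = (B * nrm l a + B * nrm l b) / (D * W)"
  have "B \<ge> 0" using Ba(1) Bb(1) Ba'(1) Bb'(1) by (simp add: B_def)
  have Bs: "\<bar>a x\<bar> \<le> B" "\<bar>b x\<bar> \<le> B" "\<bar>a' x\<bar> \<le> B" "\<bar>b' x\<bar> \<le> B" if "x \<in> {0..l}" for x
    using Ba(2)[OF that] Bb(2)[OF that] Ba'(2)[OF that] Bb'(2)[OF that] Ba(1) Bb(1) Ba'(1) Bb'(1) by (auto simp: B_def)
  have C0: "C \<ge> 0" unfolding C_def using \<open>B \<ge> 0\<close> W D_pos by (simp add: nrm_nonneg)
  show ?thesis
  proof (rule that[OF C0])
    fix f :: "real \<Rightarrow> real" assume fc: "continuous_on {0..l} f"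
    define I where "I x = integral {0..x} (\<lambda>s. a s * f s)" for x
    define J where "J x = integral {x..l} (\<lambda>s. b s * f s)" for x
    have I: "(I has_real_derivative a x * f x) (at x within {0..l})" if "x \<in> {0..l}" for x
      unfolding I_def[abs_def] by (intro integral_has_real_derivative[OF _ that] continuous_intros ac fc)
    have J: "(J has_real_derivative - (b x * f x)) (at x within {0..l})" if "x \<in> {0..l}" for x
      unfolding J_def[abs_def] by (intro integral_has_real_derivative'[OF _ that] continuous_intros bc fc)
    \<comment> \<open>This integrates \<open>f\<close> against the Green kernel
      \<open>a (min x y) * b (max x y) / (D * W)\<close>. In \<open>u'\<close> the contributions of
      the derivatives of \<open>I\<close> and \<open>J\<close> cancel, which leaves the same shape
      with \<open>a'\<close> and \<open>b'\<close>.\<close>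
    define u where "u x = (b x * I x + a x * J x) / (D * W)" for x
    define u' where "u' x = (b' x * I x + a' x * J x) / (D * W)" for x
    have DW: "D * W > 0" using D_pos W by simp
    have bound: "\<bar>(\<beta> * I x + \<alpha> * J x) / (D * W)\<bar> \<le> C * nrm l f"
      if "x \<in> {0..l}" "\<bar>\<alpha>\<bar> \<le> B" "\<bar>\<beta>\<bar> \<le> B" for x \<alpha> \<beta>
    proof -
      have 1: "\<bar>I x\<bar> \<le> nrm l a * nrm l f" unfolding I_def
        by (rule integral_mult_le_nrm[OF ac fc]) (use that in auto)
      have 2: "\<bar>J x\<bar> \<le> nrm l b * nrm l f" unfolding J_def
        by (rule integral_mult_le_nrm[OF bc fc]) (use that in auto)
      have "\<bar>\<beta> * I x + \<alpha> * J x\<bar> \<le> \<bar>\<beta>\<bar> * \<bar>I x\<bar> + \<bar>\<alpha>\<bar> * \<bar>J x\<bar>"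
        by (metis abs_mult abs_triangle_ineq)
      also have "\<dots> \<le> B * (nrm l a * nrm l f) + B * (nrm l b * nrm l f)"
        by (intro add_mono mult_mono that 1 2 \<open>B \<ge> 0\<close>) auto
      finally have "\<bar>\<beta> * I x + \<alpha> * J x\<bar> / (D * W) \<le> (B * (nrm l a * nrm l f) + B * (nrm l b * nrm l f)) / (D * W)"
        using DW by (intro divide_right_mono) auto
      also have "\<dots> = C * nrm l f" by (simp add: C_def ring_distribs add_divide_distrib)
      finally show ?thesis using DW D_pos W by (simp add: abs_mult)
    qed
    have u0: "u 0 = 0" "u l = 0" by (simp_all add: u_def I_def J_def a0 bl)
    have u1: "(u has_real_derivative u' x) (at x within {0..l})" if x: "x \<in> {0..l}" for x
    proof -
      have "(u has_real_derivative
          (b' x * I x + a x * f x * b x + (a' x * J x + - (b x * f x) * a x)) / (D * W)) (at x within {0..l})"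
        unfolding u_def[abs_def]
        by (intro DERIV_cdivide DERIV_add DERIV_mult a[OF x] b[OF x] I[OF x] J[OF x])
      then show ?thesis by (simp add: u'_def algebra_simps)
    qed
    have u2: "(u' has_real_derivative (M x * u x - f x) / D) (at x within {0..l})" if x: "x \<in> {0..l}" for x
    proof -
      have "(u' has_real_derivative
          (p x * b x * I x + a x * f x * b' x + (p x * a x * J x + - (b x * f x) * a' x)) / (D * W)) (at x within {0..l})"
        unfolding u'_def[abs_def]
        by (intro DERIV_cdivide DERIV_add DERIV_mult a'[OF x] b'[OF x] I[OF x] J[OF x])
      \<comment> \<open>At second order the derivatives of \<open>I\<close> and \<open>J\<close> no
        longer cancel: they contribute minus the Wronskian times \<open>f\<close>, and division by
        \<open>D * W\<close> leaves the source term \<open>- f x / D\<close>.\<close>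
      also have "p x * b x * I x + a x * f x * b' x + (p x * a x * J x + - (b x * f x) * a' x)
          = p x * (b x * I x + a x * J x) - (a' x * b x - a x * b' x) * f x" by (simp add: algebra_simps)
      also have "\<dots> / (D * W) = (M x * u x - f x) / D"
        unfolding wr[OF x] using D_pos W by (simp add: p_def u_def field_simps)
      finally show ?thesis .
    qed
    have ub: "\<bar>u x\<bar> \<le> C * nrm l f" "\<bar>u' x\<bar> \<le> C * nrm l f" if x: "x \<in> {0..l}" for x
      unfolding u_def u'_def using bound[OF x] Bs[OF x] by auto
    have "sol u f" using u0 u1 u2 by (rule solI)
    moreover have "\<bar>u x - u y\<bar> \<le> C * nrm l f * \<bar>x - y\<bar>" if "x \<in> {0..l}" "y \<in> {0..l}" for x y
    proof -
      have "norm (u x - u y) \<le> C * nrm l f * norm (x - y)"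
        by (rule field_differentiable_bound[of "{0..l}" u u']) (use u1 ub that in auto)
      then show ?thesis by simp
    qed
    ultimately show "\<exists>u. sol u f \<and>
    (\<forall>x\<in>{0..l}. \<bar>u x\<bar> \<le> C * nrm l f \<and> (\<forall>y\<in>{0..l}. \<bar>u x - u y\<bar> \<le> C * nrm l f * \<bar>x - y\<bar>))"
      using ub by blast
  qed
qed

text \<open>Solutions with derivatives in the interior only, which is all that \<open>SL_eigenpair\<close> provides; for
  continuous \<open>f\<close> they turn out to be the same.\<close>

definition wsol :: "(real \<Rightarrow> real) \<Rightarrow> (real \<Rightarrow> real) \<Rightarrow> bool" where
  "wsol u f \<longleftrightarrow> continuous_on {0..l} u \<and> u 0 = 0 \<and> u l = 0 \<and>
     (\<exists>u' u''. \<forall>x\<in>{0<..<l}. (u has_real_derivative u' x) (at x) \<and>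
        (u' has_real_derivative u'' x) (at x) \<and> f x = M x * u x - D * u'' x)"

lemma wsolI:
  assumes "continuous_on {0..l} u" "u 0 = 0" "u l = 0"
    "\<And>x. x \<in> {0<..<l} \<Longrightarrow> (u has_real_derivative u' x) (at x)"
    "\<And>x. x \<in> {0<..<l} \<Longrightarrow> (u' has_real_derivative u'' x) (at x)"
    "\<And>x. x \<in> {0<..<l} \<Longrightarrow> f x = M x * u x - D * u'' x"
  shows "wsol u f"
  unfolding wsol_def using assms by (intro conjI exI[of _ u'] exI[of _ u''] ballI) auto

lemma sol_continuous:
  assumes "sol u f" shows "continuous_on {0..l} u"
proof -
  obtain u' where "\<forall>x\<in>{0..l}. (u has_real_derivative u' x) (at x within {0..l})"
    using assms by (auto simp: sol_def)
  then show ?thesis by (intro continuous_on_DERIV[of "{0..l}" u u']) auto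
qed

lemma sol_wsol:
  assumes "sol u f" shows "wsol u f"
proof -
  obtain u' where u': "\<forall>x\<in>{0..l}. (u has_real_derivative u' x) (at x within {0..l}) \<and>
        (u' has_real_derivative (M x * u x - f x) / D) (at x within {0..l})"
    using assms by (auto simp: sol_def)
  show ?thesis
  proof (rule wsolI[OF sol_continuous[OF assms]])
    fix x assume x: "x \<in> {0<..<l}"
    show "(u has_real_derivative u' x) (at x)" "(u' has_real_derivative (M x * u x - f x) / D) (at x)"
      "f x = M x * u x - D * ((M x * u x - f x) / D)"
      using bspec[OF u', of x] x D_pos by (simp_all add: at_within_Icc_at)
  qed (use assms in \<open>auto simp: sol_def\<close>)
qed

lemma wsol_lincomb:
  assumes "wsol u f" "wsol v h"
  shows "wsol (\<lambda>x. c * u x + d * v x) (\<lambda>x. c * f x + d * h x)"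
proof -
  obtain u' u'' where u: "\<forall>x\<in>{0<..<l}. (u has_real_derivative u' x) (at x) \<and>
        (u' has_real_derivative u'' x) (at x) \<and> f x = M x * u x - D * u'' x"
    using assms(1) by (auto simp: wsol_def)
  obtain v' v'' where v: "\<forall>x\<in>{0<..<l}. (v has_real_derivative v' x) (at x) \<and>
        (v' has_real_derivative v'' x) (at x) \<and> h x = M x * v x - D * v'' x"
    using assms(2) by (auto simp: wsol_def)
  have "((\<lambda>x. c * u x + d * v x) has_real_derivative c * u' x + d * v' x) (at x)"
    "((\<lambda>x. c * u' x + d * v' x) has_real_derivative c * u'' x + d * v'' x) (at x)"
    "c * f x + d * h x = M x * (c * u x + d * v x) - D * (c * u'' x + d * v'' x)" if "x \<in> {0<..<l}" for x
  proof -
    note ux = bspec[OF u that] and vx = bspec[OF v that]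
    show "((\<lambda>x. c * u x + d * v x) has_real_derivative c * u' x + d * v' x) (at x)"
      "((\<lambda>x. c * u' x + d * v' x) has_real_derivative c * u'' x + d * v'' x) (at x)"
      by (intro DERIV_add DERIV_cmult; use ux vx in blast)+
    have "f x = M x * u x - D * u'' x" "h x = M x * v x - D * v'' x" using ux vx by auto
    then show "c * f x + d * h x = M x * (c * u x + d * v x) - D * (c * u'' x + d * v'' x)"
      by (simp only:) (simp add: algebra_simps)
  qed
  moreover have "continuous_on {0..l} (\<lambda>x. c * u x + d * v x)"
    using assms unfolding wsol_def by (intro continuous_intros) auto
  moreover have "c * u 0 + d * v 0 = 0" "c * u l + d * v l = 0"
    using assms unfolding wsol_def by auto
  ultimately show ?thesis by (intro wsolI)
qed

lemma wsol_nonpos: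
  assumes "wsol u f" "\<And>x. x \<in> {0<..<l} \<Longrightarrow> u x > 0 \<Longrightarrow> f x \<le> 0" "x \<in> {0..l}"
  shows "u x \<le> 0"
proof -
  obtain u' u'' where u: "\<forall>x\<in>{0<..<l}. (u has_real_derivative u' x) (at x) \<and>
        (u' has_real_derivative u'' x) (at x) \<and> f x = M x * u x - D * u'' x"
    using assms(1) by (auto simp: wsol_def)
  show ?thesis
    by (rule elliptic_max_principle[of l u D M u' u''])
       (use assms u D_pos M_pos in \<open>auto simp: wsol_def\<close>)
qed

lemma wsol_unique:
  assumes "wsol u f" "wsol v f" "x \<in> {0..l}"
  shows "u x = v x"
proof -
  have "1 * u x + - 1 * v x \<le> 0"
    by (rule wsol_nonpos[OF wsol_lincomb[OF assms(1,2)]]) (use assms in auto)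
  moreover have "1 * v x + - 1 * u x \<le> 0"
    by (rule wsol_nonpos[OF wsol_lincomb[OF assms(2,1)]]) (use assms in auto)
  ultimately show ?thesis by simp
qed

lemma sol_exists: "continuous_on {0..l} f \<Longrightarrow> \<exists>u. sol u f"
  using green_exists by metis

lemma sol_cong:
  assumes "sol u f" "\<And>x. x \<in> {0..l} \<Longrightarrow> u x = v x" "\<And>x. x \<in> {0..l} \<Longrightarrow> f x = h x"
  shows "sol v h"
proof -
  obtain u' where u': "\<forall>x\<in>{0..l}. (u has_real_derivative u' x) (at x within {0..l}) \<and>
        (u' has_real_derivative (M x * u x - f x) / D) (at x within {0..l})"
    using assms(1) by (auto simp: sol_def)
  have "(v has_real_derivative u' x) (at x within {0..l})"
        "(u' has_real_derivative (M x * v x - h x) / D) (at x within {0..l})" if x: "x \<in> {0..l}" for x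
    using has_field_derivative_transform_within[OF conjunct1[OF bspec[OF u' x]] zero_less_one x, of v]
      bspec[OF u' x] assms(2,3) x by simp_all
  moreover have "v 0 = 0" "v l = 0" using assms(1) assms(2)[of 0] assms(2)[of l] l_pos by (auto simp: sol_def)
  ultimately show ?thesis by (intro solI)
qed

text \<open>Regularity up to the endpoints follows from uniqueness: the solution built with the
  Green kernel has one-sided derivatives there and must coincide with \<open>u\<close>.\<close>

lemma wsol_imp_sol:
  assumes "wsol u f" "continuous_on {0..l} f"
  shows "sol u f"
proof -
  obtain v where v: "sol v f" using sol_exists[OF assms(2)] by blast
  show ?thesis
    by (rule sol_cong[OF v]) (use wsol_unique[OF sol_wsol[OF v] assms(1)] in auto)
qed

lemma sol_unique: "sol u f \<Longrightarrow> sol v f \<Longrightarrow> x \<in> {0..l} \<Longrightarrow> u x = v x"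
  using wsol_unique sol_wsol by blast

lemma sol_lincomb:
  assumes "sol u f" "sol v h"
  shows "sol (\<lambda>x. c * u x + d * v x) (\<lambda>x. c * f x + d * h x)"
proof -
  obtain u' where u: "\<forall>x\<in>{0..l}. (u has_real_derivative u' x) (at x within {0..l}) \<and>
        (u' has_real_derivative (M x * u x - f x) / D) (at x within {0..l})"
    using assms(1) by (auto simp: sol_def)
  obtain v' where v: "\<forall>x\<in>{0..l}. (v has_real_derivative v' x) (at x within {0..l}) \<and>
        (v' has_real_derivative (M x * v x - h x) / D) (at x within {0..l})"
    using assms(2) by (auto simp: sol_def)
  have eq: "(M x * (c * u x + d * v x) - (c * f x + d * h x)) / D
     = c * ((M x * u x - f x) / D) + d * ((M x * v x - h x) / D)" for x
    using D_pos by (simp add: field_simps)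
  have "((\<lambda>x. c * u x + d * v x) has_real_derivative c * u' x + d * v' x) (at x within {0..l})"
     "((\<lambda>x. c * u' x + d * v' x) has_real_derivative (M x * (c * u x + d * v x) - (c * f x + d * h x)) / D) (at x within {0..l})"
    if "x \<in> {0..l}" for x
    unfolding eq by (intro DERIV_add DERIV_cmult; use u v that in blast)+
  moreover have "c * u 0 + d * v 0 = 0" "c * u l + d * v l = 0"
    using assms unfolding sol_def by auto
  ultimately show ?thesis by (intro solI)
qed

lemma sol_cmult: "sol u f \<Longrightarrow> sol (\<lambda>x. c * u x) (\<lambda>x. c * f x)"
  using sol_lincomb[of u f u f c 0] by simp

lemma sol_diff: "sol u f \<Longrightarrow> sol v h \<Longrightarrow> sol (\<lambda>x. u x - v x) (\<lambda>x. f x - h x)"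
  using sol_lincomb[of u f v h 1 "-1"] by simp

lemma sol_zero: "sol (\<lambda>x. 0) (\<lambda>x. 0)"
  by (rule solI[of _ "\<lambda>x. 0"]) auto

lemma sol_sum: "finite I \<Longrightarrow> (\<And>i. i \<in> I \<Longrightarrow> sol (u i) (f i)) \<Longrightarrow> sol (\<lambda>x. \<Sum>i\<in>I. u i x) (\<lambda>x. \<Sum>i\<in>I. f i x)"
proof (induction I rule: finite_induct)
  case empty then show ?case by (simp add: sol_zero)
next
  case (insert i I)
  then show ?case using sol_lincomb[of "u i" "f i" "\<lambda>x. \<Sum>i\<in>I. u i x" "\<lambda>x. \<Sum>i\<in>I. f i x" 1 1] by simp
qed

lemma sol_bounds:
  obtains C where "C \<ge> 0"
    "\<And>u f x. sol u f \<Longrightarrow> continuous_on {0..l} f \<Longrightarrow> x \<in> {0..l} \<Longrightarrow> \<bar>u x\<bar> \<le> C * nrm l f"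
    "\<And>u f x y. sol u f \<Longrightarrow> continuous_on {0..l} f \<Longrightarrow> x \<in> {0..l} \<Longrightarrow> y \<in> {0..l} \<Longrightarrow>
       \<bar>u x - u y\<bar> \<le> C * nrm l f * \<bar>x - y\<bar>"
proof -
  obtain C where C: "C \<ge> 0" and ex: "\<And>f. continuous_on {0..l} f \<Longrightarrow> \<exists>u. sol u f \<and>
    (\<forall>x\<in>{0..l}. \<bar>u x\<bar> \<le> C * nrm l f \<and> (\<forall>y\<in>{0..l}. \<bar>u x - u y\<bar> \<le> C * nrm l f * \<bar>x - y\<bar>))"
    using green_exists by blast
  have main: "\<bar>u x\<bar> \<le> C * nrm l f \<and> \<bar>u x - u y\<bar> \<le> C * nrm l f * \<bar>x - y\<bar>"
    if u: "sol u f" and f: "continuous_on {0..l} f" and xy: "x \<in> {0..l}" "y \<in> {0..l}" for u f x y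
  proof -
    obtain v where v: "sol v f"
      "\<forall>x\<in>{0..l}. \<bar>v x\<bar> \<le> C * nrm l f \<and> (\<forall>y\<in>{0..l}. \<bar>v x - v y\<bar> \<le> C * nrm l f * \<bar>x - y\<bar>)"
      using ex[OF f] by blast
    then show ?thesis using sol_unique[OF u v(1)] xy by metis
  qed
  show ?thesis by (rule that[OF C]) (use main in blast)+
qed

text \<open>Lagrange's identity: \<open>f v - u h\<close> is the derivative of
  \<open>D (u v' - u' v)\<close>, which the Dirichlet conditions make vanish at both ends.\<close>

lemma sol_sym:
  assumes u: "sol u f" and v: "sol v h" and f: "continuous_on {0..l} f" and h: "continuous_on {0..l} h"
  shows "ip l u h = ip l f v"
proof -
  obtain u' where u': "\<forall>x\<in>{0..l}. (u has_real_derivative u' x) (at x within {0..l}) \<and>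
        (u' has_real_derivative (M x * u x - f x) / D) (at x within {0..l})"
    using assms(1) by (auto simp: sol_def)
  obtain v' where v': "\<forall>x\<in>{0..l}. (v has_real_derivative v' x) (at x within {0..l}) \<and>
        (v' has_real_derivative (M x * v x - h x) / D) (at x within {0..l})"
    using assms(2) by (auto simp: sol_def)
  note cu = sol_continuous[OF u] and cv = sol_continuous[OF v]
  have "((\<lambda>x. f x * v x - u x * h x) has_integral D * (u l * v' l - u' l * v l) - D * (u 0 * v' 0 - u' 0 * v 0)) {0..l}"
  proof (rule fundamental_theorem_of_calculus)
    fix x assume x: "x \<in> {0..l}"
    have "((\<lambda>x. D * (u x * v' x - u' x * v x)) has_real_derivative
       D * (u' x * v' x + (M x * v x - h x) / D * u x - ((M x * u x - f x) / D * v x + v' x * u' x))) (at x within {0..l})"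
      using bspec[OF u' x] bspec[OF v' x] by (intro DERIV_cmult DERIV_diff DERIV_mult) auto
    moreover have "D * (u' x * v' x + (M x * v x - h x) / D * u x - ((M x * u x - f x) / D * v x + v' x * u' x))
       = f x * v x - u x * h x" using D_pos by (simp add: field_simps)
    ultimately show "((\<lambda>x. D * (u x * v' x - u' x * v x)) has_vector_derivative f x * v x - u x * h x) (at x within {0..l})"
      by (simp add: has_real_derivative_iff_has_vector_derivative)
  qed (use l_pos in auto)
  then have "integral {0..l} (\<lambda>x. f x * v x - u x * h x) = 0"
    using u v by (simp add: sol_def integral_unique)
  moreover have "integral {0..l} (\<lambda>x. f x * v x - u x * h x) = ip l f v - ip l u h"
    using f h cu cv by (subst Henstock_Kurzweil_Integration.integral_diff)
      (auto intro!: integrable_continuous_interval continuous_intros simp: ip_eq_integral)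
  ultimately show ?thesis by simp
qed

text \<open>Injectivity of the Green operator. Two-sided derivatives decide the matter in the open
  interval only; continuity of \<open>f\<close> carries it to the endpoints.\<close>

lemma sol_zero_imp_rhs_zero:
  assumes u: "sol u f" and f: "continuous_on {0..l} f" and z: "\<And>x. x \<in> {0..l} \<Longrightarrow> u x = 0" and x: "x \<in> {0..l}"
  shows "f x = 0"
proof -
  obtain u' where u': "\<forall>x\<in>{0..l}. (u has_real_derivative u' x) (at x within {0..l}) \<and>
        (u' has_real_derivative (M x * u x - f x) / D) (at x within {0..l})"
    using assms(1) by (auto simp: sol_def)
  have u'0: "u' x = 0" if "x \<in> {0<..<l}" for x
    by (rule DERIV_eq_0_imp_interior[OF _ z that]) (use u' in auto)
  have int: "f x = 0" if x: "x \<in> {0<..<l}" for x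
  proof -
    have "(u' has_real_derivative (M x * u x - f x) / D) (at x)"
      using bspec[OF u', of x] x by (simp add: at_within_Icc_at)
    moreover have "(u' has_real_derivative 0) (at x)"
      by (rule has_field_derivative_transform_within_open[OF _ open_greaterThanLessThan x])
         (use u'0 in \<open>auto intro!: derivative_eq_intros\<close>)
    ultimately have "(M x * u x - f x) / D = 0" by (rule DERIV_unique)
    then show ?thesis using D_pos z[of x] x by simp
  qed
  have "closure {0<..<l} = {0..l}" using l_pos by simp
  then show ?thesis
    using continuous_constant_on_closure[of "{0<..<l}" f 0 x] f int x by simp
qed

text \<open>If \<open>\<mu> \<le> 0\<close>, the source \<open>\<mu> * h\<close> is nonpositive
  wherever \<open>h > 0\<close>, so the maximum principle gives \<open>h \<le> 0\<close>; the same
  reasoning applies to \<open>-h\<close>.\<close>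

lemma eigenvalue_pos:
  assumes h: "sol h (\<lambda>x. \<mu> * h x)" and x: "x \<in> {0..l}" "h x \<noteq> 0"
  shows "\<mu> > 0"
proof (rule ccontr)
  assume "\<not> \<mu> > 0"
  then have m: "\<mu> \<le> 0" by simp
  have "h x \<le> 0"
    by (rule wsol_nonpos[OF sol_wsol[OF h] _ x(1)]) (use m in \<open>auto simp: mult_le_0_iff\<close>)
  moreover have "-1 * h x \<le> 0"
    by (rule wsol_nonpos[OF sol_wsol[OF sol_cmult[OF h]] _ x(1)]) (use m in \<open>auto simp: mult_le_0_iff zero_le_mult_iff\<close>)
  ultimately show False using x by simp
qed

lemma eigenfunction_orthogonal:
  assumes e: "sol e (\<lambda>x. \<mu> * e x)" and h: "sol h (\<lambda>x. \<nu> * h x)" and "\<mu> \<noteq> \<nu>"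
  shows "ip l e h = 0"
proof -
  have "ip l e (\<lambda>x. \<nu> * h x) = ip l (\<lambda>x. \<mu> * e x) h"
    by (rule sol_sym[OF e h]) (intro continuous_intros sol_continuous[OF e] sol_continuous[OF h])+
  then show ?thesis using assms(3) by (simp add: ip_cmult_left ip_cmult_right)
qed

text \<open>Eigenfunctions vanish at 0, so for a given eigenvalue they are determined by their slope
  there, and \<open>c\<close> is the quotient of the two slopes. The slope of \<open>e\<close> is
  nonzero, as otherwise \<open>e\<close> would vanish identically.\<close>

lemma eigenvalue_simple:
  assumes e: "sol e (\<lambda>x. \<mu> * e x)" and h: "sol h (\<lambda>x. \<mu> * h x)" and x: "x \<in> {0..l}" "e x \<noteq> 0"
  shows "\<exists>c. \<forall>x\<in>{0..l}. h x = c * e x"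
proof -
  define r where "r x = (M x - \<mu>) / D" for x
  have "continuous_on {0..l} r" unfolding r_def using D_pos by (auto intro!: continuous_intros M_cont)
  then obtain R where R: "\<And>x. x \<in> {0..l} \<Longrightarrow> \<bar>r x\<bar> \<le> R" using continuous_on_Icc_abs_bound by blast
  have rw: "(M x * k x - \<mu> * k x) / D = r x * k x" for k x by (simp add: r_def algebra_simps)
  obtain e' where e0: "e 0 = 0" and e': "\<And>x. x \<in> {0..l} \<Longrightarrow> (e has_real_derivative e' x) (at x within {0..l})"
     "\<And>x. x \<in> {0..l} \<Longrightarrow> (e' has_real_derivative r x * e x) (at x within {0..l})"
    using e unfolding sol_def rw by blast
  obtain h' where h0: "h 0 = 0" and h': "\<And>x. x \<in> {0..l} \<Longrightarrow> (h has_real_derivative h' x) (at x within {0..l})"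
     "\<And>x. x \<in> {0..l} \<Longrightarrow> (h' has_real_derivative r x * h x) (at x within {0..l})"
    using h unfolding sol_def rw by blast
  have "e' 0 \<noteq> 0" using cauchy_problem_unique[OF e' R e0 _ x(1)] x(2) by blast
  define c where "c = h' 0 / e' 0"
  have "h y = c * e y" if y: "y \<in> {0..l}" for y
  proof -
    have "h y - c * e y = 0"
    proof (rule cauchy_problem_unique[of l "\<lambda>x. h x - c * e x" "\<lambda>x. h' x - c * e' x" r R])
      fix z assume z: "z \<in> {0..l}"
      show "((\<lambda>x. h x - c * e x) has_real_derivative h' z - c * e' z) (at z within {0..l})"
        by (intro DERIV_diff DERIV_cmult h' e' z)
      have "((\<lambda>x. h' x - c * e' x) has_real_derivative r z * h z - c * (r z * e z)) (at z within {0..l})"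
        by (intro DERIV_diff DERIV_cmult h' e' z)
      then show "((\<lambda>x. h' x - c * e' x) has_real_derivative r z * (h z - c * e z)) (at z within {0..l})"
        by (simp add: algebra_simps)
    qed (use R e0 h0 \<open>e' 0 \<noteq> 0\<close> y in \<open>auto simp: c_def\<close>)
    then show ?thesis by simp
  qed
  then show ?thesis by blast
qed

lemma sol_L2: "sol u f \<Longrightarrow> L2_on {0..l} u"
  using sol_continuous L2_on_continuous by blast

text \<open>An L2 bound on the sources becomes a common sup bound and a common Lipschitz constant
  for the solutions, so Arzela-Ascoli applies.\<close>

lemma sol_compact:
  assumes f: "\<And>n. continuous_on {0..l} (f n)" "\<And>n. nrm l (f n) \<le> B" and u: "\<And>n. sol (u n) (f n)"
  obtains h k where "continuous_on {0..l} h" "strict_mono (k :: nat \<Rightarrow> nat)"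
    "\<And>e. 0 < e \<Longrightarrow> \<exists>N. \<forall>n\<ge>N. \<forall>x\<in>{0..l}. \<bar>u (k n) x - h x\<bar> < e"
proof -
  obtain C where C: "C \<ge> 0"
    "\<And>u f x. sol u f \<Longrightarrow> continuous_on {0..l} f \<Longrightarrow> x \<in> {0..l} \<Longrightarrow> \<bar>u x\<bar> \<le> C * nrm l f"
    "\<And>u f x y. sol u f \<Longrightarrow> continuous_on {0..l} f \<Longrightarrow> x \<in> {0..l} \<Longrightarrow> y \<in> {0..l} \<Longrightarrow>
       \<bar>u x - u y\<bar> \<le> C * nrm l f * \<bar>x - y\<bar>"
    using sol_bounds by blast
  have B: "C * nrm l (f n) \<le> C * B" for n using f(2) C(1) by (intro mult_left_mono) auto
  have "0 \<le> B" using f(2)[of 0] nrm_nonneg[of l "f 0"] by linarith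
  then have CB: "0 \<le> C * B" using C(1) by simp
  obtain h and k :: "nat \<Rightarrow> nat" where h: "continuous_on {0..l} h" "strict_mono k"
    "\<And>e. 0 < e \<Longrightarrow> \<exists>N. \<forall>n x. n \<ge> N \<and> x \<in> {0..l} \<longrightarrow> norm (u (k n) x - h x) < e"
  proof (rule Arzela_Ascoli[of "{0..l}" u "C * B"])
    show "norm (u n x) \<le> C * B" if "x \<in> {0..l}" for n x
      using C(2)[OF u f(1) that] B[of n] by (metis order_trans real_norm_def)
    fix x e :: real assume x: "x \<in> {0..l}" and e: "0 < e"
    show "\<exists>d>0. \<forall>n y. y \<in> {0..l} \<and> norm (x - y) < d \<longrightarrow> norm (u n x - u n y) < e"
    proof (intro exI[of _ "e / (C * B + 1)"] conjI allI impI)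
      show "0 < e / (C * B + 1)" using e CB by simp
      fix n y assume y: "y \<in> {0..l} \<and> norm (x - y) < e / (C * B + 1)"
      have "\<bar>u n x - u n y\<bar> \<le> C * nrm l (f n) * \<bar>x - y\<bar>" using C(3)[OF u f(1) x] y by blast
      also have "\<dots> \<le> C * B * \<bar>x - y\<bar>" by (intro mult_right_mono B) simp
      also have "\<dots> \<le> (C * B + 1) * \<bar>x - y\<bar>" by (intro mult_right_mono) auto
      also have "\<dots> < e" using y CB by (simp add: field_simps)
      finally show "norm (u n x - u n y) < e" by simp
    qed
  qed auto
  show ?thesis
  proof (rule that[OF h(1,2)])
    fix e :: real assume "0 < e"
    from h(3)[OF this] obtain N where "\<forall>n x. n \<ge> N \<and> x \<in> {0..l} \<longrightarrow> norm (u (k n) x - h x) < e" by blast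
    then show "\<exists>N. \<forall>n\<ge>N. \<forall>x\<in>{0..l}. \<bar>u (k n) x - h x\<bar> < e" by (intro exI[of _ N]) simp
  qed
qed

end

section \<open>Density of the eigenfunctions\<close>

text \<open>\<open>lam_all\<close> says that no eigenvalue is missing; by simplicity no
  eigenfunction is missing either, up to scalars. That the \<open>e n\<close> span a dense space is
  derived from this.\<close>

locale eigenbasis = dirichlet +
  fixes e :: "nat \<Rightarrow> real \<Rightarrow> real" and lam :: "nat \<Rightarrow> real"
  assumes e_sol: "sol (e n) (\<lambda>x. lam n * e n x)"
    and e_norm: "nrm l (e n) = 1"
    and lam_inj: "inj lam"
    and lam_all: "sol h (\<lambda>x. \<mu> * h x) \<Longrightarrow> x \<in> {0..l} \<Longrightarrow> h x \<noteq> 0 \<Longrightarrow> \<mu> \<in> range lam"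
begin

section \<open>Orthonormality, Bessel's inequality and growth of the eigenvalues\<close>

lemma e_cont: "continuous_on {0..l} (e n)"
  using e_sol sol_continuous by blast

lemma e_L2: "L2_on {0..l} (e n)"
  using e_cont L2_on_continuous by blast

lemma e_nonzero: "\<exists>x\<in>{0..l}. e n x \<noteq> 0"
proof (rule ccontr)
  assume "\<not> (\<exists>x\<in>{0..l}. e n x \<noteq> 0)"
  then have "nrm l (e n) \<le> 0 * sqrt l"
    using l_pos by (intro nrm_le_sup e_L2) auto
  then show False by (simp add: e_norm)
qed

lemma lam_pos: "lam n > 0"
  using e_nonzero eigenvalue_pos[OF e_sol] by blast

lemma e_orthonormal: "ip l (e m) (e n) = (if m = n then 1 else 0)"
proof (cases "m = n")
  case True then show ?thesis using nrm_power2[of l "e n"] by (simp add: e_norm)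
next
  case False
  then have "lam m \<noteq> lam n" using lam_inj by (auto dest: injD)
  then show ?thesis using eigenfunction_orthogonal[OF e_sol e_sol] False by simp
qed

lemma ip_lincomb: "ip l (\<lambda>x. \<Sum>n<N. b n * e n x) (e m) = (if m < N then b m else 0)"
  by (subst ip_sum_left) (auto intro: L2_on_cmult e_L2 simp: ip_cmult_left e_orthonormal if_distrib sum.delta cong: if_cong)

lemma L2_lincomb: "L2_on {0..l} (\<lambda>x. \<Sum>n<N. b n * e n x)"
  by (intro L2_on_sum L2_on_cmult e_L2) simp

lemma nrm_lincomb: "(nrm l (\<lambda>x. \<Sum>n<N. b n * e n x))\<^sup>2 = (\<Sum>n<N. (b n)\<^sup>2)"
proof -
  have "(nrm l (\<lambda>x. \<Sum>n<N. b n * e n x))\<^sup>2 = (\<Sum>m<N. ip l (\<lambda>x. b m * e m x) (\<lambda>x. \<Sum>n<N. b n * e n x))"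
    unfolding nrm_power2 by (rule ip_sum_left) (auto intro: L2_on_cmult e_L2 L2_lincomb)
  also have "\<dots> = (\<Sum>m<N. b m * b m)"
    by (rule sum.cong) (auto simp: ip_cmult_left ip_commute[of l "e _"] ip_lincomb)
  finally show ?thesis by (simp add: power2_eq_square)
qed

text \<open>Completing the square. With \<open>b n = ip l f (e n)\<close> the last sum vanishes,
  which contains both Bessel's inequality and the optimality of the Fourier coefficients.\<close>

lemma nrm_diff_lincomb:
  assumes "L2_on {0..l} f"
  shows "(nrm l (\<lambda>x. f x - (\<Sum>n<N. b n * e n x)))\<^sup>2
    = (nrm l f)\<^sup>2 - (\<Sum>n<N. (ip l f (e n))\<^sup>2) + (\<Sum>n<N. (b n - ip l f (e n))\<^sup>2)"
proof -
  have "ip l (\<lambda>x. \<Sum>n<N. b n * e n x) f = (\<Sum>n<N. b n * ip l f (e n))"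
    by (subst ip_sum_left) (auto intro: L2_on_cmult e_L2 assms simp: ip_cmult_left ip_commute[of l f])
  then have "(nrm l (\<lambda>x. f x - (\<Sum>n<N. b n * e n x)))\<^sup>2 = (nrm l f)\<^sup>2 - 2 * (\<Sum>n<N. b n * ip l f (e n)) + (\<Sum>n<N. (b n)\<^sup>2)"
    by (simp add: nrm_diff_power2[OF assms L2_lincomb] nrm_lincomb ip_commute[of l f])
  then show ?thesis
    by (simp add: power2_diff sum.distrib sum_subtractf sum_distrib_left algebra_simps)
qed

text \<open>Bessel's inequality for the Green kernel with \<open>x\<close> fixed, whose Fourier
  coefficients are \<open>e n x / lam n\<close>; the sup bound of the Green operator replaces any
  handling of the kernel itself.\<close>

lemma bessel_green:
  obtains C where "C \<ge> 0" "\<And>N x. x \<in> {0..l} \<Longrightarrow> (\<Sum>n<N. (e n x / lam n)\<^sup>2) \<le> C"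
proof -
  obtain C where C: "C \<ge> 0"
    "\<And>u f x. sol u f \<Longrightarrow> continuous_on {0..l} f \<Longrightarrow> x \<in> {0..l} \<Longrightarrow> \<bar>u x\<bar> \<le> C * nrm l f"
    using sol_bounds by metis
  have "(\<Sum>n<N. (e n x / lam n)\<^sup>2) \<le> C\<^sup>2" if x: "x \<in> {0..l}" for N x
  proof -
    \<comment> \<open>\<open>f\<close> is the partial expansion of the kernel at \<open>x\<close>.
      Both \<open>u x\<close> and the squared norm of \<open>f\<close> equal the sum
      \<open>S\<close>, so the sup bound reads \<open>S \<le> C * sqrt S\<close>.\<close>
    define f where "f y = (\<Sum>n<N. e n x / lam n * e n y)" for y
    define u where "u y = (\<Sum>n<N. e n x / (lam n)\<^sup>2 * e n y)" for y
    define S where "S = (\<Sum>n<N. (e n x / lam n)\<^sup>2)"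
    have S0: "S \<ge> 0" unfolding S_def by (intro sum_nonneg) auto
    have "sol u (\<lambda>y. \<Sum>n<N. e n x / (lam n)\<^sup>2 * (lam n * e n y))"
      unfolding u_def[abs_def] by (intro sol_sum sol_cmult e_sol) simp
    also have "(\<lambda>y. \<Sum>n<N. e n x / (lam n)\<^sup>2 * (lam n * e n y)) = f"
      using lam_pos by (auto simp: f_def fun_eq_iff power2_eq_square less_imp_neq[symmetric] intro!: sum.cong)
    finally have u: "sol u f" .
    have "continuous_on {0..l} f" unfolding f_def[abs_def] by (intro continuous_intros e_cont)
    then have "\<bar>u x\<bar> \<le> C * nrm l f" by (rule C(2)[OF u _ x])
    moreover have "u x = S" by (simp add: u_def S_def power_divide power2_eq_square)
    moreover have "(nrm l f)\<^sup>2 = S" unfolding f_def[abs_def] S_def nrm_lincomb ..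
    then have "nrm l f = sqrt S" by (metis nrm_nonneg real_sqrt_unique)
    ultimately have "S \<le> C * sqrt S" by simp
    then have le: "sqrt S * sqrt S \<le> C * sqrt S" using S0 by simp
    have "sqrt S \<le> C"
    proof (cases "sqrt S = 0")
      case False
      then have "0 < sqrt S" using S0 by simp
      with le show ?thesis by (metis mult_right_le_imp_le)
    qed (use C in simp)
    then have "S \<le> C\<^sup>2" using S0 by (metis real_sqrt_ge_zero power_mono real_sqrt_pow2)
    then show ?thesis by (simp add: S_def)
  qed
  then show ?thesis using that[of "C\<^sup>2"] by simp
qed

lemma e_bound: obtains C where "C \<ge> 0" "\<And>n x. x \<in> {0..l} \<Longrightarrow> \<bar>e n x\<bar> \<le> C * lam n"
proof -
  obtain C where C: "C \<ge> 0" "\<And>N x. x \<in> {0..l} \<Longrightarrow> (\<Sum>n<N. (e n x / lam n)\<^sup>2) \<le> C"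
    using bessel_green by blast
  have "\<bar>e n x\<bar> \<le> sqrt C * lam n" if x: "x \<in> {0..l}" for n x
  proof -
    have "(e n x / lam n)\<^sup>2 \<le> (\<Sum>n<Suc n. (e n x / lam n)\<^sup>2)" by (rule member_le_sum) auto
    also have "\<dots> \<le> C" by (rule C(2)[OF x])
    finally have "\<bar>e n x / lam n\<bar> \<le> sqrt C" using real_le_rsqrt by (metis power2_abs)
    then show ?thesis using lam_pos[of n] by (simp add: abs_divide field_simps)
  qed
  then show ?thesis using that[of "sqrt C"] C by simp
qed

text \<open>The Green operator is Hilbert-Schmidt: integrating the pointwise bound over
  \<open>x\<close>, each normalised eigenfunction contributes exactly \<open>1 / (lam n)^2\<close>,
  and the bound becomes \<open>C * l\<close>.\<close>

lemma summable_lam: "summable (\<lambda>n. 1 / (lam n)\<^sup>2)"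
proof -
  obtain C where C: "C \<ge> 0" "\<And>N x. x \<in> {0..l} \<Longrightarrow> (\<Sum>n<N. (e n x / lam n)\<^sup>2) \<le> C"
    using bessel_green by blast
  have "(\<Sum>n<N. 1 / (lam n)\<^sup>2) \<le> C * l" for N
  proof -
    have ci: "(\<lambda>x. (e n x / lam n)\<^sup>2) integrable_on {0..l}" for n
      using lam_pos[of n] by (intro integrable_continuous_interval continuous_intros e_cont) auto
    have "(\<Sum>n<N. 1 / (lam n)\<^sup>2) = (\<Sum>n<N. integral {0..l} (\<lambda>x. (e n x / lam n)\<^sup>2))"
    proof (rule sum.cong)
      fix n
      have "integral {0..l} (\<lambda>x. e n x * e n x) = 1"
        using e_orthonormal[of n n] ip_eq_integral[OF e_cont e_cont, of n n] by simp
      then show "1 / (lam n)\<^sup>2 = integral {0..l} (\<lambda>x. (e n x / lam n)\<^sup>2)"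
        by (simp add: power_divide power2_eq_square)
    qed simp
    also have "\<dots> = integral {0..l} (\<lambda>x. \<Sum>n<N. (e n x / lam n)\<^sup>2)"
      by (rule integral_sum[symmetric]) (use ci in auto)
    also have "\<dots> \<le> integral {0..l} (\<lambda>x. C)"
      by (rule integral_le) (use ci C in \<open>auto intro: integrable_sum\<close>)
    also have "\<dots> = C * l" using l_pos by simp
    finally show ?thesis .
  qed
  then show ?thesis
    by (intro bounded_imp_summable[where B = "C * l"]) (auto simp only: lessThan_Suc_atMost[symmetric] zero_le_divide_1_iff zero_le_power2)
qed

text \<open>A nonzero \<open>k\<close> would have some \<open>lam n\<close> as eigenvalue and so be
  a multiple of \<open>e n\<close>, to which it is orthogonal.\<close>

lemma eigen_orth_zero:
  assumes k: "sol k (\<lambda>x. \<nu> * k x)" and orth: "\<And>n. ip l k (e n) = 0" and x: "x \<in> {0..l}"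
  shows "k x = 0"
proof (rule ccontr)
  assume "k x \<noteq> 0"
  then obtain n where n: "\<nu> = lam n" using lam_all[OF k x] by blast
  obtain y where y: "y \<in> {0..l}" "e n y \<noteq> 0" using e_nonzero by blast
  obtain c where c: "\<forall>x\<in>{0..l}. k x = c * e n x"
    using eigenvalue_simple[OF e_sol k[unfolded n] y] by blast
  have "ip l k (e n) = ip l (\<lambda>x. c * e n x) (e n)" using c by (intro ip_cong) auto
  then have "c = 0" using orth[of n] by (simp add: ip_cmult_left e_orthonormal)
  with c x \<open>k x \<noteq> 0\<close> show False by simp
qed

lemma ip_sol_e:
  assumes "sol u f" "continuous_on {0..l} f"
  shows "ip l u (e n) = ip l f (e n) / lam n"
proof -
  have "ip l u (\<lambda>x. lam n * e n x) = ip l f (e n)"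
    by (rule sol_sym[OF assms(1) e_sol assms(2)]) (intro continuous_intros e_cont)
  then show ?thesis using lam_pos[of n] by (simp add: ip_cmult_right field_simps)
qed

text \<open>The orthogonal complement of the eigenfunctions among the continuous functions. It is
  invariant under the Green operator, so the variational argument for an eigenfunction can be run
  inside it.\<close>

definition E :: "(real \<Rightarrow> real) set" where
  "E = {f. continuous_on {0..l} f \<and> (\<forall>n. ip l f (e n) = 0)}"

lemma E_sol: "f \<in> E \<Longrightarrow> sol u f \<Longrightarrow> u \<in> E"
  using sol_continuous by (auto simp: E_def ip_sol_e)

lemma E_cont: "f \<in> E \<Longrightarrow> continuous_on {0..l} f" by (simp add: E_def)
lemma E_L2: "f \<in> E \<Longrightarrow> L2_on {0..l} f" by (simp add: E_def L2_on_continuous)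

lemma E_cmult: "f \<in> E \<Longrightarrow> (\<lambda>x. c * f x) \<in> E"
  by (auto simp: E_def ip_cmult_left intro!: continuous_intros)

lemma E_add: "f \<in> E \<Longrightarrow> h \<in> E \<Longrightarrow> (\<lambda>x. f x + h x) \<in> E"
  by (auto simp: E_def ip_add_left L2_on_continuous e_L2 intro!: continuous_intros)

text \<open>Each coefficient needs to vanish only eventually: remainders of a Fourier series become
  orthogonal to a given \<open>e m\<close> only once the partial sum has reached it.\<close>

lemma E_limit:
  assumes "\<And>n. continuous_on {0..l} (u n)" "\<And>m. eventually (\<lambda>n. ip l (u n) (e m) = 0) sequentially"
    and "continuous_on {0..l} h" "(\<lambda>n. nrm l (\<lambda>x. u n x - h x)) \<longlonglongrightarrow> 0"
  shows "h \<in> E"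
proof -
  have "ip l h (e m) = 0" for m
  proof (rule LIMSEQ_unique)
    show "(\<lambda>n. ip l (u n) (e m)) \<longlonglongrightarrow> ip l h (e m)"
      by (rule ip_tendsto) (use assms e_L2 L2_on_continuous in auto)
    show "(\<lambda>n. ip l (u n) (e m)) \<longlonglongrightarrow> 0"
      by (rule tendsto_eventually) (rule assms(2))
  qed
  then show ?thesis using assms(3) by (simp add: E_def)
qed

text \<open>A maximizing sequence for the norm of the Green operator \<open>T\<close> on \<open>E\<close> yields \<open>h \<noteq> 0\<close> in \<open>E\<close>
  with \<open>T\<^sup>2 h = \<mu>\<^sup>2 h\<close>.  As \<open>T\<^sup>2 - \<mu>\<^sup>2 = (T - \<mu>)(T + \<mu>)\<close>, either \<open>T h + \<mu> h\<close> or \<open>h\<close> is then an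
  eigenfunction in \<open>E\<close>, which cannot exist.\<close>

lemma orth_imp_sol_zero:
  assumes f0: "f0 \<in> E" and u0: "sol u0 f0"
  shows "nrm l u0 = 0"
proof (rule ccontr)
  assume nz: "nrm l u0 \<noteq> 0"
  obtain C where C: "C \<ge> 0"
    "\<And>u f x. sol u f \<Longrightarrow> continuous_on {0..l} f \<Longrightarrow> x \<in> {0..l} \<Longrightarrow> \<bar>u x\<bar> \<le> C * nrm l f"
    using sol_bounds by metis
  have Cn: "nrm l u \<le> C * sqrt l * nrm l f" if "sol u f" "continuous_on {0..l} f" for u f
    using nrm_le_sup[OF sol_L2[OF that(1)] _ C(2)[OF that]] l_pos by (simp add: mult_ac)
  \<comment> \<open>Norms of the images of the unit ball of \<open>E\<close>; the supremum
    \<open>\<mu>\<close> is the norm of the Green operator \<open>T\<close> restricted to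
    \<open>E\<close>.\<close>
  define S where "S = {nrm l u | u f. f \<in> E \<and> nrm l f \<le> 1 \<and> sol u f}"
  define \<mu> where "\<mu> = Sup S"
  have bdd: "bdd_above S"
  proof (rule bdd_aboveI)
    fix s assume "s \<in> S"
    then obtain u f where uf: "s = nrm l u" "f \<in> E" "nrm l f \<le> 1" "sol u f" unfolding S_def by blast
    have "C * sqrt l * nrm l f \<le> C * sqrt l * 1" using uf C(1) l_pos by (intro mult_left_mono) auto
    then show "s \<le> C * sqrt l" using Cn[OF uf(4) E_cont[OF uf(2)]] uf(1) by simp
  qed
  have le\<mu>: "nrm l u \<le> \<mu> * nrm l f" if f: "f \<in> E" and u: "sol u f" for u f
  proof (cases "nrm l f = 0")
    case True then show ?thesis using Cn[OF u E_cont[OF f]] by simp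
  next
    case False
    then have pos: "nrm l f > 0" using nrm_nonneg[of l f] by simp
    have "nrm l (\<lambda>x. 1 / nrm l f * u x) \<in> S"
      unfolding S_def using E_cmult[OF f, of "1 / nrm l f"] sol_cmult[OF u, of "1 / nrm l f"] pos
      by (intro CollectI exI[of _ "\<lambda>x. 1 / nrm l f * u x"] exI[of _ "\<lambda>x. 1 / nrm l f * f x"])
         (simp only: nrm_cmult, simp)
    from cSup_upper[OF this bdd] show ?thesis
      using pos unfolding \<mu>_def nrm_cmult by (simp add: field_simps)
  qed
  have "0 < nrm l u0" using nz nrm_nonneg[of l u0] by simp
  then have "0 < \<mu> * nrm l f0" using le\<mu>[OF f0 u0] by simp
  then have \<mu>: "\<mu> > 0" using nrm_nonneg[of l f0] by (auto simp: zero_less_mult_iff)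
  have "S \<noteq> {}" using sol_zero by (auto simp: S_def E_def nrm_def ip_def intro!: exI[of _ "\<lambda>x. 0"])
  have "\<exists>u f. f \<in> E \<and> nrm l f \<le> 1 \<and> sol u f \<and> \<mu> - 1 / real (Suc n) < nrm l u" for n
  proof -
    have "\<mu> - 1 / real (Suc n) < Sup S" by (simp add: \<mu>_def)
    then obtain s where "s \<in> S" "\<mu> - 1 / real (Suc n) < s"
      using less_cSup_iff[OF \<open>S \<noteq> {}\<close> bdd] by blast
    then show ?thesis unfolding S_def by blast
  qed
  then obtain u f where f: "\<And>n. f n \<in> E" "\<And>n. nrm l (f n) \<le> 1" and u: "\<And>n. sol (u n) (f n)"
    and unear: "\<And>n. \<mu> - 1 / real (Suc n) < nrm l (u n)" by metis
  have u_le: "nrm l (u n) \<le> \<mu>" for n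
    using le\<mu>[OF f(1) u, of n] f(2)[of n] \<mu> mult_left_le[of "nrm l (f n)" \<mu>] by linarith
  have ulim: "(\<lambda>n. nrm l (u n)) \<longlonglongrightarrow> \<mu>"
  proof (rule real_tendsto_sandwich)
    show "(\<lambda>n. \<mu> - 1 / real (Suc n)) \<longlonglongrightarrow> \<mu>"
      using tendsto_diff[OF tendsto_const[of \<mu>] LIMSEQ_inverse_real_of_nat] by (simp add: inverse_eq_divide)
    show "(\<lambda>n. \<mu>) \<longlonglongrightarrow> \<mu>" by simp
  qed (use unear u_le in \<open>auto intro!: always_eventually less_imp_le\<close>)
  obtain h k where h: "continuous_on {0..l} h" and k: "strict_mono (k :: nat \<Rightarrow> nat)"
    and hu: "\<And>e. 0 < e \<Longrightarrow> \<exists>N. \<forall>n\<ge>N. \<forall>x\<in>{0..l}. \<bar>u (k n) x - h x\<bar> < e"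
    using sol_compact[of f 1 u, OF E_cont[OF f(1)] f(2) u] by metis
  have uE: "u n \<in> E" for n by (rule E_sol[OF f(1) u])
  have hlim: "(\<lambda>n. nrm l (\<lambda>x. u (k n) x - h x)) \<longlonglongrightarrow> 0"
    by (rule nrm_tendsto_uniform[OF sol_continuous[OF u] h l_pos hu])
  have hE: "h \<in> E"
    by (rule E_limit[OF sol_continuous[OF u] _ h hlim]) (use uE in \<open>auto simp: E_def\<close>)
  have "(\<lambda>n. nrm l (u (k n))) \<longlonglongrightarrow> \<mu>" using LIMSEQ_subseq_LIMSEQ[OF ulim k] by (simp add: o_def)
  moreover have "(\<lambda>n. nrm l (u (k n))) \<longlonglongrightarrow> nrm l h"
    by (rule nrm_tendsto[OF E_L2[OF uE] E_L2[OF hE] hlim])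
  ultimately have hn: "nrm l h = \<mu>" using LIMSEQ_unique by blast
  obtain w where w: "sol w h" using sol_exists[OF h] by blast
  have wE: "w \<in> E" by (rule E_sol[OF hE w])
  obtain z where z: "sol z w" using sol_exists[OF E_cont[OF wE]] by blast
  have "\<forall>n. \<exists>v. sol v (u n)" using sol_exists[OF sol_continuous[OF u]] by blast
  from choice[OF this] obtain v where v: "\<And>n. sol (v n) (u n)" by blast
  have "\<forall>n. \<exists>y. sol y (v n)" using sol_exists[OF sol_continuous[OF v]] by blast
  from choice[OF this] obtain y where y: "\<And>n. sol (y n) (v n)" by blast
  have vE: "v n \<in> E" for n by (rule E_sol[OF uE v])
  \<comment> \<open>Write \<open>v = T^2 f\<close> and expand the square, using that the inner
    product of \<open>T^2 f\<close> and \<open>f\<close> is the squared norm of \<open>T f\<close>,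
    that \<open>T\<close> has norm at most \<mu> on \<open>E\<close>, and that \<open>f\<close> has
    norm at most 1. For a maximizing sequence the right-hand side tends to 0.\<close>
  have d1: "nrm l (\<lambda>x. v n x - \<mu>\<^sup>2 * f n x) \<le> \<mu> * sqrt (\<mu>\<^sup>2 - (nrm l (u n))\<^sup>2)" for n
  proof (rule power2_le_imp_le)
    have "ip l (u n) (u n) = ip l (f n) (v n)"
      by (rule sol_sym[OF u v E_cont[OF f(1)] sol_continuous[OF u]])
    then have ipv: "ip l (v n) (f n) = (nrm l (u n))\<^sup>2" by (simp add: nrm_power2 ip_commute)
    have "(nrm l (\<lambda>x. v n x - \<mu>\<^sup>2 * f n x))\<^sup>2 = (nrm l (v n))\<^sup>2 - 2 * (\<mu>\<^sup>2 * (nrm l (u n))\<^sup>2) + (\<mu>\<^sup>2 * nrm l (f n))\<^sup>2"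
      by (subst nrm_diff_power2) (auto intro: E_L2 vE f L2_on_cmult simp: ip_cmult_right ipv nrm_cmult)
    also have "(nrm l (v n))\<^sup>2 \<le> (\<mu> * nrm l (u n))\<^sup>2"
      by (intro power_mono le\<mu> uE v nrm_nonneg)
    also have "(\<mu>\<^sup>2 * nrm l (f n))\<^sup>2 \<le> (\<mu>\<^sup>2 * 1)\<^sup>2"
      by (intro power_mono mult_left_mono f mult_nonneg_nonneg nrm_nonneg) auto
    finally have "(nrm l (\<lambda>x. v n x - \<mu>\<^sup>2 * f n x))\<^sup>2 \<le> \<mu>\<^sup>2 * (\<mu>\<^sup>2 - (nrm l (u n))\<^sup>2)"
      by (simp add: power_mult_distrib algebra_simps power2_eq_square)
    moreover have "0 \<le> \<mu>\<^sup>2 - (nrm l (u n))\<^sup>2" using power_mono[OF u_le[of n] nrm_nonneg, of 2] by simp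
    ultimately show "(nrm l (\<lambda>x. v n x - \<mu>\<^sup>2 * f n x))\<^sup>2 \<le> (\<mu> * sqrt (\<mu>\<^sup>2 - (nrm l (u n))\<^sup>2))\<^sup>2"
      by (simp add: power_mult_distrib)
    show "0 \<le> \<mu> * sqrt (\<mu>\<^sup>2 - (nrm l (u n))\<^sup>2)" using \<mu> \<open>0 \<le> \<mu>\<^sup>2 - (nrm l (u n))\<^sup>2\<close> by simp
  qed
  have zL: "L2_on {0..l} z" and hL: "L2_on {0..l} h" and yL: "L2_on {0..l} (y n)" and uL: "L2_on {0..l} (u n)" for n
    using sol_L2[OF z] E_L2[OF hE] sol_L2[OF y] E_L2[OF uE] by auto
  \<comment> \<open>The \<open>f n\<close> need not converge, only their images
    \<open>u (k n)\<close> do. The approximate relation is therefore used after one more application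
    of \<open>T\<close>: \<open>z - \<mu>^2 h\<close> is the sum of \<open>T^2 (h - u)\<close>,
    \<open>T (v - \<mu>^2 f)\<close> and \<open>\<mu>^2 (u - h)\<close>.\<close>
  have d2: "nrm l (\<lambda>x. z x - \<mu>\<^sup>2 * h x) \<le> 2 * \<mu>\<^sup>2 * nrm l (\<lambda>x. u (k n) x - h x)
      + \<mu> * (\<mu> * sqrt (\<mu>\<^sup>2 - (nrm l (u (k n)))\<^sup>2))" for n
  proof -
    have diffE: "(\<lambda>x. h x - u (k n) x) \<in> E" "(\<lambda>x. w x - v (k n) x) \<in> E"
      using E_add[OF hE E_cmult[OF uE, of "-1"]] E_add[OF wE E_cmult[OF vE, of "-1"]] by auto
    have "nrm l (\<lambda>x. w x - v (k n) x) \<le> \<mu> * nrm l (\<lambda>x. h x - u (k n) x)"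
      by (rule le\<mu>[OF diffE(1) sol_diff[OF w v]])
    then have "\<mu> * nrm l (\<lambda>x. w x - v (k n) x) \<le> \<mu> * (\<mu> * nrm l (\<lambda>x. h x - u (k n) x))"
      using \<mu> by simp
    then have 1: "nrm l (\<lambda>x. z x - y (k n) x) \<le> \<mu>\<^sup>2 * nrm l (\<lambda>x. u (k n) x - h x)"
      using le\<mu>[OF diffE(2) sol_diff[OF z y]]
      unfolding nrm_diff_commute[of l h] power2_eq_square by simp
    have "(\<lambda>x. v (k n) x - \<mu>\<^sup>2 * f (k n) x) \<in> E"
      using E_add[OF vE E_cmult[OF f(1), of "-(\<mu>\<^sup>2)"]] by simp
    from le\<mu>[OF this sol_diff[OF y sol_cmult[OF u]]]
    have "nrm l (\<lambda>x. y (k n) x - \<mu>\<^sup>2 * u (k n) x) \<le> \<mu> * nrm l (\<lambda>x. v (k n) x - \<mu>\<^sup>2 * f (k n) x)" .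
    also have "\<dots> \<le> \<mu> * (\<mu> * sqrt (\<mu>\<^sup>2 - (nrm l (u (k n)))\<^sup>2))" using d1 \<mu> by simp
    finally have 2: "nrm l (\<lambda>x. y (k n) x - \<mu>\<^sup>2 * u (k n) x) \<le> \<mu> * (\<mu> * sqrt (\<mu>\<^sup>2 - (nrm l (u (k n)))\<^sup>2))" .
    have 3: "nrm l (\<lambda>x. \<mu>\<^sup>2 * u (k n) x - \<mu>\<^sup>2 * h x) = \<mu>\<^sup>2 * nrm l (\<lambda>x. u (k n) x - h x)"
      unfolding right_diff_distrib[symmetric] nrm_cmult by simp
    have "nrm l (\<lambda>x. z x - \<mu>\<^sup>2 * h x) \<le> nrm l (\<lambda>x. z x - y (k n) x) + nrm l (\<lambda>x. y (k n) x - \<mu>\<^sup>2 * h x)"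
      by (rule nrm_triangle_diff[OF zL yL L2_on_cmult[OF hL]])
    also have "nrm l (\<lambda>x. y (k n) x - \<mu>\<^sup>2 * h x) \<le> nrm l (\<lambda>x. y (k n) x - \<mu>\<^sup>2 * u (k n) x)
        + nrm l (\<lambda>x. \<mu>\<^sup>2 * u (k n) x - \<mu>\<^sup>2 * h x)"
      by (rule nrm_triangle_diff[OF yL L2_on_cmult[OF uL] L2_on_cmult[OF hL]])
    finally show ?thesis using 1 2 3 by linarith
  qed
  have "(\<lambda>n. 2 * \<mu>\<^sup>2 * nrm l (\<lambda>x. u (k n) x - h x) + \<mu> * (\<mu> * sqrt (\<mu>\<^sup>2 - (nrm l (u (k n)))\<^sup>2)))
     \<longlonglongrightarrow> 2 * \<mu>\<^sup>2 * 0 + \<mu> * (\<mu> * sqrt (\<mu>\<^sup>2 - \<mu>\<^sup>2))"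
    by (intro tendsto_intros hlim \<open>(\<lambda>n. nrm l (u (k n))) \<longlonglongrightarrow> \<mu>\<close>)
  then have "nrm l (\<lambda>x. z x - \<mu>\<^sup>2 * h x) \<le> 0"
    using LIMSEQ_le_const[of _ 0 "nrm l (\<lambda>x. z x - \<mu>\<^sup>2 * h x)"] d2 by simp
  then have "nrm l (\<lambda>x. z x - \<mu>\<^sup>2 * h x) = 0" using nrm_nonneg by (metis order_antisym)
  then have zh: "z x = \<mu>\<^sup>2 * h x" if "x \<in> {0..l}" for x
    using nrm_eq_0_continuous[OF _ _ that l_pos, of "\<lambda>x. z x - \<mu>\<^sup>2 * h x"] sol_continuous[OF z] h
    by (simp add: continuous_on_diff continuous_on_mult_left)
  have hw: "sol h (\<lambda>x. 1 / \<mu>\<^sup>2 * w x)"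
    by (rule sol_cong[OF sol_cmult[OF z, of "1 / \<mu>\<^sup>2"]]) (use zh \<mu> in auto)
  \<comment> \<open>An eigenvalue in the sense of \<open>sol\<close> is the reciprocal of one of
    \<open>T\<close>. The claim is thus that \<open>T\<close> multiplies \<open>w + \<mu> h\<close>
    by \<mu>, which follows from \<open>T h = w\<close> and \<open>T w = \<mu>^2 h\<close>.\<close>
  have k1: "sol (\<lambda>x. 1 * w x + \<mu> * h x) (\<lambda>x. 1 / \<mu> * (1 * w x + \<mu> * h x))"
    by (rule sol_cong[OF sol_lincomb[OF w hw, of 1 \<mu>]]) (use \<mu> in \<open>auto simp: field_simps power2_eq_square\<close>)
  have k1E: "(\<lambda>x. 1 * w x + \<mu> * h x) \<in> E" using E_add[OF wE E_cmult[OF hE]] by simp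
  have wh: "1 * w x + \<mu> * h x = 0" if "x \<in> {0..l}" for x
    by (rule eigen_orth_zero[OF k1 _ that]) (use k1E in \<open>simp add: E_def\<close>)
  have h1: "sol h (\<lambda>x. - 1 / \<mu> * h x)"
  proof (rule sol_cong[OF hw])
    fix x assume "x \<in> {0..l}"
    then have "w x = - (\<mu> * h x)" using wh[of x] by simp
    then show "1 / \<mu>\<^sup>2 * w x = - 1 / \<mu> * h x" using \<mu> by (simp add: power2_eq_square)
  qed simp
  have "h x = 0" if "x \<in> {0..l}" for x
    by (rule eigen_orth_zero[OF h1 _ that]) (use hE in \<open>simp add: E_def\<close>)
  then have "nrm l h \<le> 0 * sqrt l" using l_pos by (intro nrm_le_sup hL) auto
  then show False using hn \<mu> by simp
qed

lemma orth_imp_zero: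
  assumes "f \<in> E" "x \<in> {0..l}"
  shows "f x = 0"
proof -
  obtain u where u: "sol u f" using sol_exists[OF E_cont[OF assms(1)]] by blast
  have "nrm l u = 0" by (rule orth_imp_sol_zero[OF assms(1) u])
  then show ?thesis
    using sol_zero_imp_rhs_zero[OF u E_cont[OF assms(1)] _ assms(2)]
      nrm_eq_0_continuous[OF sol_continuous[OF u] _ _ l_pos] by blast
qed

lemma span_dense_range:
  assumes u: "sol u f" and f: "continuous_on {0..l} f" and "\<epsilon> > 0"
  shows "\<exists>N b. \<forall>x\<in>{0..l}. \<bar>u x - (\<Sum>n<N. b n * e n x)\<bar> < \<epsilon>"
proof -
  define b where "b n = ip l f (e n)" for n
  define r where "r N x = f x - (\<Sum>n<N. b n * e n x)" for N x
  define t where "t N x = u x - (\<Sum>n<N. b n / lam n * e n x)" for N x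
  have rc: "continuous_on {0..l} (r N)" for N
    unfolding r_def[abs_def] by (intro continuous_intros f e_cont)
  have t: "sol (t N) (r N)" for N
  proof -
    have "sol (\<lambda>x. \<Sum>n<N. b n / lam n * e n x) (\<lambda>x. \<Sum>n<N. b n / lam n * (lam n * e n x))"
      by (intro sol_sum sol_cmult e_sol) simp
    also have "(\<lambda>x. \<Sum>n<N. b n / lam n * (lam n * e n x)) = (\<lambda>x. \<Sum>n<N. b n * e n x)"
      using lam_pos by (auto simp: fun_eq_iff less_imp_neq[symmetric] intro!: sum.cong)
    finally show ?thesis unfolding r_def[abs_def] t_def[abs_def] by (rule sol_diff[OF u])
  qed
  have rn: "nrm l (r N) \<le> nrm l f" for N
  proof (rule power2_le_imp_le)
    show "(nrm l (r N))\<^sup>2 \<le> (nrm l f)\<^sup>2"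
      unfolding r_def[abs_def] nrm_diff_lincomb[OF L2_on_continuous[OF f]]
      by (simp add: b_def sum_nonneg)
  qed (rule nrm_nonneg)
  obtain h k where h: "continuous_on {0..l} h" and k: "strict_mono (k :: nat \<Rightarrow> nat)"
    and hu: "\<And>e. 0 < e \<Longrightarrow> \<exists>N. \<forall>n\<ge>N. \<forall>x\<in>{0..l}. \<bar>t (k n) x - h x\<bar> < e"
    using sol_compact[of r "nrm l f" t, OF rc rn t] by metis
  have "h \<in> E"
  proof (rule E_limit[OF sol_continuous[OF t] _ h nrm_tendsto_uniform[OF sol_continuous[OF t] h l_pos hu]])
    fix m
    have "ip l (t (k n)) (e m) = 0" if "n > m" for n
    proof -
      have "m < k n" using that seq_suble[OF k, of n] by linarith
      then have "ip l (r (k n)) (e m) = 0"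
        unfolding r_def[abs_def]
        by (simp add: ip_diff_left L2_on_continuous[OF f] L2_lincomb e_L2 ip_lincomb b_def)
      then show ?thesis using ip_sol_e[OF t rc] by simp
    qed
    then show "\<forall>\<^sub>F n in sequentially. ip l (t (k n)) (e m) = 0"
      by (intro eventually_mono[OF eventually_gt_at_top[of m]])
  qed
  then have h0: "h x = 0" if "x \<in> {0..l}" for x using orth_imp_zero that by blast
  obtain N where "\<forall>n\<ge>N. \<forall>x\<in>{0..l}. \<bar>t (k n) x - h x\<bar> < \<epsilon>" using hu[OF \<open>\<epsilon> > 0\<close>] by blast
  then have "\<forall>x\<in>{0..l}. \<bar>t (k N) x\<bar> < \<epsilon>" using h0 by fastforce
  then show ?thesis unfolding t_def by (intro exI[of _ "k N"] exI[of _ "\<lambda>n. b n / lam n"])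
qed

text \<open>A polynomial minus the affine function interpolating its end values is smooth and
  satisfies the boundary conditions, so it lies in the range of the Green operator.\<close>

lemma span_dense:
  assumes q: "continuous_on {0..l} q" "q 0 = 0" "q l = 0" and "\<epsilon> > 0"
  shows "\<exists>N b. \<forall>x\<in>{0..l}. \<bar>q x - (\<Sum>n<N. b n * e n x)\<bar> < \<epsilon>"
proof -
  \<comment> \<open>The error budget: \<epsilon>/6 for the polynomial, \<epsilon>/6 for
    \<open>p 0\<close>, \<epsilon>/3 for the slope term, which is at most the difference of the end
    values of \<open>p\<close>, and \<epsilon>/3 for the eigenfunctions.\<close>
  have "\<epsilon> / 6 > 0" using \<open>\<epsilon> > 0\<close> by simp
  then obtain p where p: "polynomial_function p" "\<forall>x\<in>{0..l}. norm (q x - p x) < \<epsilon> / 6"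
    using Stone_Weierstrass_polynomial_function[OF compact_Icc q(1)] by blast
  obtain p' where p': "polynomial_function p'" "\<And>x. (p has_real_derivative p' x) (at x)"
    using has_vector_derivative_polynomial_function[OF p(1)] by (auto simp: has_real_derivative_iff_has_vector_derivative)
  obtain p'' where p'': "polynomial_function p''" "\<And>x. (p' has_real_derivative p'' x) (at x)"
    using has_vector_derivative_polynomial_function[OF p'(1)] by (auto simp: has_real_derivative_iff_has_vector_derivative)
  define \<phi> where "\<phi> x = p x - p 0 - (p l - p 0) / l * x" for x
  define f where "f x = M x * \<phi> x - D * p'' x" for x
  have pc: "continuous_on {0..l} p" "continuous_on {0..l} p''"
    using p(1) p''(1) by (auto intro: continuous_on_polymonial_function)
  have \<phi>c: "continuous_on {0..l} \<phi>" unfolding \<phi>_def[abs_def] using l_pos by (intro continuous_intros pc)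
  have fc: "continuous_on {0..l} f" unfolding f_def[abs_def] by (intro continuous_intros pc M_cont \<phi>c)
  have "sol \<phi> f"
  proof (rule solI)
    show "\<phi> 0 = 0" "\<phi> l = 0" using l_pos by (simp_all add: \<phi>_def)
    fix x
    have "(\<phi> has_real_derivative p' x - 0 - (p l - p 0) / l * 1) (at x within {0..l})"
      unfolding \<phi>_def[abs_def] by (intro DERIV_diff DERIV_const DERIV_cmult DERIV_ident has_field_derivative_at_within[OF p'(2)])
    then show "(\<phi> has_real_derivative p' x - (p l - p 0) / l) (at x within {0..l})" by simp
    have "((\<lambda>x. p' x - (p l - p 0) / l) has_real_derivative p'' x - 0) (at x within {0..l})"
      by (intro DERIV_diff DERIV_const has_field_derivative_at_within[OF p''(2)])
    then show "((\<lambda>x. p' x - (p l - p 0) / l) has_real_derivative (M x * \<phi> x - f x) / D) (at x within {0..l})"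
      using D_pos by (simp add: f_def)
  qed
  then obtain N b where Nb: "\<forall>x\<in>{0..l}. \<bar>\<phi> x - (\<Sum>n<N. b n * e n x)\<bar> < \<epsilon> / 3"
    using span_dense_range[OF _ fc, of \<phi> "\<epsilon> / 3"] \<open>\<epsilon> > 0\<close> by auto
  have "\<bar>q x - (\<Sum>n<N. b n * e n x)\<bar> < \<epsilon>" if x: "x \<in> {0..l}" for x
  proof -
    have p0: "\<bar>p 0\<bar> < \<epsilon> / 6" "\<bar>p l\<bar> < \<epsilon> / 6"
      using bspec[OF p(2), of 0] bspec[OF p(2), of l] q l_pos by auto
    have "\<bar>(p l - p 0) / l * x\<bar> = \<bar>p l - p 0\<bar> * (x / l)" using x l_pos by (simp add: abs_mult)
    also have "\<dots> \<le> \<bar>p l - p 0\<bar> * 1" using x l_pos by (intro mult_left_mono) auto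
    finally have "\<bar>(p l - p 0) / l * x\<bar> \<le> \<bar>p l - p 0\<bar>" by simp
    moreover have "\<bar>q x - p x\<bar> < \<epsilon> / 6" using p(2) x by auto
    moreover have "\<bar>\<phi> x - (\<Sum>n<N. b n * e n x)\<bar> < \<epsilon> / 3" using Nb x by auto
    ultimately show ?thesis using p0 unfolding \<phi>_def by linarith
  qed
  then show ?thesis by blast
qed

text \<open>Density enters as the hypothesis \<open>approx\<close>, which the solution itself at
  small times will satisfy for the initial datum. Optimality of the Fourier coefficients and
  monotonicity of the residual turn one good combination into convergence of the whole
  series.\<close>

lemma eigen_expansion_L2:
  assumes f: "L2_on {0..l} f"
    and approx: "\<And>\<epsilon>. \<epsilon> > 0 \<Longrightarrow> \<exists>q. continuous_on {0..l} q \<and> q 0 = 0 \<and> q l = 0 \<and> nrm l (\<lambda>x. f x - q x) < \<epsilon>"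
  shows "(\<lambda>N. nrm l (\<lambda>x. f x - (\<Sum>n<N. ip l f (e n) * e n x))) \<longlonglongrightarrow> 0"
proof (rule LIMSEQ_I)
  fix \<epsilon> :: real assume "0 < \<epsilon>"
  then obtain q where q: "continuous_on {0..l} q" "q 0 = 0" "q l = 0" "nrm l (\<lambda>x. f x - q x) < \<epsilon> / 2"
    using approx[of "\<epsilon> / 2"] by auto
  have "\<epsilon> / 2 / sqrt l > 0" using \<open>0 < \<epsilon>\<close> l_pos by simp
  then obtain N b where Nb: "\<forall>x\<in>{0..l}. \<bar>q x - (\<Sum>n<N. b n * e n x)\<bar> < \<epsilon> / 2 / sqrt l"
    using span_dense[OF q(1-3)] by blast
  have qL: "L2_on {0..l} q" using q(1) by (rule L2_on_continuous)
  have "nrm l (\<lambda>x. q x - (\<Sum>n<N. b n * e n x)) \<le> \<epsilon> / 2 / sqrt l * sqrt l"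
    by (intro nrm_le_sup L2_on_diff qL L2_lincomb) (use Nb l_pos in \<open>auto intro: less_imp_le\<close>)
  also have "\<dots> = \<epsilon> / 2" using l_pos by simp
  finally have lt: "nrm l (\<lambda>x. f x - (\<Sum>n<N. b n * e n x)) < \<epsilon>"
    using nrm_triangle_diff[OF f qL L2_lincomb[of b N]] q(4) by linarith
  have "nrm l (\<lambda>x. f x - (\<Sum>n<m. ip l f (e n) * e n x)) < \<epsilon>" if "m \<ge> N" for m
  proof -
    have "(nrm l (\<lambda>x. f x - (\<Sum>n<m. ip l f (e n) * e n x)))\<^sup>2 = (nrm l f)\<^sup>2 - (\<Sum>n<m. (ip l f (e n))\<^sup>2)"
      by (simp add: nrm_diff_lincomb[OF f])
    also have "\<dots> \<le> (nrm l f)\<^sup>2 - (\<Sum>n<N. (ip l f (e n))\<^sup>2)"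
      using that by (intro diff_left_mono sum_mono2) auto
    also have "\<dots> \<le> (nrm l (\<lambda>x. f x - (\<Sum>n<N. b n * e n x)))\<^sup>2"
      by (simp add: nrm_diff_lincomb[OF f] sum_nonneg)
    finally show ?thesis
      using lt power2_le_imp_le[OF _ nrm_nonneg] by fastforce
  qed
  then show "\<exists>no. \<forall>n\<ge>no. norm (nrm l (\<lambda>x. f x - (\<Sum>i<n. ip l f (e i) * e i x)) - 0) < \<epsilon>"
    by (intro exI[of _ N]) (simp add: nrm_nonneg)
qed

end

section \<open>Removing the drift\<close>

lemma indefinite_integral_halfline:
  fixes c :: "real \<Rightarrow> real"
  assumes c: "continuous_on {0..} c"
  shows "0 < t \<Longrightarrow> ((\<lambda>t. integral {0..t} c) has_real_derivative c t) (at t)"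
    and "continuous_on {0..T} (\<lambda>t. integral {0..t} c)"
proof -
  assume t: "0 < t"
  have "continuous_on {0..t+1} c" by (rule continuous_on_subset[OF c]) auto
  from integral_has_real_derivative[OF this, of t] t
  show "((\<lambda>t. integral {0..t} c) has_real_derivative c t) (at t)" by (simp add: at_within_Icc_at)
next
  have "continuous_on {0..T} c" by (rule continuous_on_subset[OF c]) auto
  then show "continuous_on {0..T} (\<lambda>t. integral {0..t} c)"
    by (intro indefinite_integral_continuous_1 integrable_continuous_interval)
qed

lemma C2_halflineD:
  assumes "C2_halfline f f' f''"
  shows "0 < t \<Longrightarrow> (f has_real_derivative f' t) (at t)"
    and "0 < t \<Longrightarrow> (f' has_real_derivative f'' t) (at t)"
    and "continuous_on {0..} f" and "continuous_on {0..} f'"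
proof -
  have within: "(f has_real_derivative f' t) (at t within {0..})"
    "(f' has_real_derivative f'' t) (at t within {0..})" if "t \<ge> 0" for t
    using assms that by (auto simp: C2_halfline_def)
  show "continuous_on {0..} f" by (rule continuous_on_DERIV) (use within in auto)
  show "continuous_on {0..} f'" by (rule continuous_on_DERIV) (use within in auto)
  assume t: "0 < t"
  have "at t within {0<..} = at t" using t by (intro at_within_open) auto
  moreover have "(f has_real_derivative f' t) (at t within {0<..})"
    "(f' has_real_derivative f'' t) (at t within {0<..})"
    by (rule has_field_derivative_subset[OF within(1)] has_field_derivative_subset[OF within(2)]; use t in auto)+
  ultimately show "(f has_real_derivative f' t) (at t)" "(f' has_real_derivative f'' t) (at t)" by simp_all
qed

text \<open>From \<open>(1 + x/3)^3 \<le> exp x\<close>, whence the 27. Of the three powers gained,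
  one pays for the linear growth of the eigenfunctions in \<open>lam n\<close> and two leave the
  summable \<open>1 / (lam n)^2\<close>.\<close>

lemma cube_exp_bound:
  fixes z r :: real
  assumes "z > 0" "r > 0"
  shows "z ^ 3 * exp (- z * r) \<le> 27 / r ^ 3"
proof -
  have "(z * r / 3) ^ 3 \<le> (1 + z * r / 3) ^ 3" using assms by (intro power_mono) auto
  also have "\<dots> \<le> exp (z * r)"
    using exp_ge_one_plus_x_over_n_power_n[of 3 "z * r"] mult_pos_pos[OF assms] by simp
  finally have "(z * r) ^ 3 \<le> 27 * exp (z * r)" by (simp add: power_divide)
  then have "z ^ 3 * r ^ 3 * exp (- z * r) \<le> 27"
    using assms by (simp add: power_mult_distrib exp_minus field_simps)
  then show ?thesis using assms by (simp add: field_simps)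
qed

locale moving_domain =
  fixes D f0 \<gamma>0 \<gamma>1 :: real
    and A A' A'' L L' L'' :: "real \<Rightarrow> real"
    and u :: "real \<Rightarrow> real \<Rightarrow> real"
    and \<sigma> :: "nat \<Rightarrow> real" and g :: "nat \<Rightarrow> real \<Rightarrow> real"
  assumes D_pos: "D > 0"
    and A_C2: "C2_halfline A A' A''" and L_C2: "C2_halfline L L' L''"
    and L_pos: "\<And>t. t \<ge> 0 \<Longrightarrow> L t > 0"
    and u0_L2: "L2_on {0..L 0} (\<lambda>\<xi>. u \<xi> 0)"
    and u_sol: "transformed_solution D f0 A' L L' u"
    and g_sys: "SL_eigensystem D (L 0) \<gamma>0 \<gamma>1 \<sigma> g"
begin

abbreviation "l \<equiv> L 0"

text \<open>\<open>a\<close> is the common time factor of the transformed equation. Measured in its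
  integral \<open>s\<close>, the comparison equation with potential \<open>Q\<close> is autonomous,
  which is why the modes evolve by \<open>exp (\<sigma> n * s t)\<close>.\<close>

definition "a t = l\<^sup>2 / (L t)\<^sup>2"
definition "s t = integral {0..t} a"
definition "I t = integral {0..t} (\<lambda>\<zeta>. (A' \<zeta>)\<^sup>2 / (4 * D))"

text \<open>\<open>exp (P \<xi> t)\<close> is the factor of \<open>mode\<close> that does not depend on \<open>n\<close>; the square root of
  \<open>l / L t\<close> is absorbed into the exponent.\<close>

definition "P \<xi> t = f0 * t - I t - \<xi>\<^sup>2 * L' t * L t / (4 * D * l\<^sup>2) - \<xi> * A' t * L t / (2 * D * l)
   + (ln l - ln (L t)) / 2"
definition "Px \<xi> t = - 2 * \<xi> * L' t * L t / (4 * D * l\<^sup>2) - A' t * L t / (2 * D * l)"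
definition "Pxx t = - 2 * L' t * L t / (4 * D * l\<^sup>2)"
definition "Pt \<xi> t = f0 - (A' t)\<^sup>2 / (4 * D) - \<xi>\<^sup>2 * (L'' t * L t + (L' t)\<^sup>2) / (4 * D * l\<^sup>2)
   - \<xi> * (A'' t * L t + A' t * L' t) / (2 * D * l) - L' t / (2 * L t)"
definition "w \<xi> t = u \<xi> t * exp (- P \<xi> t)"
definition "Q \<xi> = \<gamma>0 * \<xi>\<^sup>2 / (4 * D * l ^ 4) + \<gamma>1 * \<xi> / (2 * D * l ^ 3)"
text \<open>The true potential: \<open>Q\<close> with \<open>L'' L^3\<close> and
  \<open>A'' L^3\<close> in place of the constants. Both multiply nonnegative functions of \<xi>, so
  the two hypotheses of the theorem order \<open>q\<close> and \<open>Q\<close>.\<close>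

definition "q \<xi> t = L'' t * L t ^ 3 * \<xi>\<^sup>2 / (4 * D * l ^ 4) + A'' t * L t ^ 3 * \<xi> / (2 * D * l ^ 3)"

section \<open>Regularity and differential identities of the exponent\<close>

lemma l_pos: "l > 0" using L_pos by simp

lemma a_pos: "t \<ge> 0 \<Longrightarrow> a t > 0"
  unfolding a_def using L_pos[of t] l_pos by simp

lemma a_cont: "continuous_on {0..} a"
proof -
  have "\<forall>t\<in>{0..}. (L t)\<^sup>2 \<noteq> 0" using L_pos by (metis atLeast_iff less_irrefl power_not_zero)
  then show ?thesis unfolding a_def[abs_def]
    by (intro continuous_intros C2_halflineD(3)[OF L_C2])
qed

lemma I_cont: "continuous_on {0..} (\<lambda>\<zeta>. (A' \<zeta>)\<^sup>2 / (4 * D))"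
  using D_pos by (intro continuous_intros C2_halflineD(4)[OF A_C2]) auto

lemma s_deriv: "0 < t \<Longrightarrow> (s has_real_derivative a t) (at t)"
  unfolding s_def[abs_def] by (rule indefinite_integral_halfline(1)[OF a_cont])

lemma s_cont: "continuous_on {0..T} s"
  unfolding s_def[abs_def] by (rule indefinite_integral_halfline(2)[OF a_cont])

lemma s_0: "s 0 = 0" by (simp add: s_def)

lemma s_strict:
  assumes "0 \<le> t1" "t1 < t2" shows "s t1 < s t2"
proof (rule DERIV_pos_imp_increasing_open[OF assms(2)])
  show "continuous_on {t1..t2} s" by (rule continuous_on_subset[OF s_cont[of t2]]) (use assms in auto)
  fix t assume "t1 < t"
  then have "0 < t" using assms by simp
  then show "\<exists>y. (s has_real_derivative y) (at t) \<and> 0 < y" using s_deriv a_pos[of t] by (intro exI[of _ "a t"]) simp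
qed

lemma P_cont: "continuous_on ({0..l} \<times> {0..T}) (\<lambda>(\<xi>, t). P \<xi> t)"
proof -
  have snd: "continuous_on ({0..l} \<times> {0..T}) (\<lambda>z. c (snd z))" if "continuous_on {0..T} c" for c :: "real \<Rightarrow> real"
    by (rule continuous_on_compose2[OF that continuous_on_snd[OF continuous_on_id]]) auto
  have I: "continuous_on {0..T} I"
    unfolding I_def[abs_def] by (rule indefinite_integral_halfline(2)[OF I_cont])
  have L: "continuous_on {0..T} L" "continuous_on {0..T} L'" "continuous_on {0..T} A'"
    by (rule continuous_on_subset[OF C2_halflineD(3)[OF L_C2]] continuous_on_subset[OF C2_halflineD(4)[OF L_C2]]
        continuous_on_subset[OF C2_halflineD(4)[OF A_C2]]; auto)+
  have nz: "\<forall>z\<in>{0..l} \<times> {0..T}. L (snd z) \<noteq> 0" using L_pos by fastforce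
  show ?thesis unfolding P_def split_beta
    by (intro continuous_intros snd[OF I] snd[OF L(1)] snd[OF L(2)] snd[OF L(3)]) (use nz D_pos l_pos in auto)
qed

lemma P_cont_fixed:
  assumes "t \<ge> 0" shows "continuous_on {0..l} (\<lambda>\<xi>. P \<xi> t)"
  unfolding P_def using D_pos l_pos by (intro continuous_intros) auto

lemma P_derivs:
  assumes t: "t > 0"
  shows "((\<lambda>\<xi>. P \<xi> t) has_real_derivative Px \<xi> t) (at \<xi>)"
    and "((\<lambda>\<xi>. Px \<xi> t) has_real_derivative Pxx t) (at \<xi>)"
    and "(P \<xi> has_real_derivative Pt \<xi> t) (at t)"
proof -
  have nz: "D \<noteq> 0" "l \<noteq> 0" "L t > 0" using D_pos l_pos L_pos[of t] t by auto
  show "((\<lambda>\<xi>. P \<xi> t) has_real_derivative Px \<xi> t) (at \<xi>)"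
    unfolding P_def Px_def using nz by (auto intro!: derivative_eq_intros simp: field_simps)
  show "((\<lambda>\<xi>. Px \<xi> t) has_real_derivative Pxx t) (at \<xi>)"
    unfolding Px_def Pxx_def using nz by (auto intro!: derivative_eq_intros simp: field_simps)
  note dL = C2_halflineD(1)[OF L_C2 t] C2_halflineD(2)[OF L_C2 t] C2_halflineD(2)[OF A_C2 t]
  have dI: "(I has_real_derivative (A' t)\<^sup>2 / (4 * D)) (at t)"
    unfolding I_def[abs_def] by (rule indefinite_integral_halfline(1)[OF I_cont t])
  have d1: "((\<lambda>t. f0 * t) has_real_derivative f0) (at t)" by (auto intro!: derivative_eq_intros)
  have d2: "((\<lambda>t. \<xi>\<^sup>2 * L' t * L t / (4 * D * l\<^sup>2)) has_real_derivative \<xi>\<^sup>2 * (L'' t * L t + (L' t)\<^sup>2) / (4 * D * l\<^sup>2)) (at t)"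
    using DERIV_cdivide[OF DERIV_cmult[OF DERIV_mult[OF dL(2) dL(1)], of "\<xi>\<^sup>2"], of "4 * D * l\<^sup>2"]
    by (simp add: mult.assoc power2_eq_square)
  have d3: "((\<lambda>t. \<xi> * A' t * L t / (2 * D * l)) has_real_derivative \<xi> * (A'' t * L t + A' t * L' t) / (2 * D * l)) (at t)"
    using DERIV_cdivide[OF DERIV_cmult[OF DERIV_mult[OF dL(3) dL(1)], of \<xi>], of "2 * D * l"]
    by (simp add: mult.assoc mult.commute[of "L' t"])
  have d4: "((\<lambda>t. (ln l - ln (L t)) / 2) has_real_derivative - (L' t / (2 * L t))) (at t)"
    using dL(1) nz by (auto intro!: derivative_eq_intros simp: field_simps)
  show "(P \<xi> has_real_derivative Pt \<xi> t) (at t)"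
    using DERIV_add[OF DERIV_diff[OF DERIV_diff[OF DERIV_diff[OF d1 dI] d2] d3] d4]
    unfolding P_def[abs_def] Pt_def by simp
qed

text \<open>This is what determines \<open>P\<close>. The first identity removes the drift and fixes
  the dependence on \<xi>. Since the drift equals \<open>- 2 a D Px\<close>, the zeroth order
  coefficient involves \<open>Pxx - Px^2\<close>; the terms of \<open>P\<close> without \<xi> absorb
  \<open>f0\<close>, the square of \<open>A'\<close>, and the contribution \<open>L' / (2 L)\<close>
  of \<open>Pxx\<close>, which is the origin of the square root of \<open>l / L t\<close>.\<close>

lemma P_identity:
  assumes t: "t > 0"
  shows "a t * D * (2 * Px \<xi> t) = - (A' t * l + \<xi> * L' t) / L t"
    and "f0 - Pt \<xi> t - a t * D * ((Px \<xi> t)\<^sup>2 - Pxx t) = a t * q \<xi> t"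
proof -
  have nz: "D \<noteq> 0" "l \<noteq> 0" "L t \<noteq> 0" using D_pos l_pos L_pos[of t] t by auto
  show "a t * D * (2 * Px \<xi> t) = - (A' t * l + \<xi> * L' t) / L t"
    unfolding a_def Px_def using nz by (simp add: field_simps power2_eq_square)
  define c1 c2 where "c1 = - (2 * L' t * L t / (4 * D * l\<^sup>2))" and "c2 = - (A' t * L t / (2 * D * l))"
  have Px: "Px \<xi> t = c1 * \<xi> + c2" by (simp add: Px_def c1_def c2_def)
  have "a t * D * c1\<^sup>2 = (L' t)\<^sup>2 / (4 * D * l\<^sup>2)" "a t * D * (2 * c1 * c2) = A' t * L' t / (2 * D * l)"
    "a t * D * c2\<^sup>2 = (A' t)\<^sup>2 / (4 * D)" "a t * D * Pxx t = - (L' t / (2 * L t))"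
    unfolding a_def c1_def c2_def Pxx_def using nz by (simp_all add: field_simps power2_eq_square)
  moreover have "a t * D * ((Px \<xi> t)\<^sup>2 - Pxx t)
      = \<xi>\<^sup>2 * (a t * D * c1\<^sup>2) + \<xi> * (a t * D * (2 * c1 * c2)) + a t * D * c2\<^sup>2 - a t * D * Pxx t"
    unfolding Px by (simp add: algebra_simps power2_eq_square)
  ultimately have 1: "a t * D * ((Px \<xi> t)\<^sup>2 - Pxx t)
      = \<xi>\<^sup>2 * ((L' t)\<^sup>2 / (4 * D * l\<^sup>2)) + \<xi> * (A' t * L' t / (2 * D * l)) + (A' t)\<^sup>2 / (4 * D) + L' t / (2 * L t)"
    by simp
  have "a t * (L'' t * L t ^ 3 / (4 * D * l ^ 4)) = L'' t * L t / (4 * D * l\<^sup>2)"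
    "a t * (A'' t * L t ^ 3 / (2 * D * l ^ 3)) = A'' t * L t / (2 * D * l)"
    unfolding a_def using nz by (simp_all add: field_simps power2_eq_square power3_eq_cube power4_eq_xxxx)
  moreover have "a t * q \<xi> t = \<xi>\<^sup>2 * (a t * (L'' t * L t ^ 3 / (4 * D * l ^ 4))) + \<xi> * (a t * (A'' t * L t ^ 3 / (2 * D * l ^ 3)))"
    unfolding q_def by (simp add: algebra_simps)
  ultimately have 2: "a t * q \<xi> t = \<xi>\<^sup>2 * (L'' t * L t / (4 * D * l\<^sup>2)) + \<xi> * (A'' t * L t / (2 * D * l))"
    by simp
  show "f0 - Pt \<xi> t - a t * D * ((Px \<xi> t)\<^sup>2 - Pxx t) = a t * q \<xi> t"
    unfolding 1 2 Pt_def by (simp add: ring_distribs add_divide_distrib)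
qed

lemma w_pde:
  obtains wt wx wxx where
    "\<And>\<xi> t. \<xi> \<in> {0<..<l} \<Longrightarrow> t > 0 \<Longrightarrow> (w \<xi> has_real_derivative wt \<xi> t) (at t)"
    "\<And>\<xi> t. \<xi> \<in> {0<..<l} \<Longrightarrow> t > 0 \<Longrightarrow> ((\<lambda>\<xi>. w \<xi> t) has_real_derivative wx \<xi> t) (at \<xi>)"
    "\<And>\<xi> t. \<xi> \<in> {0<..<l} \<Longrightarrow> t > 0 \<Longrightarrow> ((\<lambda>\<xi>. wx \<xi> t) has_real_derivative wxx \<xi> t) (at \<xi>)"
    "\<And>\<xi> t. \<xi> \<in> {0<..<l} \<Longrightarrow> t > 0 \<Longrightarrow> wt \<xi> t = a t * (D * wxx \<xi> t + q \<xi> t * w \<xi> t)"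
proof -
  obtain ut ux uxx where u: "\<forall>t>0. \<forall>\<xi>\<in>{0<..<l}.
           ((\<lambda>s. u \<xi> s) has_real_derivative ut \<xi> t) (at t) \<and>
           ((\<lambda>x. u x t) has_real_derivative ux \<xi> t) (at \<xi>) \<and>
           ((\<lambda>x. ux x t) has_real_derivative uxx \<xi> t) (at \<xi>) \<and>
           ut \<xi> t = D * l\<^sup>2 / (L t)\<^sup>2 * uxx \<xi> t
                    + (A' t * l + \<xi> * L' t) / L t * ux \<xi> t + f0 * u \<xi> t"
    using u_sol unfolding transformed_solution_def by blast
  show ?thesis
  proof
    fix \<xi> t assume x: "\<xi> \<in> {0<..<l}" and t: "t > (0::real)"
    note ud = u[rule_format, OF t x]
    show "(w \<xi> has_real_derivative (ut \<xi> t - Pt \<xi> t * u \<xi> t) * exp (- P \<xi> t)) (at t)"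
      unfolding w_def[abs_def]
      by (rule derivative_eq_intros conjunct1[OF ud] P_derivs(3)[OF t] refl)+ (simp add: algebra_simps)
    show "((\<lambda>\<xi>. w \<xi> t) has_real_derivative (ux \<xi> t - Px \<xi> t * u \<xi> t) * exp (- P \<xi> t)) (at \<xi>)"
      unfolding w_def[abs_def]
      by (rule derivative_eq_intros conjunct1[OF conjunct2[OF ud]] P_derivs(1)[OF t] refl)+ (simp add: algebra_simps)
    show "((\<lambda>\<xi>. (ux \<xi> t - Px \<xi> t * u \<xi> t) * exp (- P \<xi> t)) has_real_derivative
      (uxx \<xi> t - 2 * Px \<xi> t * ux \<xi> t + ((Px \<xi> t)\<^sup>2 - Pxx t) * u \<xi> t) * exp (- P \<xi> t)) (at \<xi>)"
      by (rule derivative_eq_intros conjunct1[OF conjunct2[OF ud]] conjunct1[OF conjunct2[OF conjunct2[OF ud]]]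
          P_derivs(1,2)[OF t] refl)+ (simp add: algebra_simps power2_eq_square)
    have "ut \<xi> t = a t * D * uxx \<xi> t + (A' t * l + \<xi> * L' t) / L t * ux \<xi> t + f0 * u \<xi> t"
      using ud by (simp add: a_def mult.commute)
    also have "(A' t * l + \<xi> * L' t) / L t = - (a t * D * (2 * Px \<xi> t))"
      unfolding P_identity(1)[OF t] by (simp only: minus_divide_left[symmetric] minus_minus)
    finally have eq: "ut \<xi> t - Pt \<xi> t * u \<xi> t = a t * D * (uxx \<xi> t - 2 * Px \<xi> t * ux \<xi> t + ((Px \<xi> t)\<^sup>2 - Pxx t) * u \<xi> t)
        + (f0 - Pt \<xi> t - a t * D * ((Px \<xi> t)\<^sup>2 - Pxx t)) * u \<xi> t"
      by (simp add: algebra_simps)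
    show "(ut \<xi> t - Pt \<xi> t * u \<xi> t) * exp (- P \<xi> t) = a t * (D *
      ((uxx \<xi> t - 2 * Px \<xi> t * ux \<xi> t + ((Px \<xi> t)\<^sup>2 - Pxx t) * u \<xi> t) * exp (- P \<xi> t)) + q \<xi> t * w \<xi> t)"
      unfolding eq P_identity(2)[OF t] w_def by (simp add: algebra_simps)
  qed
qed

end

section \<open>Comparison with the eigenfunction expansion\<close>

text \<open>Strictness of \<open>Q < \<kappa>\<close> is used twice: it makes \<open>M\<close>
  positive for the elliptic theory, and it makes the parabolic differential inequality
  strict.\<close>

locale moving_domain_shift = moving_domain +
  fixes \<kappa> :: real
  assumes \<kappa>: "\<And>\<xi>. \<xi> \<in> {0..l} \<Longrightarrow> Q \<xi> < \<kappa>"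
begin

definition "M \<xi> = \<kappa> - Q \<xi>"
definition "e n \<xi> = 1 / nrm l (g n) * g n \<xi>"
definition "lam n = \<kappa> - \<sigma> n"

sublocale dir: dirichlet l D M
proof
  show "continuous_on {0..l} M"
    unfolding M_def[abs_def] Q_def[abs_def] using D_pos l_pos by (intro continuous_intros) auto
qed (use l_pos D_pos \<kappa> in \<open>auto simp: M_def\<close>)

lemma eigenpair_imp_sol:
  assumes "SL_eigenpair D l \<gamma>0 \<gamma>1 \<mu> h"
  shows "dir.sol h (\<lambda>x. (\<kappa> - \<mu>) * h x)"
proof -
  obtain h' h'' where h: "\<forall>\<xi>\<in>{0<..<l}. (h has_real_derivative h' \<xi>) (at \<xi>) \<and>
        (h' has_real_derivative h'' \<xi>) (at \<xi>) \<and>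
        \<mu> * h \<xi> = D * h'' \<xi> + (\<gamma>0 * \<xi>\<^sup>2 / (4 * D * l ^ 4) + \<gamma>1 * \<xi> / (2 * D * l ^ 3)) * h \<xi>"
    and c: "continuous_on {0..l} h" "h 0 = 0" "h l = 0"
    using assms unfolding SL_eigenpair_def by blast
  have "(\<kappa> - \<mu>) * h x = M x * h x - D * h'' x" if "x \<in> {0<..<l}" for x
  proof -
    have "\<mu> * h x = D * h'' x + Q x * h x" using h that unfolding Q_def by blast
    then show ?thesis by (simp add: M_def left_diff_distrib)
  qed
  then have "dir.wsol h (\<lambda>x. (\<kappa> - \<mu>) * h x)"
    using h by (intro dir.wsolI[OF c, of h' h'']) auto
  then show ?thesis by (rule dir.wsol_imp_sol) (intro continuous_intros c)
qed

lemma sol_imp_eigenpair: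
  assumes sol: "dir.sol h (\<lambda>x. \<mu> * h x)" and x: "x \<in> {0..l}" "h x \<noteq> 0"
  shows "SL_eigenpair D l \<gamma>0 \<gamma>1 (\<kappa> - \<mu>) h"
proof -
  have "dir.wsol h (\<lambda>x. \<mu> * h x)" by (rule dir.sol_wsol[OF sol])
  then obtain h' h'' where h: "\<forall>x\<in>{0<..<l}. (h has_real_derivative h' x) (at x) \<and>
        (h' has_real_derivative h'' x) (at x) \<and> \<mu> * h x = M x * h x - D * h'' x"
    and c: "continuous_on {0..l} h" "h 0 = 0" "h l = 0"
    unfolding dir.wsol_def by blast
  have "(\<kappa> - \<mu>) * h y = D * h'' y + Q y * h y" if "y \<in> {0<..<l}" for y
  proof -
    have "\<mu> * h y = (\<kappa> - Q y) * h y - D * h'' y" using h that unfolding M_def by blast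
    then show ?thesis by (simp add: algebra_simps)
  qed
  then have "\<forall>\<xi>\<in>{0<..<l}. (h has_real_derivative h' \<xi>) (at \<xi>) \<and>
        (h' has_real_derivative h'' \<xi>) (at \<xi>) \<and>
        (\<kappa> - \<mu>) * h \<xi> = D * h'' \<xi> + (\<gamma>0 * \<xi>\<^sup>2 / (4 * D * l ^ 4) + \<gamma>1 * \<xi> / (2 * D * l ^ 3)) * h \<xi>"
    using h unfolding Q_def by blast
  moreover have "x \<noteq> 0" "x \<noteq> l" using c x by auto
  then have "\<exists>\<xi>\<in>{0<..<l}. h \<xi> \<noteq> 0" using x by (intro bexI[of _ x]) auto
  ultimately show ?thesis using c unfolding SL_eigenpair_def
    by (intro conjI exI[of _ h'] exI[of _ h'']) auto
qed

lemma g_pair: "SL_eigenpair D l \<gamma>0 \<gamma>1 (\<sigma> n) (g n)"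
  using g_sys by (simp add: SL_eigensystem_def)

lemma g_nrm_pos: "0 < nrm l (g n)"
proof -
  have c: "continuous_on {0..l} (g n)" and "\<exists>\<xi>\<in>{0<..<l}. g n \<xi> \<noteq> 0"
    using g_pair[of n] unfolding SL_eigenpair_def by blast+
  then obtain \<xi> where "\<xi> \<in> {0<..<l}" "g n \<xi> \<noteq> 0" by blast
  then show ?thesis by (intro nrm_pos_continuous[OF c _ _ l_pos, of \<xi>]) auto
qed

sublocale eb: eigenbasis l D M e lam
proof
  fix n
  show "dir.sol (e n) (\<lambda>x. lam n * e n x)"
    unfolding e_def[abs_def] lam_def
    by (rule dir.sol_cong[OF dir.sol_cmult[OF eigenpair_imp_sol[OF g_pair[of n]], of "1 / nrm l (g n)"]]) auto
  show "nrm l (e n) = 1"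
    unfolding e_def[abs_def] nrm_cmult using g_nrm_pos[of n] by simp
  show "inj lam"
    using g_sys by (auto simp: SL_eigensystem_def lam_def inj_def)
next
  fix h \<mu> x assume h: "dir.sol h (\<lambda>x. \<mu> * h x)" "x \<in> {0..l}" "h x \<noteq> 0"
  have "\<kappa> - \<mu> \<in> range \<sigma>"
    using sol_imp_eigenpair[OF h] g_sys unfolding SL_eigensystem_def by blast
  then obtain n where "\<kappa> - \<mu> = \<sigma> n" by blast
  then show "\<mu> \<in> range lam" by (intro image_eqI[of _ _ n]) (auto simp: lam_def)
qed

section \<open>The driftless function and its comparison with finite sums\<close>

lemma u_cont: "continuous_on ({0..l} \<times> {0<..}) (\<lambda>(\<xi>, t). u \<xi> t)"
  using u_sol unfolding transformed_solution_def by blast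

lemma u_bc: "t > 0 \<Longrightarrow> u 0 t = 0" "t > 0 \<Longrightarrow> u l t = 0"
  using u_sol unfolding transformed_solution_def by blast+

lemma u_nonneg: "t > 0 \<Longrightarrow> \<xi> \<in> {0..l} \<Longrightarrow> 0 \<le> u \<xi> t"
  using u_sol unfolding transformed_solution_def by blast

lemma w_nonneg: "t > 0 \<Longrightarrow> \<xi> \<in> {0..l} \<Longrightarrow> 0 \<le> w \<xi> t"
  unfolding w_def using u_nonneg by simp

lemma w_cont:
  assumes "\<tau> > 0" shows "continuous_on ({0..l} \<times> {\<tau>..T}) (\<lambda>(\<xi>, t). w \<xi> t)"
proof -
  have "continuous_on ({0..l} \<times> {\<tau>..T}) (\<lambda>(\<xi>, t). u \<xi> t)"
    by (rule continuous_on_subset[OF u_cont]) (use assms in auto)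
  moreover have "continuous_on ({0..l} \<times> {\<tau>..T}) (\<lambda>(\<xi>, t). P \<xi> t)"
    by (rule continuous_on_subset[OF P_cont[of T]]) (use assms in auto)
  ultimately show ?thesis unfolding w_def split_beta by (intro continuous_intros)
qed

lemma u_cont_fixed: "t > 0 \<Longrightarrow> continuous_on {0..l} (\<lambda>\<xi>. u \<xi> t)"
  using continuous_on_compose2[OF u_cont, of "{0..l}" "\<lambda>\<xi>. (\<xi>, t)"]
  by (auto simp: image_subset_iff continuous_on_Pair)

lemma w_cont_fixed: "t > 0 \<Longrightarrow> continuous_on {0..l} (\<lambda>\<xi>. w \<xi> t)"
  unfolding w_def by (intro continuous_intros u_cont_fixed P_cont_fixed) auto

lemma w_L2:
  assumes "t \<ge> 0" shows "L2_on {0..l} (\<lambda>\<xi>. w \<xi> t)"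
proof (cases "t = 0")
  case True
  have "continuous_on {0..l} (\<lambda>\<xi>. exp (- P \<xi> 0))" by (intro continuous_intros P_cont_fixed) simp
  from L2_on_mult_continuous[OF u0_L2 this] show ?thesis using True by (simp add: w_def mult.commute)
next
  case False
  then show ?thesis using assms by (intro L2_on_continuous w_cont_fixed) simp
qed

text \<open>The sign \<open>\<epsilon> = 1\<close> gives the upper and \<open>\<epsilon> = -1\<close> the lower bound.\<close>

lemma comparison:
  assumes \<epsilon>: "\<epsilon> * \<epsilon> = 1" and sgn: "\<And>\<xi> t. \<xi> \<in> {0<..<l} \<Longrightarrow> t > 0 \<Longrightarrow> \<epsilon> * (q \<xi> t - Q \<xi>) \<le> 0"
    and \<tau>: "\<tau> > 0" "\<tau> \<le> T" and \<delta>: "\<delta> \<ge> 0"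
    and init: "\<And>\<xi>. \<xi> \<in> {0..l} \<Longrightarrow> \<bar>w \<xi> \<tau> - (\<Sum>n<N. b n * e n \<xi>)\<bar> \<le> \<delta>"
    and \<xi>: "\<xi> \<in> {0..l}"
  shows "\<epsilon> * (w \<xi> T - (\<Sum>n<N. b n * exp (\<sigma> n * (s T - s \<tau>)) * e n \<xi>)) \<le> \<delta> * exp (\<kappa> * (s T - s \<tau>))"
proof (rule w_pde)
  fix wt wx wxx assume w:
    "\<And>\<xi> t. \<xi> \<in> {0<..<l} \<Longrightarrow> t > 0 \<Longrightarrow> (w \<xi> has_real_derivative wt \<xi> t) (at t)"
    "\<And>\<xi> t. \<xi> \<in> {0<..<l} \<Longrightarrow> t > 0 \<Longrightarrow> ((\<lambda>\<xi>. w \<xi> t) has_real_derivative wx \<xi> t) (at \<xi>)"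
    "\<And>\<xi> t. \<xi> \<in> {0<..<l} \<Longrightarrow> t > 0 \<Longrightarrow> ((\<lambda>\<xi>. wx \<xi> t) has_real_derivative wxx \<xi> t) (at \<xi>)"
    "\<And>\<xi> t. \<xi> \<in> {0<..<l} \<Longrightarrow> t > 0 \<Longrightarrow> wt \<xi> t = a t * (D * wxx \<xi> t + q \<xi> t * w \<xi> t)"
  have "\<forall>n. \<exists>e'. \<forall>x\<in>{0<..<l}. (e n has_real_derivative e' x) (at x) \<and>
      (e' has_real_derivative (M x * e n x - lam n * e n x) / D) (at x)"
  proof
    fix n
    from conjunct2[OF conjunct2[OF eb.e_sol[of n, unfolded dir.sol_def]]]
    obtain e' where e': "\<forall>x\<in>{0..l}. (e n has_real_derivative e' x) (at x within {0..l}) \<and>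
        (e' has_real_derivative (M x * e n x - lam n * e n x) / D) (at x within {0..l})" ..
    show "\<exists>e'. \<forall>x\<in>{0<..<l}. (e n has_real_derivative e' x) (at x) \<and>
      (e' has_real_derivative (M x * e n x - lam n * e n x) / D) (at x)"
    proof (intro exI[of _ e'] ballI)
      fix x assume x: "x \<in> {0<..<l}"
      then have eq: "at x within {0..l} = at x" by (intro at_within_Icc_at) auto
      have "x \<in> {0..l}" using x by simp
      from bspec[OF e' this, unfolded eq] show "(e n has_real_derivative e' x) (at x) \<and>
        (e' has_real_derivative (M x * e n x - lam n * e n x) / D) (at x)" .
    qed
  qed
  from choice[OF this] obtain e' where e'0: "\<forall>n. \<forall>x\<in>{0<..<l}. (e n has_real_derivative e' n x) (at x) \<and>
      (e' n has_real_derivative (M x * e n x - lam n * e n x) / D) (at x)" ..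
  have e': "(e n has_real_derivative e' n x) (at x)"
    "(e' n has_real_derivative (M x * e n x - lam n * e n x) / D) (at x)" if "x \<in> {0<..<l}" for n x
    by (rule conjunct1[OF bspec[OF spec[OF e'0] that]] conjunct2[OF bspec[OF spec[OF e'0] that]])+
  \<comment> \<open>The exact solution of the equation with potential \<open>Q\<close> that starts
    at time \<tau> from the given finite combination.\<close>
  define W where "W \<xi> t = (\<Sum>n<N. b n * exp (\<sigma> n * (s t - s \<tau>)) * e n \<xi>)" for \<xi> t
  define Wt where "Wt \<xi> t = (\<Sum>n<N. b n * (exp (\<sigma> n * (s t - s \<tau>)) * (\<sigma> n * a t)) * e n \<xi>)" for \<xi> t
  define Wx where "Wx \<xi> t = (\<Sum>n<N. b n * exp (\<sigma> n * (s t - s \<tau>)) * e' n \<xi>)" for \<xi> t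
  define Wxx where "Wxx \<xi> t = (\<Sum>n<N. b n * exp (\<sigma> n * (s t - s \<tau>)) * ((M \<xi> * e n \<xi> - lam n * e n \<xi>) / D))" for \<xi> t
  have W: "(W \<xi> has_real_derivative Wt \<xi> t) (at t)" if "t > 0" for \<xi> t
    unfolding W_def[abs_def] Wt_def
    by (auto intro!: derivative_eq_intros s_deriv[OF that] simp: mult_ac)
  have W1: "((\<lambda>\<xi>. W \<xi> t) has_real_derivative Wx \<xi> t) (at \<xi>)" if "\<xi> \<in> {0<..<l}" for \<xi> t
    unfolding W_def[abs_def] Wx_def by (intro DERIV_sum DERIV_cmult e'(1) that)
  have W2: "((\<lambda>\<xi>. Wx \<xi> t) has_real_derivative Wxx \<xi> t) (at \<xi>)" if "\<xi> \<in> {0<..<l}" for \<xi> t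
    unfolding Wx_def[abs_def] Wxx_def by (intro DERIV_sum DERIV_cmult e'(2) that)
  have Wpde: "Wt \<xi> t = a t * (D * Wxx \<xi> t + Q \<xi> * W \<xi> t)" for \<xi> t
    unfolding Wt_def Wxx_def W_def sum_distrib_left sum.distrib[symmetric]
    by (rule sum.cong) (use D_pos in \<open>auto simp: M_def lam_def field_simps\<close>)
  \<comment> \<open>This factor replaces the potential \<open>Q\<close> by
    \<open>Q - \<kappa> < 0\<close>; undoing it at time \<open>T\<close> produces the exponential on
    the right-hand side of the claim.\<close>
  define X where "X t = exp (- \<kappa> * (s t - s \<tau>))" for t
  define y where "y \<xi> t = \<epsilon> * (w \<xi> t - W \<xi> t) * X t" for \<xi> t
  have Xpos: "X t > 0" for t by (simp add: X_def)
  have dX: "(X has_real_derivative - \<kappa> * a t * X t) (at t)" if "t > 0" for t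
    unfolding X_def[abs_def] by (auto intro!: derivative_eq_intros s_deriv[OF that])
  have "y \<xi> T \<le> \<delta>"
  proof (rule parabolic_max_principle[of l \<tau> T y \<delta>
        "\<lambda>\<xi> t. \<epsilon> * (wt \<xi> t - Wt \<xi> t) * X t + - \<kappa> * a t * X t * (\<epsilon> * (w \<xi> t - W \<xi> t))"
        "\<lambda>\<xi> t. \<epsilon> * (wx \<xi> t - Wx \<xi> t) * X t" "\<lambda>\<xi> t. \<epsilon> * (wxx \<xi> t - Wxx \<xi> t) * X t" "\<lambda>t. a t * D"])
    have snd: "continuous_on ({0..l} \<times> {\<tau>..T}) (\<lambda>z. s (snd z))"
      by (rule continuous_on_compose2[OF s_cont[of T] continuous_on_snd[OF continuous_on_id]]) (use \<tau> in auto)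
    have fst: "continuous_on ({0..l} \<times> {\<tau>..T}) (\<lambda>z. e n (fst z))" for n
      by (rule continuous_on_compose2[OF eb.e_cont continuous_on_fst[OF continuous_on_id]]) auto
    show "continuous_on ({0..l} \<times> {\<tau>..T}) (\<lambda>(\<xi>, t). y \<xi> t)"
      unfolding y_def W_def X_def split_beta
      by (intro continuous_intros snd fst w_cont[OF \<tau>(1), of T, unfolded split_beta])
    show "y 0 t \<le> \<delta>" "y l t \<le> \<delta>" if "t \<in> {\<tau>..T}" for t
    proof -
      have e0: "e n 0 = 0" "e n l = 0" for n using eb.e_sol[of n] by (auto simp: dir.sol_def)
      show "y 0 t \<le> \<delta>" "y l t \<le> \<delta>"
        using that \<tau> \<delta> by (auto simp: y_def w_def W_def u_bc e0)
    qed
    fix \<xi> assume \<xi>: "\<xi> \<in> {0..l}"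
    have "\<bar>\<epsilon>\<bar> = 1" using \<epsilon> by (metis abs_mult_self_eq abs_one abs_square_eq_1 power2_eq_square)
    then have "\<bar>\<epsilon> * (w \<xi> \<tau> - W \<xi> \<tau>)\<bar> \<le> \<delta>" using init[OF \<xi>] by (simp add: W_def abs_mult)
    then show "y \<xi> \<tau> \<le> \<delta>" by (simp add: y_def X_def)
  next
    fix \<xi> t assume \<xi>: "\<xi> \<in> {0<..<l}" and t': "t \<in> {\<tau><..T}"
    then have t: "t > 0" using \<tau> by simp
    show "(y \<xi> has_real_derivative \<epsilon> * (wt \<xi> t - Wt \<xi> t) * X t + - \<kappa> * a t * X t * (\<epsilon> * (w \<xi> t - W \<xi> t))) (at t)"
      unfolding y_def[abs_def] by (intro DERIV_mult DERIV_cmult DERIV_diff w(1) W dX t \<xi>)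
    show "((\<lambda>\<xi>. y \<xi> t) has_real_derivative \<epsilon> * (wx \<xi> t - Wx \<xi> t) * X t) (at \<xi>)"
      unfolding y_def[abs_def] by (intro DERIV_cmult_right DERIV_cmult DERIV_diff w(2) W1 t \<xi>)
    show "((\<lambda>\<xi>. \<epsilon> * (wx \<xi> t - Wx \<xi> t) * X t) has_real_derivative \<epsilon> * (wxx \<xi> t - Wxx \<xi> t) * X t) (at \<xi>)"
      by (intro DERIV_cmult_right DERIV_cmult DERIV_diff w(3) W2 t \<xi>)
    assume y: "0 < y \<xi> t"
    have at: "a t > 0" using a_pos t by simp
    \<comment> \<open>The defect splits in two: the difference of potentials multiplies
      \<open>w\<close>, whose sign is known, while \<open>Q - \<kappa>\<close> multiplies
      \<open>y\<close> and is strictly negative where \<open>y > 0\<close>.\<close>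
    have "\<epsilon> * (wt \<xi> t - Wt \<xi> t) * X t + - \<kappa> * a t * X t * (\<epsilon> * (w \<xi> t - W \<xi> t))
      - a t * D * (\<epsilon> * (wxx \<xi> t - Wxx \<xi> t) * X t)
      = a t * (X t * w \<xi> t * (\<epsilon> * (q \<xi> t - Q \<xi>)) + (Q \<xi> - \<kappa>) * y \<xi> t)"
      unfolding w(4)[OF \<xi> t] Wpde y_def by (simp add: algebra_simps)
    moreover have "X t * w \<xi> t * (\<epsilon> * (q \<xi> t - Q \<xi>)) \<le> 0"
      by (rule mult_nonneg_nonpos[OF mult_nonneg_nonneg sgn[OF \<xi> t]])
        (use less_imp_le[OF Xpos[of t]] w_nonneg[OF t, of \<xi>] \<xi> in auto)
    moreover have "(Q \<xi> - \<kappa>) * y \<xi> t < 0"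
      using \<kappa>[of \<xi>] \<xi> y by (intro mult_neg_pos) auto
    ultimately have "\<epsilon> * (wt \<xi> t - Wt \<xi> t) * X t + - \<kappa> * a t * X t * (\<epsilon> * (w \<xi> t - W \<xi> t))
      - a t * D * (\<epsilon> * (wxx \<xi> t - Wxx \<xi> t) * X t) < 0"
      using at by (simp add: mult_pos_neg)
    then show "\<epsilon> * (wt \<xi> t - Wt \<xi> t) * X t + - \<kappa> * a t * X t * (\<epsilon> * (w \<xi> t - W \<xi> t))
      < a t * D * (\<epsilon> * (wxx \<xi> t - Wxx \<xi> t) * X t)" by simp
  next
    show "0 \<le> a t * D" if "t \<in> {\<tau><..T}" for t using a_pos[of t] D_pos \<tau> that by simp
  qed (use \<delta> \<xi> \<tau> in auto)
  then have "\<epsilon> * (w \<xi> T - W \<xi> T) * X T * exp (\<kappa> * (s T - s \<tau>)) \<le> \<delta> * exp (\<kappa> * (s T - s \<tau>))"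
    unfolding y_def by (intro mult_right_mono) auto
  moreover have "X T * exp (\<kappa> * (s T - s \<tau>)) = 1"
    unfolding X_def exp_add[symmetric] by simp
  ultimately show ?thesis unfolding W_def by (simp add: mult.assoc)
qed

text \<open>The increment of \<open>w\<close> splits into \<open>exp (- P \<xi> t)\<close> times the
  increment of \<open>u\<close>, small in L2, and the increment of the exponential times the datum,
  small because \<open>P\<close> is uniformly continuous up to time 0.\<close>

lemma w_initial: "((\<lambda>t. nrm l (\<lambda>\<xi>. w \<xi> t - w \<xi> 0)) \<longlongrightarrow> 0) (at_right 0)"
proof -
  have "((\<lambda>t. (nrm l (\<lambda>\<xi>. u \<xi> t - u \<xi> 0))\<^sup>2) \<longlongrightarrow> 0) (at_right 0)"
    using u_sol unfolding transformed_solution_def L2_dist_sq_eq_nrm by blast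
  then have "((\<lambda>t. sqrt ((nrm l (\<lambda>\<xi>. u \<xi> t - u \<xi> 0))\<^sup>2)) \<longlongrightarrow> sqrt 0) (at_right 0)"
    by (rule tendsto_real_sqrt)
  then have ulim: "((\<lambda>t. nrm l (\<lambda>\<xi>. u \<xi> t - u \<xi> 0)) \<longlongrightarrow> 0) (at_right 0)"
    by (simp add: nrm_nonneg)
  have Ec: "continuous_on ({0..l} \<times> {0..1}) (\<lambda>z. exp (- P (fst z) (snd z)))"
    using P_cont[of 1] unfolding split_beta by (intro continuous_intros)
  have comp: "compact ({0..l} \<times> {0..1::real})" by (intro compact_Times compact_Icc)
  obtain B0 where "\<forall>z\<in>(\<lambda>z. exp (- P (fst z) (snd z))) ` ({0..l} \<times> {0..1}). \<bar>z\<bar> \<le> B0"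
    using compact_imp_bounded[OF compact_continuous_image[OF Ec comp]] unfolding bounded_real by blast
  then have B: "exp (- P \<xi> t) \<le> \<bar>B0\<bar>" if "\<xi> \<in> {0..l}" "t \<in> {0..1}" for \<xi> t
    using that by force
  show ?thesis
  proof (rule tendstoI)
    fix r :: real assume r: "r > 0"
    \<comment> \<open>Adding 1 keeps the divisor positive when the datum has norm zero.\<close>
    define r1 where "r1 = r / 2 / (nrm l (\<lambda>\<xi>. u \<xi> 0) + 1)"
    have n0: "nrm l (\<lambda>\<xi>. u \<xi> 0) + 1 > 0" using nrm_nonneg[of l "\<lambda>\<xi>. u \<xi> 0"] by simp
    have r1: "r1 > 0" using r n0 by (simp add: r1_def)
    have "r / 2 / (\<bar>B0\<bar> + 1) > 0" using r by simp
    from tendstoD[OF ulim this]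
    have ev1: "\<forall>\<^sub>F t in at_right 0. nrm l (\<lambda>\<xi>. u \<xi> t - u \<xi> 0) < r / 2 / (\<bar>B0\<bar> + 1)"
      by (simp add: nrm_nonneg)
    from compact_uniformly_continuous[OF Ec comp] r1
    obtain d where d: "d > 0" "\<And>z z'. z \<in> {0..l} \<times> {0..1} \<Longrightarrow> z' \<in> {0..l} \<times> {0..1} \<Longrightarrow> dist z' z < d \<Longrightarrow>
       dist (exp (- P (fst z') (snd z'))) (exp (- P (fst z) (snd z))) < r1"
      unfolding uniformly_continuous_on_def by metis
    have "\<forall>\<^sub>F t in at_right (0::real). t < min d 1" "\<forall>\<^sub>F t in at_right (0::real). 0 < t"
      using d(1) by (auto simp: eventually_at_right_less intro: eventually_at_right_real eventually_at_rightI[of 0 "min d 1"])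
    with ev1 show "\<forall>\<^sub>F t in at_right 0. dist (nrm l (\<lambda>\<xi>. w \<xi> t - w \<xi> 0)) 0 < r"
    proof eventually_elim
      case (elim t)
      have t: "0 < t" "t < d" "t \<in> {0..1}" using elim by auto
      have uL: "L2_on {0..l} (\<lambda>\<xi>. u \<xi> t - u \<xi> 0)"
        by (intro L2_on_diff L2_on_continuous u_cont_fixed t u0_L2)
      have Pc: "continuous_on {0..l} (\<lambda>\<xi>. exp (- P \<xi> t))" "continuous_on {0..l} (\<lambda>\<xi>. exp (- P \<xi> t) - exp (- P \<xi> 0))"
        using t by (auto intro!: continuous_intros P_cont_fixed)
      note L1 = L2_on_mult_continuous[OF uL Pc(1)] and L2 = L2_on_mult_continuous[OF u0_L2 Pc(2)]
      have "nrm l (\<lambda>\<xi>. w \<xi> t - w \<xi> 0) = nrm l (\<lambda>\<xi>. exp (- P \<xi> t) * (u \<xi> t - u \<xi> 0) + (exp (- P \<xi> t) - exp (- P \<xi> 0)) * u \<xi> 0)"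
        by (rule nrm_cong) (simp add: w_def algebra_simps)
      also have "\<dots> \<le> nrm l (\<lambda>\<xi>. exp (- P \<xi> t) * (u \<xi> t - u \<xi> 0)) + nrm l (\<lambda>\<xi>. (exp (- P \<xi> t) - exp (- P \<xi> 0)) * u \<xi> 0)"
        by (rule nrm_triangle[OF L1 L2])
      also have "nrm l (\<lambda>\<xi>. exp (- P \<xi> t) * (u \<xi> t - u \<xi> 0)) \<le> \<bar>B0\<bar> * nrm l (\<lambda>\<xi>. u \<xi> t - u \<xi> 0)"
        by (rule nrm_le_bound[OF L1]) (use l_pos uL B t in \<open>auto simp: abs_mult intro!: mult_right_mono\<close>)
      also have "\<dots> \<le> (\<bar>B0\<bar> + 1) * nrm l (\<lambda>\<xi>. u \<xi> t - u \<xi> 0)"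
        by (intro mult_right_mono nrm_nonneg) simp
      also have "\<dots> < r / 2" using elim(1) by (simp add: field_simps)
      also have "nrm l (\<lambda>\<xi>. (exp (- P \<xi> t) - exp (- P \<xi> 0)) * u \<xi> 0) \<le> r1 * nrm l (\<lambda>\<xi>. u \<xi> 0)"
      proof (rule nrm_le_bound[OF L2])
        fix \<xi> assume "\<xi> \<in> {0..l}"
        then have "\<bar>exp (- P \<xi> t) - exp (- P \<xi> 0)\<bar> < r1"
          using d(2)[of "(\<xi>, 0)" "(\<xi>, t)"] t by (simp add: dist_Pair_Pair dist_real_def)
        then show "\<bar>(exp (- P \<xi> t) - exp (- P \<xi> 0)) * u \<xi> 0\<bar> \<le> r1 * \<bar>u \<xi> 0\<bar>"
          by (simp add: abs_mult mult_right_mono)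
      qed (use l_pos u0_L2 r1 in auto)
      also have "r1 * nrm l (\<lambda>\<xi>. u \<xi> 0) \<le> r1 * (nrm l (\<lambda>\<xi>. u \<xi> 0) + 1)" using r1 by simp
      also have "\<dots> = r / 2" using n0 r1_def by (metis less_irrefl nonzero_eq_divide_eq)
      finally show ?case by (simp add: nrm_nonneg)
    qed
  qed
qed

section \<open>The mode series and the passage to the initial time\<close>

lemma mode_eq:
  assumes "t \<ge> 0"
  shows "mode D f0 A' L L' \<mu> h \<xi> t = exp (\<mu> * s t) * h \<xi> * exp (P \<xi> t)"
proof -
  have "(l / L t) powr (1/2) = exp ((ln l - ln (L t)) / 2)"
    using l_pos L_pos[OF assms] by (simp add: powr_def ln_div)
  moreover have "s t = integral {0..t} (\<lambda>\<zeta>. l\<^sup>2 / (L \<zeta>)\<^sup>2)" by (simp add: s_def a_def[abs_def])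
  ultimately show ?thesis
    unfolding mode_def P_def I_def by (simp add: exp_add[symmetric] mult.assoc)
qed

text \<open>A summable majorant uniform in \<xi> and in the elapsed time \<open>z\<close>, provided
  \<open>z\<close> stays away from 0: writing \<open>\<sigma> n = \<kappa> - lam n\<close>, the
  decay in \<open>lam n\<close> beats the growth of \<open>e n\<close>. Uniformity in
  \<open>z\<close> is needed because the starting times vary.\<close>

lemma eigen_term_bound:
  assumes "r > 0" "r \<le> R"
  obtains K where "\<And>(\<beta>::real) z n \<xi> B. \<bar>\<beta>\<bar> \<le> B \<Longrightarrow> r \<le> z \<Longrightarrow> z \<le> R \<Longrightarrow> \<xi> \<in> {0..l} \<Longrightarrow>
    \<bar>\<beta> * exp (\<sigma> n * z) * e n \<xi>\<bar> \<le> B * K * (1 / (lam n)\<^sup>2)"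
proof -
  obtain C where C: "C \<ge> 0" "\<And>n x. x \<in> {0..l} \<Longrightarrow> \<bar>e n x\<bar> \<le> C * lam n" using eb.e_bound by blast
  define K where "K = exp (\<bar>\<kappa>\<bar> * R) * (27 / r ^ 3) * C"
  show ?thesis
  proof (rule that[of K])
    fix \<beta> z B :: real and n \<xi> assume \<beta>: "\<bar>\<beta>\<bar> \<le> B" and z: "r \<le> z" "z \<le> R" and \<xi>: "\<xi> \<in> {0..l}"
    have lp: "lam n > 0" by (rule eb.lam_pos)
    have "exp (\<sigma> n * z) = exp (\<kappa> * z) * exp (- lam n * z)"
      unfolding exp_add[symmetric] lam_def by (simp add: algebra_simps)
    also have "\<dots> \<le> exp (\<bar>\<kappa>\<bar> * R) * exp (- lam n * r)"
    proof (intro mult_mono)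
      have "\<kappa> * z \<le> \<bar>\<kappa>\<bar> * z" using z assms by (intro mult_right_mono) auto
      also have "\<dots> \<le> \<bar>\<kappa>\<bar> * R" using z by (intro mult_left_mono) auto
      finally show "exp (\<kappa> * z) \<le> exp (\<bar>\<kappa>\<bar> * R)" by simp
    qed (use lp z in auto)
    finally have "exp (\<sigma> n * z) * \<bar>e n \<xi>\<bar> \<le> exp (\<bar>\<kappa>\<bar> * R) * exp (- lam n * r) * (C * lam n)"
      by (intro mult_mono C \<xi>) auto
    also have "\<dots> = exp (\<bar>\<kappa>\<bar> * R) * (lam n ^ 3 * exp (- lam n * r)) * C * (1 / (lam n)\<^sup>2)"
      using lp by (simp add: power3_eq_cube power2_eq_square)
    also have "\<dots> \<le> exp (\<bar>\<kappa>\<bar> * R) * (27 / r ^ 3) * C * (1 / (lam n)\<^sup>2)"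
      using C(1) by (intro mult_right_mono mult_left_mono cube_exp_bound[OF lp assms(1)]) auto
    finally have key: "exp (\<sigma> n * z) * \<bar>e n \<xi>\<bar> \<le> K * (1 / (lam n)\<^sup>2)" by (simp add: K_def)
    have "\<bar>\<beta>\<bar> * (exp (\<sigma> n * z) * \<bar>e n \<xi>\<bar>) \<le> B * (K * (1 / (lam n)\<^sup>2))"
      by (rule mult_mono[OF \<beta> key]) (use \<beta> in auto)
    then show "\<bar>\<beta> * exp (\<sigma> n * z) * e n \<xi>\<bar> \<le> B * K * (1 / (lam n)\<^sup>2)"
      by (simp add: abs_mult mult.assoc)
  qed
qed

definition "c0 n = ip l (\<lambda>\<xi>. w \<xi> 0) (e n)"

lemma c0_bound: "\<bar>c0 n\<bar> \<le> nrm l (\<lambda>\<xi>. w \<xi> 0)"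
  unfolding c0_def using ip_Cauchy_Schwarz[OF w_L2[of 0] eb.e_L2[of n]] by (simp add: eb.e_norm)

lemma summable_expansion:
  assumes "t > 0" "\<xi> \<in> {0..l}"
  shows "summable (\<lambda>n. c0 n * exp (\<sigma> n * s t) * e n \<xi>)"
proof -
  have st: "s t > 0" using s_strict[of 0 t] s_0 assms by simp
  obtain K where K: "\<And>(\<beta>::real) z n \<xi> B. \<bar>\<beta>\<bar> \<le> B \<Longrightarrow> s t \<le> z \<Longrightarrow> z \<le> s t \<Longrightarrow> \<xi> \<in> {0..l} \<Longrightarrow>
    \<bar>\<beta> * exp (\<sigma> n * z) * e n \<xi>\<bar> \<le> B * K * (1 / (lam n)\<^sup>2)"
    using eigen_term_bound[OF st order_refl] by blast
  show ?thesis
    by (rule summable_comparison_test'[OF summable_mult[OF eb.summable_lam]])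
      (use K[OF c0_bound order_refl order_refl assms(2)] in simp)
qed

text \<open>The finite comparison is applied at starting times tending to 0 with uniform errors
  tending to 0. Tannery's theorem moves the limit inside the series, and the error term vanishes
  because its exponential factor stays bounded.\<close>

lemma expansion_bound:
  assumes \<epsilon>: "\<epsilon> * \<epsilon> = 1" and sgn: "\<And>\<xi> t. \<xi> \<in> {0<..<l} \<Longrightarrow> t > 0 \<Longrightarrow> \<epsilon> * (q \<xi> t - Q \<xi>) \<le> 0"
    and t: "t > 0" and \<xi>: "\<xi> \<in> {0..l}"
  shows "\<epsilon> * (w \<xi> t - (\<Sum>n. c0 n * exp (\<sigma> n * s t) * e n \<xi>)) \<le> 0"
proof -
  \<comment> \<open>The single tolerance \<open>1 / real (Suc j)\<close> controls the starting time,
    the L2 distance to the datum and the uniform error of the combination.\<close>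
  define R where "R j \<tau> N b \<longleftrightarrow> 0 < \<tau> \<and> \<tau> < 1 / real (Suc j) \<and> nrm l (\<lambda>\<xi>. w \<xi> \<tau> - w \<xi> 0) < 1 / real (Suc j) \<and>
      (\<forall>\<xi>\<in>{0..l}. \<bar>w \<xi> \<tau> - (\<Sum>n<N. b n * e n \<xi>)\<bar> < 1 / real (Suc j))" for j \<tau> N b
  have "\<exists>\<tau> N b. R j \<tau> N b" for j
  proof -
    have p: "1 / real (Suc j) > 0" by simp
    have "\<forall>\<^sub>F t in at_right 0. nrm l (\<lambda>\<xi>. w \<xi> t - w \<xi> 0) < 1 / real (Suc j)"
      using tendstoD[OF w_initial p] by (simp add: nrm_nonneg)
    moreover have "\<forall>\<^sub>F t in at_right 0. t \<in> {0<..<1 / real (Suc j)}"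
      by (rule eventually_at_right_real) simp
    ultimately have "\<forall>\<^sub>F t in at_right 0. nrm l (\<lambda>\<xi>. w \<xi> t - w \<xi> 0) < 1 / real (Suc j) \<and> t \<in> {0<..<1 / real (Suc j)}"
      by (rule eventually_conj)
    then obtain \<tau> where \<tau>: "nrm l (\<lambda>\<xi>. w \<xi> \<tau> - w \<xi> 0) < 1 / real (Suc j)" "\<tau> \<in> {0<..<1 / real (Suc j)}"
      using eventually_happens' trivial_limit_at_right_real by blast
    then have "\<tau> > 0" by simp
    have "w 0 \<tau> = 0" "w l \<tau> = 0" using u_bc \<open>\<tau> > 0\<close> by (simp_all add: w_def)
    from eb.span_dense[OF w_cont_fixed[OF \<open>\<tau> > 0\<close>] this p] \<tau> show ?thesis unfolding R_def by auto
  qed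
  then obtain \<tau> N b where R: "\<And>j. R j (\<tau> j) (N j) (b j)" by metis
  then have \<tau>0: "\<And>j. 0 < \<tau> j" and \<tau>1: "\<And>j. \<tau> j < 1 / real (Suc j)"
    and \<tau>n: "\<And>j. nrm l (\<lambda>\<xi>. w \<xi> (\<tau> j) - w \<xi> 0) < 1 / real (Suc j)"
    and Nb: "\<And>j \<xi>. \<xi> \<in> {0..l} \<Longrightarrow> \<bar>w \<xi> (\<tau> j) - (\<Sum>n<N j. b j n * e n \<xi>)\<bar> < 1 / real (Suc j)"
    unfolding R_def by blast+
  have inv: "(\<lambda>j. 1 / real (Suc j)) \<longlonglongrightarrow> 0"
    using LIMSEQ_inverse_real_of_nat by (simp add: inverse_eq_divide)
  have \<tau>lim: "\<tau> \<longlonglongrightarrow> 0"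
    by (rule Lim_null_comparison[OF _ inv]) (use \<tau>0 \<tau>1 in \<open>auto intro!: always_eventually less_imp_le simp: abs_of_pos\<close>)
  define \<phi> where "\<phi> j \<xi> = (\<Sum>n<N j. b j n * e n \<xi>)" for j \<xi>
  \<comment> \<open>Reading the coefficients as inner products of \<phi> with the eigenfunctions
    extends them by zero beyond \<open>N j\<close> and makes their convergence to
    \<open>c0 n\<close> a consequence of L2 convergence alone.\<close>
  define bb where "bb j n = ip l (\<phi> j) (e n)" for j n
  have bb: "bb j n = (if n < N j then b j n else 0)" for j n
    unfolding bb_def \<phi>_def[abs_def] by (rule eb.ip_lincomb)
  have \<phi>L: "L2_on {0..l} (\<phi> j)" for j unfolding \<phi>_def[abs_def] by (rule eb.L2_lincomb)
  have wL: "L2_on {0..l} (\<lambda>\<xi>. w \<xi> (\<tau> j))" for j using w_L2 \<tau>0[of j] by simp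
  have w0L: "L2_on {0..l} (\<lambda>\<xi>. w \<xi> 0)" using w_L2 by simp
  have \<phi>n: "nrm l (\<lambda>\<xi>. \<phi> j \<xi> - w \<xi> 0) \<le> 1 / real (Suc j) * (sqrt l + 1)" for j
  proof -
    have "nrm l (\<lambda>\<xi>. \<phi> j \<xi> - w \<xi> (\<tau> j)) \<le> 1 / real (Suc j) * sqrt l"
    proof (rule nrm_le_sup)
      show "\<bar>\<phi> j x - w x (\<tau> j)\<bar> \<le> 1 / real (Suc j)" if "x \<in> {0..l}" for x
        using Nb[OF that, of j] unfolding \<phi>_def by (simp add: abs_minus_commute)
    qed (use l_pos \<phi>L wL in \<open>auto intro: L2_on_diff\<close>)
    then have "nrm l (\<lambda>\<xi>. \<phi> j \<xi> - w \<xi> 0) \<le> 1 / real (Suc j) * sqrt l + 1 / real (Suc j)"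
      using nrm_triangle_diff[OF \<phi>L[of j] wL[of j] w0L] \<tau>n[of j] by linarith
    then show ?thesis by (simp only: distrib_left mult_1_right)
  qed
  have \<phi>lim: "(\<lambda>j. nrm l (\<lambda>\<xi>. \<phi> j \<xi> - w \<xi> 0)) \<longlonglongrightarrow> 0"
  proof (rule Lim_null_comparison)
    show "\<forall>\<^sub>F j in sequentially. norm (nrm l (\<lambda>\<xi>. \<phi> j \<xi> - w \<xi> 0)) \<le> 1 / real (Suc j) * (sqrt l + 1)"
      using \<phi>n by (simp add: nrm_nonneg)
    show "(\<lambda>j. 1 / real (Suc j) * (sqrt l + 1)) \<longlonglongrightarrow> 0"
      using tendsto_mult_right[OF inv, of "sqrt l + 1"] by simp
  qed
  have bblim: "(\<lambda>j. bb j n) \<longlonglongrightarrow> c0 n" for n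
    unfolding bb_def c0_def by (rule ip_tendsto[OF \<phi>L w0L eb.e_L2 \<phi>lim])
  define B where "B = nrm l (\<lambda>\<xi>. w \<xi> 0) + (sqrt l + 1)"
  have bbB: "\<bar>bb j n\<bar> \<le> B" for j n
  proof -
    have "\<bar>bb j n\<bar> \<le> nrm l (\<phi> j)"
      unfolding bb_def using ip_Cauchy_Schwarz[OF \<phi>L[of j] eb.e_L2[of n]] by (simp add: eb.e_norm)
    also have "\<dots> \<le> nrm l (\<lambda>\<xi>. \<phi> j \<xi> - w \<xi> 0) + nrm l (\<lambda>\<xi>. w \<xi> 0)"
      by (rule nrm_le_diff[OF \<phi>L w0L])
    also have "1 / real (Suc j) * (sqrt l + 1) \<le> 1 * (sqrt l + 1)"
      using l_pos by (intro mult_right_mono) auto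
    from order_trans[OF \<phi>n[of j] this] have "nrm l (\<lambda>\<xi>. \<phi> j \<xi> - w \<xi> 0) \<le> sqrt l + 1" by simp
    finally show ?thesis by (simp add: B_def)
  qed
  have st: "s t > 0" using s_strict[of 0 t] s_0 t by simp
  have slim: "(\<lambda>j. s (\<tau> j)) \<longlonglongrightarrow> 0"
  proof -
    have "(\<lambda>j. s (\<tau> j)) \<longlonglongrightarrow> s 0"
    proof (rule continuous_on_tendsto_compose[OF s_cont[of 1] \<tau>lim])
      have "\<tau> j \<le> 1" for j using order.strict_trans2[OF \<tau>1[of j], of 1] by simp
      then show "\<forall>\<^sub>F j in sequentially. \<tau> j \<in> {0..1}" using \<tau>0 by (simp add: less_imp_le)
    qed simp
    then show ?thesis by (simp add: s_0)
  qed
  \<comment> \<open>Then the elapsed time \<open>s t - s (\<tau> j)\<close> lies between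
    \<open>s t / 2\<close> and \<open>s t\<close>, where the uniform majorant applies.\<close>
  have ev_s: "\<forall>\<^sub>F j in sequentially. s (\<tau> j) < s t / 2"
    using order_tendstoD(2)[OF slim, of "s t / 2"] st by simp
  have ev_t: "\<forall>\<^sub>F j in sequentially. \<tau> j < t"
    using order_tendstoD(2)[OF \<tau>lim t] by simp
  have spos: "s (\<tau> j) > 0" for j using s_strict[of 0 "\<tau> j"] \<tau>0 s_0 by simp
  obtain K where K: "\<And>(\<beta>::real) z n \<xi> B. \<bar>\<beta>\<bar> \<le> B \<Longrightarrow> s t / 2 \<le> z \<Longrightarrow> z \<le> s t \<Longrightarrow> \<xi> \<in> {0..l} \<Longrightarrow>
    \<bar>\<beta> * exp (\<sigma> n * z) * e n \<xi>\<bar> \<le> B * K * (1 / (lam n)\<^sup>2)"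
    using eigen_term_bound[of "s t / 2" "s t"] st by auto
  have "(\<lambda>j. \<Sum>n. bb j n * exp (\<sigma> n * (s t - s (\<tau> j))) * e n \<xi>) \<longlonglongrightarrow> (\<Sum>n. c0 n * exp (\<sigma> n * s t) * e n \<xi>)"
  proof (rule conjunct2[OF conjunct2[OF tannerys_theorem]])
    show "(\<lambda>j. bb j n * exp (\<sigma> n * (s t - s (\<tau> j))) * e n \<xi>) \<longlonglongrightarrow> c0 n * exp (\<sigma> n * s t) * e n \<xi>" for n
    proof -
      have "(\<lambda>j. bb j n * exp (\<sigma> n * (s t - s (\<tau> j))) * e n \<xi>) \<longlonglongrightarrow> c0 n * exp (\<sigma> n * (s t - 0)) * e n \<xi>"
        by (intro tendsto_intros bblim slim)
      then show ?thesis by simp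
    qed
    have "\<forall>\<^sub>F j in sequentially. \<forall>n. norm (bb j n * exp (\<sigma> n * (s t - s (\<tau> j))) * e n \<xi>) \<le> B * K * (1 / (lam n)\<^sup>2)"
      using ev_s
    proof eventually_elim
      case (elim j)
      show ?case
      proof
        fix n
        show "norm (bb j n * exp (\<sigma> n * (s t - s (\<tau> j))) * e n \<xi>) \<le> B * K * (1 / (lam n)\<^sup>2)"
          unfolding real_norm_def by (rule K[OF bbB _ _ \<xi>]) (use elim spos[of j] in auto)
      qed
    qed
    then show "\<forall>\<^sub>F (n, j) in at_top \<times>\<^sub>F sequentially. norm (bb j n * exp (\<sigma> n * (s t - s (\<tau> j))) * e n \<xi>) \<le> B * K * (1 / (lam n)\<^sup>2)"
      unfolding eventually_prod_filter split_beta
      by (intro exI[of _ "\<lambda>n. True"] exI[of _ "\<lambda>j. \<forall>n. norm (bb j n * exp (\<sigma> n * (s t - s (\<tau> j))) * e n \<xi>) \<le> B * K * (1 / (lam n)\<^sup>2)"]) auto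
    show "summable (\<lambda>n. B * K * (1 / (lam n)\<^sup>2))" by (intro summable_mult eb.summable_lam)
  qed simp
  then have lim1: "(\<lambda>j. \<epsilon> * (w \<xi> t - (\<Sum>n. bb j n * exp (\<sigma> n * (s t - s (\<tau> j))) * e n \<xi>)))
      \<longlonglongrightarrow> \<epsilon> * (w \<xi> t - (\<Sum>n. c0 n * exp (\<sigma> n * s t) * e n \<xi>))"
    by (intro tendsto_intros)
  have "(\<lambda>j. 1 / real (Suc j) * exp (\<kappa> * (s t - s (\<tau> j)))) \<longlonglongrightarrow> 0 * exp (\<kappa> * (s t - 0))"
    by (intro tendsto_intros inv slim)
  then have lim2: "(\<lambda>j. 1 / real (Suc j) * exp (\<kappa> * (s t - s (\<tau> j)))) \<longlonglongrightarrow> 0" by simp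
  show ?thesis
  proof (rule tendsto_le[OF _ lim2 lim1])
    show "\<forall>\<^sub>F j in sequentially. \<epsilon> * (w \<xi> t - (\<Sum>n. bb j n * exp (\<sigma> n * (s t - s (\<tau> j))) * e n \<xi>))
       \<le> 1 / real (Suc j) * exp (\<kappa> * (s t - s (\<tau> j)))"
      using ev_t
    proof eventually_elim
      case (elim j)
      have "(\<Sum>n. bb j n * exp (\<sigma> n * (s t - s (\<tau> j))) * e n \<xi>) = (\<Sum>n<N j. bb j n * exp (\<sigma> n * (s t - s (\<tau> j))) * e n \<xi>)"
        by (rule suminf_finite) (auto simp: bb)
      also have "\<dots> = (\<Sum>n<N j. b j n * exp (\<sigma> n * (s t - s (\<tau> j))) * e n \<xi>)"
        by (rule sum.cong) (auto simp: bb)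
      finally show ?case
        using comparison[where \<delta> = "1 / real (Suc j)" and N = "N j" and b = "b j",
            OF \<epsilon> sgn \<tau>0[of j] less_imp_le[OF elim] _ less_imp_le[OF Nb] \<xi>] by simp
    qed
  qed simp
qed

text \<open>Dividing \<open>c0 n\<close> by the norm of \<open>g n\<close> undoes the normalisation,
  so no scaling of the given eigenfunctions has to be fixed.\<close>

lemma expansion_bound_mode:
  assumes \<epsilon>: "\<epsilon> * \<epsilon> = 1" and sgn: "\<And>\<xi> t. \<xi> \<in> {0<..<l} \<Longrightarrow> t > 0 \<Longrightarrow> \<epsilon> * (q \<xi> t - Q \<xi>) \<le> 0"
  shows "\<exists>c. expansion_of_initial l (\<lambda>n. mode D f0 A' L L' (\<sigma> n) (g n)) u c \<and>
    (\<forall>t>0. \<forall>\<xi>\<in>{0..l}. \<epsilon> * (u \<xi> t - (\<Sum>n. c n * mode D f0 A' L L' (\<sigma> n) (g n) \<xi> t)) \<le> 0)"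
proof (intro exI[of _ "\<lambda>n. c0 n / nrm l (g n)"] conjI allI impI ballI)
  have term_eq: "c0 n / nrm l (g n) * mode D f0 A' L L' (\<sigma> n) (g n) \<xi> t
      = exp (P \<xi> t) * (c0 n * exp (\<sigma> n * s t) * e n \<xi>)" if "t \<ge> 0" for n \<xi> t
    unfolding mode_eq[OF that] by (simp add: e_def)
  show "expansion_of_initial l (\<lambda>n. mode D f0 A' L L' (\<sigma> n) (g n)) u (\<lambda>n. c0 n / nrm l (g n))"
    unfolding expansion_of_initial_def
  proof (intro conjI allI impI ballI)
    show "summable (\<lambda>n. c0 n / nrm l (g n) * mode D f0 A' L L' (\<sigma> n) (g n) \<xi> t)"
      if "0 < t" "\<xi> \<in> {0..l}" for t \<xi>
      using summable_mult[OF summable_expansion[OF that], of "exp (P \<xi> t)"]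
      by (simp only: term_eq[OF less_imp_le[OF that(1)]])
    have "continuous_on {0..l} (\<lambda>\<xi>. exp (P \<xi> 0))" by (intro continuous_intros P_cont_fixed) simp
    then obtain B where B: "0 \<le> B" "\<And>\<xi>. \<xi> \<in> {0..l} \<Longrightarrow> \<bar>exp (P \<xi> 0)\<bar> \<le> B"
      using continuous_on_Icc_abs_bound by blast
    \<comment> \<open>Orthogonality belongs to the expansion of \<open>w\<close>, not of
      \<open>u\<close>. At time 0 the mode series is the former times the bounded factor
      \<open>exp (P \<xi> 0)\<close>, so L2 convergence carries over.\<close>
    define S where "S N \<xi> = (\<Sum>n<N. c0 n * e n \<xi>)" for N \<xi>
    have w0: "L2_on {0..l} (\<lambda>\<xi>. w \<xi> 0)" using w_L2 by simp
    have SL: "L2_on {0..l} (S N)" for N unfolding S_def[abs_def] by (rule eb.L2_lincomb)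
    have Slim: "(\<lambda>N. nrm l (\<lambda>\<xi>. w \<xi> 0 - S N \<xi>)) \<longlonglongrightarrow> 0"
      unfolding S_def c0_def
    proof (rule eb.eigen_expansion_L2[OF w0])
      \<comment> \<open>The datum need not be continuous or vanish at the ends, but \<open>w\<close>
        at a small positive time does both and is close to it in L2.\<close>
      fix r :: real assume r: "r > 0"
      have "\<forall>\<^sub>F t in at_right 0. nrm l (\<lambda>\<xi>. w \<xi> t - w \<xi> 0) < r"
        using tendstoD[OF w_initial r] by (simp add: nrm_nonneg)
      moreover have "\<forall>\<^sub>F t in at_right (0::real). t \<in> {0<..<1}"
        by (rule eventually_at_right_real) simp
      ultimately have "\<forall>\<^sub>F t in at_right 0. nrm l (\<lambda>\<xi>. w \<xi> t - w \<xi> 0) < r \<and> t \<in> {0<..<1}"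
        by (rule eventually_conj)
      then obtain t where t: "nrm l (\<lambda>\<xi>. w \<xi> t - w \<xi> 0) < r" "t \<in> {0<..<1}"
        using eventually_happens' trivial_limit_at_right_real by blast
      then show "\<exists>q. continuous_on {0..l} q \<and> q 0 = 0 \<and> q l = 0 \<and> nrm l (\<lambda>x. w x 0 - q x) < r"
        using w_cont_fixed[of t] u_bc[of t] nrm_diff_commute[of l "\<lambda>\<xi>. w \<xi> t"]
        by (intro exI[of _ "\<lambda>\<xi>. w \<xi> t"]) (auto simp: w_def)
    qed
    have eq: "(\<Sum>n<N. c0 n / nrm l (g n) * mode D f0 A' L L' (\<sigma> n) (g n) \<xi> 0) = exp (P \<xi> 0) * S N \<xi>" for N \<xi>
      unfolding S_def sum_distrib_left by (rule sum.cong[OF refl], subst term_eq[OF order_refl]) (simp add: s_0)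
    have "nrm l (\<lambda>\<xi>. exp (P \<xi> 0) * S N \<xi> - u \<xi> 0) \<le> B * nrm l (\<lambda>\<xi>. w \<xi> 0 - S N \<xi>)" for N
    proof (rule nrm_le_bound)
      show "L2_on {0..l} (\<lambda>\<xi>. exp (P \<xi> 0) * S N \<xi> - u \<xi> 0)"
        by (intro L2_on_diff L2_on_mult_continuous SL u0_L2 continuous_intros P_cont_fixed) simp
      show "L2_on {0..l} (\<lambda>\<xi>. w \<xi> 0 - S N \<xi>)" by (intro L2_on_diff w0 SL)
      fix \<xi> assume \<xi>: "\<xi> \<in> {0..l}"
      have "exp (P \<xi> 0) * S N \<xi> - u \<xi> 0 = exp (P \<xi> 0) * (S N \<xi> - w \<xi> 0)"
        by (simp add: w_def right_diff_distrib exp_minus)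
      then show "\<bar>exp (P \<xi> 0) * S N \<xi> - u \<xi> 0\<bar> \<le> B * \<bar>w \<xi> 0 - S N \<xi>\<bar>"
        using B(2)[OF \<xi>] by (simp add: abs_mult abs_minus_commute mult_right_mono)
    qed (use l_pos B in auto)
    then have "\<forall>\<^sub>F N in sequentially. norm (nrm l (\<lambda>\<xi>. exp (P \<xi> 0) * S N \<xi> - u \<xi> 0)) \<le> B * nrm l (\<lambda>\<xi>. w \<xi> 0 - S N \<xi>)"
      by (simp add: nrm_nonneg)
    then have "(\<lambda>N. nrm l (\<lambda>\<xi>. exp (P \<xi> 0) * S N \<xi> - u \<xi> 0)) \<longlonglongrightarrow> 0"
      by (rule Lim_null_comparison) (use tendsto_mult_left[OF Slim, of B] in simp)
    then have "(\<lambda>N. (nrm l (\<lambda>\<xi>. exp (P \<xi> 0) * S N \<xi> - u \<xi> 0))\<^sup>2) \<longlonglongrightarrow> 0\<^sup>2"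
      by (intro tendsto_intros)
    then show "(\<lambda>N. L2_dist_sq {0..l} (\<lambda>\<xi>. \<Sum>n<N. c0 n / nrm l (g n) * mode D f0 A' L L' (\<sigma> n) (g n) \<xi> 0) (\<lambda>\<xi>. u \<xi> 0)) \<longlonglongrightarrow> 0"
      unfolding eq L2_dist_sq_eq_nrm by simp
  qed
  fix t \<xi> :: real assume t: "0 < t" and \<xi>: "\<xi> \<in> {0..l}"
  have "(\<Sum>n. c0 n / nrm l (g n) * mode D f0 A' L L' (\<sigma> n) (g n) \<xi> t)
      = exp (P \<xi> t) * (\<Sum>n. c0 n * exp (\<sigma> n * s t) * e n \<xi>)"
    using suminf_mult[OF summable_expansion[OF t \<xi>], of "exp (P \<xi> t)"]
    by (simp only: term_eq[OF less_imp_le[OF t]])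
  moreover have "u \<xi> t = exp (P \<xi> t) * w \<xi> t" by (simp add: w_def exp_minus)
  ultimately have "\<epsilon> * (u \<xi> t - (\<Sum>n. c0 n / nrm l (g n) * mode D f0 A' L L' (\<sigma> n) (g n) \<xi> t))
      = exp (P \<xi> t) * (\<epsilon> * (w \<xi> t - (\<Sum>n. c0 n * exp (\<sigma> n * s t) * e n \<xi>)))"
    by (simp add: algebra_simps)
  also have "\<dots> \<le> 0"
    using expansion_bound[OF \<epsilon> sgn t \<xi>] by (simp add: mult_le_0_iff)
  finally show "\<epsilon> * (u \<xi> t - (\<Sum>n. c0 n / nrm l (g n) * mode D f0 A' L L' (\<sigma> n) (g n) \<xi> t)) \<le> 0" .
qed

end

lemma (in moving_domain) shift_exists: "\<exists>\<kappa>. \<forall>\<xi>\<in>{0..l}. Q \<xi> < \<kappa>"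
proof -
  have "continuous_on {0..l} Q"
    unfolding Q_def[abs_def] using D_pos l_pos by (intro continuous_intros) auto
  then obtain B where "\<And>\<xi>. \<xi> \<in> {0..l} \<Longrightarrow> \<bar>Q \<xi>\<bar> \<le> B" using continuous_on_Icc_abs_bound by blast
  then have "\<forall>\<xi>\<in>{0..l}. Q \<xi> < B + 1" by fastforce
  then show ?thesis by blast
qed

lemma (in moving_domain) q_Q_sign:
  assumes "\<And>t. t > 0 \<Longrightarrow> \<epsilon> * (L'' t * L t ^ 3 - \<gamma>0) \<le> 0" "\<And>t. t > 0 \<Longrightarrow> \<epsilon> * (A'' t * L t ^ 3 - \<gamma>1) \<le> 0"
    and "\<xi> \<in> {0<..<l}" "t > 0"
  shows "\<epsilon> * (q \<xi> t - Q \<xi>) \<le> 0"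
proof -
  have "\<epsilon> * (q \<xi> t - Q \<xi>) = \<epsilon> * (L'' t * L t ^ 3 - \<gamma>0) * (\<xi>\<^sup>2 / (4 * D * l ^ 4))
      + \<epsilon> * (A'' t * L t ^ 3 - \<gamma>1) * (\<xi> / (2 * D * l ^ 3))"
    unfolding q_def Q_def by (simp add: algebra_simps diff_divide_distrib)
  also have "\<dots> \<le> 0"
    by (rule add_nonpos_nonpos[OF mult_nonpos_nonneg[OF assms(1)] mult_nonpos_nonneg[OF assms(2)]])
      (use assms(3,4) D_pos l_pos in auto)
  finally show ?thesis .
qed

theorem proposition2p2:
  fixes D f0 \<gamma>0 \<gamma>1 :: real
    and A A' A'' L L' L'' :: "real \<Rightarrow> real"
    and u :: "real \<Rightarrow> real \<Rightarrow> real"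
    and \<sigma> :: "nat \<Rightarrow> real" and g :: "nat \<Rightarrow> real \<Rightarrow> real"
  assumes "D > 0" and "f0 > 0"
    and "C2_halfline A A' A''" and "C2_halfline L L' L''"
    and "\<And>t. t \<ge> 0 \<Longrightarrow> L t > 0"
    and "L2_on {0..L 0} (\<lambda>\<xi>. u \<xi> 0)"
    and "transformed_solution D f0 A' L L' u"
    and "SL_eigensystem D (L 0) \<gamma>0 \<gamma>1 \<sigma> g"
  defines "v \<equiv> (\<lambda>n. mode D f0 A' L L' (\<sigma> n) (g n))"
  shows "((\<forall>t\<ge>0. L'' t * L t ^ 3 \<le> \<gamma>0) \<and> (\<forall>t\<ge>0. A'' t * L t ^ 3 \<le> \<gamma>1) \<longrightarrow>
           (\<exists>c. expansion_of_initial (L 0) v u c \<and>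
                (\<forall>t>0. \<forall>\<xi>\<in>{0..L 0}. u \<xi> t \<le> (\<Sum>n. c n * v n \<xi> t)))) \<and>
         ((\<forall>t\<ge>0. L'' t * L t ^ 3 \<ge> \<gamma>0) \<and> (\<forall>t\<ge>0. A'' t * L t ^ 3 \<ge> \<gamma>1) \<longrightarrow>
           (\<exists>c. expansion_of_initial (L 0) v u c \<and>
                (\<forall>t>0. \<forall>\<xi>\<in>{0..L 0}. u \<xi> t \<ge> (\<Sum>n. c n * v n \<xi> t))))"
proof -
  interpret moving_domain D f0 \<gamma>0 \<gamma>1 A A' A'' L L' L'' u \<sigma> g
    by unfold_locales (use assms in auto)
  obtain \<kappa> where "\<forall>\<xi>\<in>{0..L 0}. Q \<xi> < \<kappa>" using shift_exists by blast
  then interpret moving_domain_shift D f0 \<gamma>0 \<gamma>1 A A' A'' L L' L'' u \<sigma> g \<kappa>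
    by unfold_locales auto
  \<comment> \<open>One interpretation serves both directions: the hypotheses on \<open>L''\<close>
    and \<open>A''\<close> enter only through the sign condition on \<open>q - Q\<close>.\<close>
  have upper: "\<exists>c. expansion_of_initial (L 0) v u c \<and> (\<forall>t>0. \<forall>\<xi>\<in>{0..L 0}. u \<xi> t \<le> (\<Sum>n. c n * v n \<xi> t))"
    if "\<forall>t\<ge>0. L'' t * L t ^ 3 \<le> \<gamma>0" "\<forall>t\<ge>0. A'' t * L t ^ 3 \<le> \<gamma>1"
    using expansion_bound_mode[of 1, OF _ q_Q_sign] that unfolding v_def by auto
  have lower: "\<exists>c. expansion_of_initial (L 0) v u c \<and> (\<forall>t>0. \<forall>\<xi>\<in>{0..L 0}. u \<xi> t \<ge> (\<Sum>n. c n * v n \<xi> t))"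
    if "\<forall>t\<ge>0. L'' t * L t ^ 3 \<ge> \<gamma>0" "\<forall>t\<ge>0. A'' t * L t ^ 3 \<ge> \<gamma>1"
    using expansion_bound_mode[of "-1", OF _ q_Q_sign] that unfolding v_def by auto
  show ?thesis using upper lower by blast
qed

end
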